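(* Let $(W,H,\mu)$ be an abstract Wiener space with $H$ infinite dimensional, let $\{e_i\}_{i\ge1}$ be a complete orthonormal basis of $H$, let $\alpha>0$, and set $$u(w)=\sum_{i=1}^\infty 2^{-i\alpha}\,\delta(e_{i+1})\,e_i .$$ Then $u\in\mathbb D_{2,1}(H)$ and $\nabla u$ is quasinilpotent, but there is no continuous strictly increasing resolution of the identity on $H$ such that $u$ is adapted to the filtration it induces. In particular, quasinilpotence of $\nabla u$ for $u\in\mathbb D_{2,1}(H)$ does not imply the existence of a filtration (induced by a continuous strictly increasing resolution of the identity) to which $u$ is adapted.
   Context: $(W,H,\mu)$ is an abstract Wiener space: $W$ is a separable Banach space, $H$ (the Cameron-Martin space) is a separable Hilbert space densely and continuously embedded in $W$, $W^*\hookrightarrow H^*=H\hookrightarrow W$, and under $\mu$ each $e\in W^*$ satisfies ${}_{W^*}(e,w)_W\sim N(0,|e|_H^2)$. For $e\in W^*$, $\delta(e)$ denotes the random variable ${}_{W^*}(e,w)_W$; for general $e\in H$, $\delta(e)$ is the $L^2(\mu)$ limit of $\delta(e_n)$ with $e_n\in W^*$, $e_n\to e$ in $H$. $\nabla$ is the Malliavin gradient and $\mathbb D_{2,1}(H)$ is the Sobolev space of $H$-valued $u\in L^2(\mu,H)$ with $\nabla u\in L^2(\mu,H\otimes H)$; $\nabla u$ is regarded as a Hilbert-Schmidt operator on $H$, with $(\nabla u)h=\nabla_hu$. A Hilbert-Schmidt operator on $H$ is quasinilpotent if its spectrum is $\{0\}$. A resolution of the identity is an increasing family of orthogonal projections $\{\pi_\theta,\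 0\le\theta\le1\}$ on $H$ with $\pi_0=0$, $\pi_1=I$; it is continuous if $\theta\mapsto\pi_\theta$ is strongly continuous. The filtration it induces is $\mathcal F_\theta=\sigma\{\delta(\pi_\theta h): h\in H\}$. An $H$-valued random variable $u$ is $\mathcal F_\cdot$-adapted if $(u,\pi_\theta h)_H$ is $\mathcal F_\theta$-measurable for every $\theta\in[0,1]$ and $h\in H$. *)

theory Defs
  imports "HOL-Probability.Probability"
begin

text \<open>
  Throughout, the type \<open>'w\<close> is the separable Banach space \<open>W\<close>, the type \<open>'h\<close> is the separable
  Hilbert space \<open>H\<close> and \<open>j :: 'h \<Rightarrow>\<^sub>L 'w\<close> is the embedding of \<open>H\<close> into \<open>W\<close>.
  Elements of \<open>L\<^sup>2(\<mu>)\<close> are represented by functions, so random variables determined up to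
  \<open>\<mu>\<close>-null sets are described by predicates that single out their versions.
\<close>


section \<open>Hilbert space preliminaries\<close>

definition orthonormal_basis :: "'h::real_inner set \<Rightarrow> bool" where
  "orthonormal_basis B \<longleftrightarrow>
     (\<forall>b\<in>B. norm b = 1) \<and> pairwise orthogonal B \<and> closure (span B) = UNIV"

text \<open>The squared Hilbert-Schmidt norm does not depend on the orthonormal basis chosen.\<close>

definition hs_norm2 :: "('h::{real_inner,banach,second_countable_topology} \<Rightarrow>\<^sub>L 'h) \<Rightarrow> ennreal" where
  "hs_norm2 A =
     (\<integral>\<^sup>+ b. ennreal ((norm (blinfun_apply A b))\<^sup>2) \<partial>count_space (SOME B. orthonormal_basis B))"

text \<open>
  \<open>H\<close> is a real space, so the spectrum is that of the complexification: with \<open>x + \<i>y\<close> encoded as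
  the pair \<open>(x, y)\<close>, the operator below is \<open>A - z\<close> acting on \<open>H + \<i>H\<close>.
\<close>

definition complexified_minus ::
  "('h::real_normed_vector \<Rightarrow>\<^sub>L 'h) \<Rightarrow> complex \<Rightarrow> 'h \<times> 'h \<Rightarrow> 'h \<times> 'h" where
  "complexified_minus A z = (\<lambda>(x, y).
     (blinfun_apply A x - (Re z *\<^sub>R x - Im z *\<^sub>R y),
      blinfun_apply A y - (Re z *\<^sub>R y + Im z *\<^sub>R x)))"

definition op_spectrum :: "('h::real_normed_vector \<Rightarrow>\<^sub>L 'h) \<Rightarrow> complex set" where
  "op_spectrum A = {z. \<not> (\<exists>R :: ('h \<times> 'h) \<Rightarrow>\<^sub>L ('h \<times> 'h).
     (\<forall>p. blinfun_apply R (complexified_minus A z p) = p) \<and>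
     (\<forall>p. complexified_minus A z (blinfun_apply R p) = p))}"

definition quasinilpotent :: "('h::real_normed_vector \<Rightarrow>\<^sub>L 'h) \<Rightarrow> bool" where
  "quasinilpotent A \<longleftrightarrow> op_spectrum A = {0}"

definition orthogonal_projection :: "('h::real_inner \<Rightarrow>\<^sub>L 'h) \<Rightarrow> bool" where
  "orthogonal_projection P \<longleftrightarrow>
     P o\<^sub>L P = P \<and> (\<forall>x y. inner (blinfun_apply P x) y = inner x (blinfun_apply P y))"

text \<open>Only the values of \<open>\<pi>\<close> on the unit interval matter; projections are ordered by their ranges.\<close>

definition resolution_of_identity :: "(real \<Rightarrow> 'h::real_inner \<Rightarrow>\<^sub>L 'h) \<Rightarrow> bool" where
  "resolution_of_identity \<pi> \<longleftrightarrow>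
     (\<forall>\<theta>\<in>{0..1}. orthogonal_projection (\<pi> \<theta>)) \<and>
     (\<forall>\<theta>\<in>{0..1}. \<forall>\<theta>'\<in>{0..1}. \<theta> \<le> \<theta>' \<longrightarrow>
        range (blinfun_apply (\<pi> \<theta>)) \<subseteq> range (blinfun_apply (\<pi> \<theta>'))) \<and>
     \<pi> 0 = 0 \<and> \<pi> 1 = id_blinfun"

definition resolution_continuous :: "(real \<Rightarrow> 'h::real_inner \<Rightarrow>\<^sub>L 'h) \<Rightarrow> bool" where
  "resolution_continuous \<pi> \<longleftrightarrow> (\<forall>h. continuous_on {0..1} (\<lambda>\<theta>. blinfun_apply (\<pi> \<theta>) h))"

definition resolution_strictly_increasing :: "(real \<Rightarrow> 'h::real_inner \<Rightarrow>\<^sub>L 'h) \<Rightarrow> bool" where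
  "resolution_strictly_increasing \<pi> \<longleftrightarrow>
     (\<forall>\<theta>\<in>{0..1}. \<forall>\<theta>'\<in>{0..1}. \<theta> < \<theta>' \<longrightarrow>
        range (blinfun_apply (\<pi> \<theta>)) \<subset> range (blinfun_apply (\<pi> \<theta>')))"


section \<open>Abstract Wiener spaces\<close>

text \<open>The image in \<open>H\<close> of \<open>l \<in> W\<^sup>*\<close> under \<open>W\<^sup>* \<hookrightarrow> H\<^sup>* = H\<close> (Riesz representation of \<open>l \<circ> j\<close>).\<close>

definition dual_embedding ::
  "('h::real_inner \<Rightarrow>\<^sub>L 'w::real_normed_vector) \<Rightarrow> ('w \<Rightarrow>\<^sub>L real) \<Rightarrow> 'h" where
  "dual_embedding j l = (THE h. \<forall>k. blinfun_apply l (blinfun_apply j k) = inner h k)"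

text \<open>
  For \<open>l = 0\<close> the normal law is the point mass at \<open>0\<close>, so the condition is void; for \<open>l \<noteq> 0\<close> the
  image of \<open>l\<close> in \<open>H\<close> is nonzero by density of \<open>H\<close>. The second argument of
  \<open>normal_density\<close> is the standard deviation.
\<close>

definition abstract_wiener_space ::
  "'w::{banach,second_countable_topology} measure \<Rightarrow>
   ('h::{real_inner,banach,second_countable_topology} \<Rightarrow>\<^sub>L 'w) \<Rightarrow> bool" where
  "abstract_wiener_space \<mu> j \<longleftrightarrow>
     prob_space \<mu> \<and> sets \<mu> = sets borel \<and>
     inj (blinfun_apply j) \<and> closure (range (blinfun_apply j)) = UNIV \<and>
     (\<forall>l. l \<noteq> 0 \<longrightarrow> distributed \<mu> lborel (blinfun_apply l)
        (normal_density 0 (norm (dual_embedding j l))))"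

text \<open>\<open>X\<close> is a version of \<open>\<delta>(e)\<close>.\<close>

definition is_delta ::
  "'w::{banach,second_countable_topology} measure \<Rightarrow>
   ('h::{real_inner,banach,second_countable_topology} \<Rightarrow>\<^sub>L 'w) \<Rightarrow> 'h \<Rightarrow> ('w \<Rightarrow> real) \<Rightarrow> bool" where
  "is_delta \<mu> j e X \<longleftrightarrow> X \<in> borel_measurable \<mu> \<and>
     (\<exists>l :: nat \<Rightarrow> 'w \<Rightarrow>\<^sub>L real. (\<lambda>n. dual_embedding j (l n)) \<longlonglongrightarrow> e \<and>
        (\<lambda>n. \<integral>\<^sup>+ w. ennreal ((blinfun_apply (l n) w - X w)\<^sup>2) \<partial>\<mu>) \<longlonglongrightarrow> 0)"


section \<open>The Malliavin gradient\<close>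

text \<open>
  Points of \<open>\<real>\<^sup>n\<close> are encoded by the first \<open>n\<close> values of a function on the naturals.
  Boundedness of the partial derivatives of all orders makes each of them Lipschitz, so the
  functions below are exactly the smooth functions on \<open>\<real>\<^sup>n\<close> bounded with all their derivatives.
\<close>

definition partial_deriv :: "nat \<Rightarrow> ((nat \<Rightarrow> real) \<Rightarrow> real) \<Rightarrow> (nat \<Rightarrow> real) \<Rightarrow> real" where
  "partial_deriv i f = (\<lambda>x. deriv (\<lambda>t. f (x(i := t))) (x i))"

definition smooth_bounded :: "nat \<Rightarrow> ((nat \<Rightarrow> real) \<Rightarrow> real) \<Rightarrow> bool" where
  "smooth_bounded n f \<longleftrightarrow>
     (\<forall>x y. (\<forall>i<n. x i = y i) \<longrightarrow> f x = f y) \<and>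
     (\<forall>is. set is \<subseteq> {..<n} \<longrightarrow>
        bounded (range (foldr partial_deriv is f)) \<and>
        (\<forall>i<n. \<forall>x. (\<lambda>t. foldr partial_deriv is f (x(i := t))) differentiable (at (x i))))"

text \<open>
  \<open>U\<close> is the \<open>H\<close>-valued smooth cylindrical function \<open>\<Sum>\<^sub>k f\<^sub>k(\<delta>(l\<^sub>0),\<dots>,\<delta>(l\<^sub>n\<^sub>-\<^sub>1)) a\<^sub>k\<close> with
  \<open>l\<^sub>i \<in> W\<^sup>*\<close>, \<open>a\<^sub>k \<in> H\<close>, and \<open>G\<close> is its gradient, \<open>G(w) h = \<nabla>\<^sub>h U(w)\<close>; note that the inner
  product in \<open>H\<close> of the image of \<open>l\<^sub>i\<close> with \<open>h\<close> is \<open>l\<^sub>i(j h)\<close>.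
\<close>

definition smooth_cylindrical ::
  "('h::{real_inner,banach,second_countable_topology} \<Rightarrow>\<^sub>L 'w::{banach,second_countable_topology}) \<Rightarrow>
   ('w \<Rightarrow> 'h) \<Rightarrow> ('w \<Rightarrow> 'h \<Rightarrow>\<^sub>L 'h) \<Rightarrow> bool" where
  "smooth_cylindrical j U G \<longleftrightarrow>
     (\<exists>(m :: nat) (n :: nat) (f :: nat \<Rightarrow> (nat \<Rightarrow> real) \<Rightarrow> real)
       (l :: nat \<Rightarrow> 'w \<Rightarrow>\<^sub>L real) (a :: nat \<Rightarrow> 'h).
        (\<forall>k<m. smooth_bounded n (f k)) \<and>
        (\<forall>w. U w = (\<Sum>k<m. f k (\<lambda>i. blinfun_apply (l i) w) *\<^sub>R a k)) \<and>
        (\<forall>w h. blinfun_apply (G w) h =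
           (\<Sum>k<m. (\<Sum>i<n. partial_deriv i (f k) (\<lambda>i. blinfun_apply (l i) w) *
                             blinfun_apply (l i) (blinfun_apply j h)) *\<^sub>R a k)))"

text \<open>
  \<open>D\<close> is a version of \<open>\<nabla>u\<close>, the \<open>L\<^sup>2\<close>-closure of the gradient on smooth cylindrical functions.
  As \<open>H\<close> is separable, measurability of \<open>D\<close> as a Hilbert-Schmidt valued map amounts to
  measurability of \<open>w \<mapsto> D(w) h\<close> for all \<open>h\<close>.
\<close>

definition is_malliavin_gradient ::
  "'w::{banach,second_countable_topology} measure \<Rightarrow>
   ('h::{real_inner,banach,second_countable_topology} \<Rightarrow>\<^sub>L 'w) \<Rightarrow>
   ('w \<Rightarrow> 'h) \<Rightarrow> ('w \<Rightarrow> 'h \<Rightarrow>\<^sub>L 'h) \<Rightarrow> bool" where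
  "is_malliavin_gradient \<mu> j u D \<longleftrightarrow>
     u \<in> borel_measurable \<mu> \<and> (\<integral>\<^sup>+ w. ennreal ((norm (u w))\<^sup>2) \<partial>\<mu>) < \<infinity> \<and>
     (\<forall>h. (\<lambda>w. blinfun_apply (D w) h) \<in> borel_measurable \<mu>) \<and>
     (\<integral>\<^sup>+ w. hs_norm2 (D w) \<partial>\<mu>) < \<infinity> \<and>
     (\<exists>U G. (\<forall>n :: nat. smooth_cylindrical j (U n) (G n)) \<and>
        (\<lambda>n. \<integral>\<^sup>+ w. ennreal ((norm (U n w - u w))\<^sup>2) \<partial>\<mu>) \<longlonglongrightarrow> 0 \<and>
        (\<lambda>n. \<integral>\<^sup>+ w. hs_norm2 (G n w - D w) \<partial>\<mu>) \<longlonglongrightarrow> 0)"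

definition sobolev_D21 ::
  "'w::{banach,second_countable_topology} measure \<Rightarrow>
   ('h::{real_inner,banach,second_countable_topology} \<Rightarrow>\<^sub>L 'w) \<Rightarrow> ('w \<Rightarrow> 'h) set" where
  "sobolev_D21 \<mu> j = {u. \<exists>D. is_malliavin_gradient \<mu> j u D}"

text \<open>\<open>\<nabla>u\<close> is quasinilpotent almost surely, whichever version of it is taken.\<close>

definition quasinilpotent_gradient ::
  "'w::{banach,second_countable_topology} measure \<Rightarrow>
   ('h::{real_inner,banach,second_countable_topology} \<Rightarrow>\<^sub>L 'w) \<Rightarrow> ('w \<Rightarrow> 'h) \<Rightarrow> bool" where
  "quasinilpotent_gradient \<mu> j u \<longleftrightarrow>
     (\<forall>D. is_malliavin_gradient \<mu> j u D \<longrightarrow> (AE w in \<mu>. quasinilpotent (D w)))"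


section \<open>Induced filtrations and adaptedness\<close>

text \<open>
  Since each \<open>\<delta>(h)\<close> is only defined up to null sets, the \<open>\<sigma>\<close>-algebras are augmented by the
  \<open>\<mu>\<close>-null sets, which makes them independent of the versions chosen.
\<close>

definition induced_filtration ::
  "'w measure \<Rightarrow> ('h \<Rightarrow> 'w \<Rightarrow> real) \<Rightarrow> (real \<Rightarrow> 'h::real_normed_vector \<Rightarrow>\<^sub>L 'h) \<Rightarrow>
   real \<Rightarrow> 'w measure" where
  "induced_filtration \<mu> \<delta> \<pi> \<theta> = sigma (space \<mu>)
     ({\<delta> (blinfun_apply (\<pi> \<theta>) h) -` A \<inter> space \<mu> | h A. A \<in> sets borel} \<union> null_sets \<mu>)"

definition adapted ::
  "'w measure \<Rightarrow> ('h \<Rightarrow> 'w \<Rightarrow> real) \<Rightarrow> (real \<Rightarrow> 'h::real_inner \<Rightarrow>\<^sub>L 'h) \<Rightarrow> ('w \<Rightarrow> 'h) \<Rightarrow> bool" where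
  "adapted \<mu> \<delta> \<pi> u \<longleftrightarrow>
     (\<forall>\<theta>\<in>{0..1}. \<forall>h. (\<lambda>w. inner (u w) (blinfun_apply (\<pi> \<theta>) h))
        \<in> borel_measurable (induced_filtration \<mu> \<delta> \<pi> \<theta>))"

end

theory Submission
  imports Defs
begin

text \<open>
  The gradient of \<open>u\<close> is the constant operator \<open>T e\<^bsub>i+1\<^esub> = 2\<^bsup>-i\<alpha>\<^esup> e\<^sub>i\<close>, a weighted backward shift with
  geometric weights: \<open>\<parallel>T\<^sup>n\<parallel>\<close> decays superexponentially, so \<open>T\<close> is quasinilpotent.
  On the other hand \<open>(u, k) = \<delta>(T\<^sup>* k)\<close>. If \<open>u\<close> is adapted, then for \<open>k = \<pi>\<^sub>\<theta> h\<close> the component of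
  \<open>T\<^sup>* k\<close> orthogonal to the range of \<open>\<pi>\<^sub>\<theta>\<close> gives a Gaussian variable that is both measurable with
  respect to and independent of the \<open>\<sigma>\<close>-algebra at \<open>\<theta>\<close>, hence vanishes: every \<open>\<pi>\<^sub>\<theta>\<close> has a range invariant under
  \<open>T\<^sup>*\<close>. By Donoghue's theorem \<open>T\<^sup>*\<close> has only countably many closed invariant subspaces, whereas a
  strictly increasing resolution of the identity has uncountably many ranges.
  Quasinilpotence must hold for every version of the gradient, which requires the closability of the
  gradient, that is Gaussian integration by parts.
\<close>

text \<open>The subspaces occurring here are told apart by one natural number, the first index at
  which some vector of the subspace has a nonzero coordinate. That two nested invariant subspaces
  with the same index coincide is the substance of Donoghue's theorem; it maps the parameters in
  (0,1] injectively into the naturals. The variables \<open>\<delta> h\<close> are accessible only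
  as mean square limits of functionals, so their laws enter through characteristic functions: a
  linear combination is again such a variable, and its transform depends only on the norm of the
  corresponding vector. Independence is therefore derived from factorizing transforms, and a
  variable independent of itself is exploited through \<open>iexp X * iexp (- X) = 1\<close>. Two
  features of the definitions shape the estimates. \<open>hs_norm2\<close> uses an unspecified
  orthonormal basis, so it is bounded by Bessel's inequality, valid in every basis, and not computed
  in the given one. Smooth cylindrical functions are bounded, so a linear functional has to be
  approximated by \<open>sin (s * x) / s\<close> with small \<open>s\<close>.\<close>

abbreviation msq :: "'a measure \<Rightarrow> ('a \<Rightarrow> real) \<Rightarrow> ennreal" where
  "msq M f \<equiv> (\<integral>\<^sup>+ w. ennreal ((f w)\<^sup>2) \<partial>M)"

abbreviation evals :: "(nat \<Rightarrow> 'a::real_normed_vector \<Rightarrow>\<^sub>L real) \<Rightarrow> 'a \<Rightarrow> nat \<Rightarrow> real" where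
  "evals lam w \<equiv> (\<lambda>i. blinfun_apply (lam i) w)"

notation blinfun_apply (infixl "\<cdot>" 998)

section \<open>Orthonormal bases and Hilbert-Schmidt norms\<close>

lemma norm_sum_orthonormal:
  fixes v :: "'i \<Rightarrow> 'h::real_inner"
  assumes "finite I" "\<And>i k. i \<in> I \<Longrightarrow> k \<in> I \<Longrightarrow> inner (v i) (v k) = (if i = k then 1 else 0)"
  shows "(norm (\<Sum>i\<in>I. c i *\<^sub>R v i))\<^sup>2 = (\<Sum>i\<in>I. (c i)\<^sup>2)"
proof -
  have "(norm (\<Sum>i\<in>I. c i *\<^sub>R v i))\<^sup>2 = (\<Sum>i\<in>I. \<Sum>k\<in>I. c i * c k * inner (v i) (v k))"
    by (simp add: power2_norm_eq_inner inner_sum_left inner_sum_right sum_distrib_left mult_ac inner_commute)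
  also have "\<dots> = (\<Sum>i\<in>I. \<Sum>k\<in>I. if i = k then c i * c k else 0)"
    using assms(2) by (intro sum.cong refl) auto
  finally show ?thesis
    using assms(1) by (simp add: power2_eq_square)
qed

lemma bessel_finite:
  fixes x :: "'h::real_inner"
  assumes "finite I" "\<And>i k. i \<in> I \<Longrightarrow> k \<in> I \<Longrightarrow> inner (v i) (v k) = (if i = k then 1 else 0)"
  shows "(\<Sum>i\<in>I. (inner x (v i))\<^sup>2) \<le> (norm x)\<^sup>2"
proof -
  define p where "p = (\<Sum>i\<in>I. inner x (v i) *\<^sub>R v i)"
  have "inner x p = (\<Sum>i\<in>I. (inner x (v i))\<^sup>2)"
    by (simp add: p_def inner_sum_right power2_eq_square)
  moreover have "inner p p = (\<Sum>i\<in>I. (inner x (v i))\<^sup>2)"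
    using norm_sum_orthonormal[OF assms, where c="\<lambda>i. inner x (v i)"] by (simp add: p_def power2_norm_eq_inner)
  moreover have "0 \<le> inner (x - p) (x - p)" by simp
  ultimately show ?thesis
    by (simp add: inner_diff_left inner_diff_right inner_commute power2_norm_eq_inner)
qed

lemma bessel_orthonormal_basis:
  assumes "orthonormal_basis B" "finite F" "F \<subseteq> B"
  shows "(\<Sum>b\<in>F. (inner x b)\<^sup>2) \<le> (norm x)\<^sup>2"
proof (rule bessel_finite)
  fix i k assume "i \<in> F" "k \<in> F"
  then show "inner i k = (if i = k then 1 else 0)"
    using assms unfolding orthonormal_basis_def pairwise_def orthogonal_def
    by (auto simp: norm_eq_1 subset_iff)
qed fact

text \<open>Finite partial sums control the integral although \<open>B\<close> is not assumed
  countable: a simple function below \<open>f\<close> either has finite support in \<open>B\<close>,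
  where its integral is a finite sum, or takes some nonzero value infinitely often, which forces
  \<open>C\<close> to be infinite.\<close>

lemma nn_integral_count_space_le:
  fixes f :: "'a \<Rightarrow> ennreal"
  assumes "\<And>F. finite F \<Longrightarrow> F \<subseteq> B \<Longrightarrow> sum f F \<le> C"
  shows "(\<integral>\<^sup>+ b. f b \<partial>count_space B) \<le> C"
  unfolding nn_integral_def
proof (rule SUP_least, safe)
  fix g assume g: "simple_function (count_space B) g" "g \<le> f"
  have "simple_integral (count_space B) g = (\<integral>\<^sup>+ b. g b \<partial>count_space B)"
    using g(1) by (simp add: nn_integral_eq_simple_integral)
  also have "\<dots> \<le> C"
  proof (cases "finite {b\<in>B. g b \<noteq> 0}")
    case True
    then have "(\<integral>\<^sup>+ b. g b \<partial>count_space B) = (\<Sum>b | b \<in> B \<and> g b \<noteq> 0. g b)"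
      using nn_integral_count_space[of B g] by (simp add: zero_less_iff_neq_zero)
    also have "\<dots> \<le> (\<Sum>b | b \<in> B \<and> g b \<noteq> 0. f b)"
      using g(2) by (intro sum_mono) (auto simp: le_fun_def)
    also have "\<dots> \<le> C" using True by (intro assms) auto
    finally show ?thesis .
  next
    case False
    have fin: "finite (g ` B)" using g(1) by (simp add: simple_function_def)
    have "{b\<in>B. g b \<noteq> 0} = (\<Union>y\<in>g ` B - {0}. {b\<in>B. g b = y})" by auto
    with False fin obtain y where y: "y \<in> g ` B" "y \<noteq> 0" and inf: "infinite {b\<in>B. g b = y}"
      by (metis (no_types, lifting) DiffD1 DiffD2 finite_Diff finite_UN insertI1)
    \<comment> \<open>Any \<open>n\<close> points at which \<open>g\<close> has the value
      \<open>y\<close> form a finite set whose sum is at most \<open>C\<close>.\<close>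
    have "of_nat n * y \<le> C" for n
    proof -
      obtain F where F: "finite F" "card F = n" "F \<subseteq> {b\<in>B. g b = y}"
        using infinite_arbitrarily_large[OF inf] by blast
      have "of_nat n * y = sum g F" using F by (subst sum.cong[OF refl, of F g "\<lambda>_. y"]) auto
      also have "\<dots> \<le> sum f F" using g(2) by (intro sum_mono) (auto simp: le_fun_def)
      also have "\<dots> \<le> C" using F by (intro assms) auto
      finally show ?thesis .
    qed
    then have "(SUP n. of_nat n * y) \<le> C" by (intro SUP_least) auto
    moreover have "(SUP n. of_nat n * y) = (SUP n. of_nat n) * y"
      by (simp add: SUP_mult_right_ennreal)
    ultimately have "C = top"
      using y(2) by (simp add: ennreal_SUP_of_nat_eq_top ennreal_top_mult top_unique)
    then show ?thesis by simp
  qed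
  finally show "simple_integral (count_space B) g \<le> C" .
qed

text \<open>Cauchy-Schwarz on finite combinations of the chosen basis bounds the operator norm by
  the Hilbert-Schmidt norm, and density of the span extends the bound. The hypothesis on
  \<open>B0\<close> guarantees that the \<open>SOME\<close> inside \<open>hs_norm2\<close> denotes
  an orthonormal basis.\<close>

lemma norm_sq_le_hs_norm2:
  fixes A :: "'h::{real_inner,banach,second_countable_topology} \<Rightarrow>\<^sub>L 'h"
  assumes ex: "orthonormal_basis (B0 :: 'h set)" and h: "norm h \<le> 1"
  shows "ennreal ((norm (A \<cdot> h))\<^sup>2) \<le> hs_norm2 A"
proof (cases "hs_norm2 A = top")
  case False
  define B :: "'h set" where "B = (SOME B. orthonormal_basis B)"
  have B: "orthonormal_basis B" unfolding B_def using ex by (rule someI)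
  define C where "C = enn2real (hs_norm2 A)"
  have C: "hs_norm2 A = ennreal C" "C \<ge> 0" using False by (simp_all add: C_def less_top)
  have fin: "(\<Sum>b\<in>F. (norm (A b))\<^sup>2) \<le> C" if "finite F" "F \<subseteq> B" for F
  proof -
    have "ennreal (\<Sum>b\<in>F. (norm (A b))\<^sup>2) = (\<integral>\<^sup>+ b. ennreal ((norm (A b))\<^sup>2) \<partial>count_space F)"
      using that by (simp add: nn_integral_count_space_finite)
    also have "\<dots> = (\<integral>\<^sup>+ b. ennreal ((norm (A b))\<^sup>2) * indicator F b \<partial>count_space B)"
      using that by (subst nn_integral_count_space_indicator[of F], simp,
        subst nn_integral_count_space_indicator[of B], simp)
       (auto intro!: nn_integral_cong split: split_indicator)
    also have "\<dots> \<le> hs_norm2 A"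
      unfolding hs_norm2_def B_def[symmetric] by (intro nn_integral_mono) (auto split: split_indicator)
    finally show ?thesis using C by simp
  qed
  have "span B \<subseteq> {h. norm (A h) \<le> sqrt C * norm h}"
  proof safe
    fix h assume "h \<in> span B"
    then obtain F c where F: "finite F" "F \<subseteq> B" and h: "h = (\<Sum>b\<in>F. c b *\<^sub>R b)"
      unfolding span_explicit by auto
    have o: "inner i k = (if i = k then 1 else 0)" if "i \<in> F" "k \<in> F" for i k
      using B F that unfolding orthonormal_basis_def pairwise_def orthogonal_def
      by (auto simp: norm_eq_1 subset_iff)
    have nh: "(norm h)\<^sup>2 = (\<Sum>b\<in>F. (c b)\<^sup>2)"
      using norm_sum_orthonormal[OF F(1), of "\<lambda>b. b" c] o by (simp add: h)
    have "norm (A h) \<le> (\<Sum>b\<in>F. \<bar>c b\<bar> * norm (A b))"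
      by (simp add: h blinfun.sum_right blinfun.scaleR_right sum_norm_le)
    then have "(norm (A h))\<^sup>2 \<le> (\<Sum>b\<in>F. \<bar>c b\<bar> * norm (A b))\<^sup>2" by (intro power_mono) auto
    also have "\<dots> \<le> (\<Sum>b\<in>F. \<bar>c b\<bar>\<^sup>2) * (\<Sum>b\<in>F. (norm (A b))\<^sup>2)" by (rule Cauchy_Schwarz_ineq_sum)
    also have "\<dots> \<le> (norm h)\<^sup>2 * C" using fin[OF F] by (auto simp: nh intro!: mult_left_mono sum_nonneg)
    finally have "norm (A h) \<le> sqrt ((norm h)\<^sup>2 * C)" by (simp add: real_le_rsqrt)
    then show "norm (A h) \<le> sqrt C * norm h" by (simp add: real_sqrt_mult mult.commute)
  qed
  moreover have "closed {h. norm (A h) \<le> sqrt C * norm h}"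
    by (intro closed_Collect_le continuous_intros)
  ultimately have "closure (span B) \<subseteq> {h. norm (A h) \<le> sqrt C * norm h}" by (rule closure_minimal)
  then have "norm (A h) \<le> sqrt C * norm h" using B by (auto simp: orthonormal_basis_def)
  also have "\<dots> \<le> sqrt C" using h C(2) by (simp add: mult_left_le)
  finally have "(norm (A h))\<^sup>2 \<le> C" using C(2) by (simp add: sqrt_ge_absD)
  then show ?thesis using C by simp
qed simp

text \<open>The \<open>v k\<close> play the role of the rows of \<open>A\<close>. Exchanging the sum
  over the rows with the sum over the basis picked by \<open>hs_norm2\<close> leaves one Bessel sum
  per row, so different bases never have to be compared.\<close>

lemma hs_norm2_bound:
  fixes A :: "'h::{real_inner,banach,second_countable_topology} \<Rightarrow>\<^sub>L 'h"
  assumes ex: "orthonormal_basis (B0 :: 'h set)"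
    and A: "\<And>h. ennreal ((norm (A \<cdot> h))\<^sup>2) \<le> (\<Sum>k. ennreal ((inner (v k) h)\<^sup>2))"
  shows "hs_norm2 A \<le> (\<Sum>k. ennreal ((norm (v k))\<^sup>2))"
proof -
  define B :: "'h set" where "B = (SOME B. orthonormal_basis B)"
  have B: "orthonormal_basis B" unfolding B_def using ex by (rule someI)
  have "hs_norm2 A \<le> (\<integral>\<^sup>+ b. (\<Sum>k. ennreal ((inner (v k) b)\<^sup>2)) \<partial>count_space B)"
    unfolding hs_norm2_def B_def[symmetric] by (intro nn_integral_mono A)
  also have "\<dots> = (\<Sum>k. \<integral>\<^sup>+ b. ennreal ((inner (v k) b)\<^sup>2) \<partial>count_space B)"
    by (rule nn_integral_suminf) simp
  also have "\<dots> \<le> (\<Sum>k. ennreal ((norm (v k))\<^sup>2))"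
    by (intro suminf_le summableI nn_integral_count_space_le)
       (use bessel_orthonormal_basis[OF B] in auto)
  finally show ?thesis .
qed

locale hilbert_basis =
  fixes b :: "nat \<Rightarrow> 'h::{real_inner,banach,second_countable_topology}"
  assumes orthonormal: "inner (b i) (b k) = (if i = k then 1 else 0)"
    and dense: "closure (span (range b)) = UNIV"
begin

lemma norm_b [simp]: "norm (b i) = 1"
  by (simp add: norm_eq_1 orthonormal)

lemma orthonormal_basis_range: "orthonormal_basis (range b)"
  unfolding orthonormal_basis_def pairwise_def orthogonal_def by (auto simp: orthonormal dense)

lemma bessel_lessThan: "(\<Sum>k<n. (inner x (b k))\<^sup>2) \<le> (norm x)\<^sup>2"
  by (rule bessel_finite) (auto simp: orthonormal)

text \<open>Bessel makes every partial sum operator a contraction, and on a vector of the span these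
  operators are eventually the identity; density does the rest.\<close>

lemma expansion: "(\<lambda>k. inner x (b k) *\<^sub>R b k) sums x"
  unfolding sums_def
proof (rule LIMSEQ_I)
  define S where "S = (\<lambda>n x. \<Sum>k<n. inner x (b k) *\<^sub>R b k)"
  have Sle: "norm (S n x) \<le> norm x" for n x
  proof -
    have "(norm (S n x))\<^sup>2 = (\<Sum>k<n. (inner x (b k))\<^sup>2)"
      unfolding S_def by (rule norm_sum_orthonormal) (auto simp: orthonormal)
    also have "\<dots> \<le> (norm x)\<^sup>2" by (rule bessel_lessThan)
    finally show ?thesis by (simp add: abs_le_square_iff[symmetric])
  qed
  have Sdiff: "S n (x - y) = S n x - S n y" for n x y
    by (simp add: S_def inner_diff_left scaleR_left_diff_distrib sum_subtractf)
  fix \<epsilon> :: real assume \<epsilon>: "\<epsilon> > 0"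
  have "x \<in> closure (span (range b))" by (simp add: dense)
  then obtain y where y: "y \<in> span (range b)" "dist y x < \<epsilon> / 2"
    using \<epsilon> by (meson closure_approachable half_gt_zero)
  have "\<exists>N. \<forall>n\<ge>N. S n y = y"
    using y(1)
  proof (induction rule: span_induct_alt)
    case base
    then show ?case by (simp add: S_def)
  next
    case (step c z y)
    then obtain N i where N: "\<And>n. n \<ge> N \<Longrightarrow> S n y = y" and i: "z = b i" by auto
    have "S n (c *\<^sub>R z + y) = c *\<^sub>R z + y" if "n \<ge> max N (Suc i)" for n
    proof -
      have "S n (c *\<^sub>R z + y) = (\<Sum>k<n. (if k = i then c *\<^sub>R b k else 0)) + S n y"
        unfolding S_def sum.distrib[symmetric]
        by (intro sum.cong) (auto simp: i orthonormal inner_add_left algebra_simps)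
      then show ?thesis using that N by (simp add: i)
    qed
    then show ?case by blast
  qed
  then obtain N where N: "\<And>n. n \<ge> N \<Longrightarrow> S n y = y" by blast
  have "norm (S n x - x) < \<epsilon>" if "n \<ge> N" for n
  proof -
    have "S n x - x = S n (x - y) + (y - x)" using N[OF that] by (simp add: Sdiff)
    then have "norm (S n x - x) \<le> norm (S n (x - y)) + norm (y - x)" by (simp only: norm_triangle_ineq)
    also have "\<dots> \<le> norm (x - y) + norm (y - x)" using Sle by simp
    also have "\<dots> < \<epsilon>" using y(2) by (simp add: dist_norm norm_minus_commute)
    finally show ?thesis .
  qed
  then show "\<exists>N. \<forall>n\<ge>N. norm ((\<Sum>k<n. inner x (b k) *\<^sub>R b k) - x) < \<epsilon>"
    unfolding S_def by blast
qed

lemma parseval_sums: "(\<lambda>k. (inner x (b k))\<^sup>2) sums (norm x)\<^sup>2"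
proof -
  have "(\<lambda>n. (norm (\<Sum>k<n. inner x (b k) *\<^sub>R b k))\<^sup>2) \<longlonglongrightarrow> (norm x)\<^sup>2"
    by (intro tendsto_intros) (use expansion in \<open>simp add: sums_def\<close>)
  moreover have "(norm (\<Sum>k<n. inner x (b k) *\<^sub>R b k))\<^sup>2 = (\<Sum>k<n. (inner x (b k))\<^sup>2)" for n
    by (rule norm_sum_orthonormal) (auto simp: orthonormal)
  ultimately show ?thesis by (simp add: sums_def)
qed

lemma parseval_ennreal: "(\<Sum>k. ennreal ((inner x (b k))\<^sup>2)) = ennreal ((norm x)\<^sup>2)"
  using parseval_sums[of x] by (intro sums_unique[symmetric]) (simp add: sums_ennreal)

lemma coord_eqI: "(\<And>k. inner x (b k) = inner y (b k)) \<Longrightarrow> x = y"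
  using expansion[of x] expansion[of y] sums_unique2 by simp

text \<open>Riesz-Fischer: by Pythagoras the Cauchy criterion for the squared coefficients becomes
  the Cauchy criterion for the vector series, and completeness gives the sum.\<close>

lemma riesz_sum:
  assumes "\<And>n. (\<Sum>k<n. (c k)\<^sup>2) \<le> C"
  shows "summable (\<lambda>k. c k *\<^sub>R b k)" "inner (\<Sum>k. c k *\<^sub>R b k) (b i) = c i"
proof -
  have s: "summable (\<lambda>k. (c k)\<^sup>2)" using assms by (intro summableI_nonneg_bounded) auto
  show *: "summable (\<lambda>k. c k *\<^sub>R b k)"
    unfolding summable_Cauchy
  proof safe
    fix \<epsilon> :: real assume "\<epsilon> > 0"
    then have "\<epsilon>\<^sup>2 > 0" by simp
    then obtain N where N: "\<And>m n. m \<ge> N \<Longrightarrow> norm (\<Sum>k=m..<n. (c k)\<^sup>2) < \<epsilon>\<^sup>2"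
      using s unfolding summable_Cauchy by blast
    have "norm (\<Sum>k=m..<n. c k *\<^sub>R b k) < \<epsilon>" if "m \<ge> N" for m n
    proof -
      have "(norm (\<Sum>k=m..<n. c k *\<^sub>R b k))\<^sup>2 = (\<Sum>k=m..<n. (c k)\<^sup>2)"
        by (rule norm_sum_orthonormal) (auto simp: orthonormal)
      also have "\<dots> < \<epsilon>\<^sup>2" using N[OF that, of n] by (simp add: sum_nonneg)
      finally show ?thesis using \<open>\<epsilon> > 0\<close> by (simp add: power_less_imp_less_base)
    qed
    then show "\<exists>N. \<forall>m\<ge>N. \<forall>n. norm (\<Sum>k=m..<n. c k *\<^sub>R b k) < \<epsilon>" by blast
  qed
  have "(\<lambda>k. inner (c k *\<^sub>R b k) (b i)) sums inner (\<Sum>k. c k *\<^sub>R b k) (b i)"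
    using bounded_linear.sums[OF bounded_linear_inner_left summable_sums[OF *]] .
  moreover have "(\<lambda>k. inner (c k *\<^sub>R b k) (b i)) = (\<lambda>k. if k = i then c k else 0)"
    by (auto simp: orthonormal)
  ultimately show "inner (\<Sum>k. c k *\<^sub>R b k) (b i) = c i"
    using sums_single[of i c] sums_unique2 by force
qed

text \<open>\<open>dual_embedding\<close> is a definite description, so existence and uniqueness are
  both needed. Evaluating \<open>f\<close> at a finite sum of the vectors
  \<open>f (b k) *\<^sub>R b k\<close> returns the square of its norm, whence the bound of the
  square sums by that of \<open>norm f\<close>.\<close>

lemma riesz:
  fixes f :: "'h \<Rightarrow>\<^sub>L real"
  shows "\<exists>!h. \<forall>k. f \<cdot> k = inner h k"
proof -
  have bd: "(\<Sum>k<n. (f (b k))\<^sup>2) \<le> (norm f)\<^sup>2" for n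
  proof -
    let ?x = "\<Sum>k<n. f (b k) *\<^sub>R b k"
    have nx: "(norm ?x)\<^sup>2 = (\<Sum>k<n. (f (b k))\<^sup>2)"
      by (rule norm_sum_orthonormal) (auto simp: orthonormal)
    have "(norm ?x)\<^sup>2 = f ?x"
      unfolding nx by (simp add: blinfun.sum_right blinfun.scaleR_right power2_eq_square)
    also have "\<dots> \<le> norm f * norm ?x" using norm_blinfun[of f ?x] by simp
    finally have "norm ?x \<le> norm f"
      by (cases "norm ?x = 0") (simp_all add: power2_eq_square)
    then show ?thesis by (simp add: nx[symmetric] power_mono)
  qed
  define h where "h = (\<Sum>k. f (b k) *\<^sub>R b k)"
  have hb: "inner h (b i) = f (b i)" for i unfolding h_def by (rule riesz_sum(2)[OF bd])
  have "f k = inner h k" for k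
  proof -
    have "(\<lambda>i. f (inner k (b i) *\<^sub>R b i)) sums f k"
      using bounded_linear.sums[OF blinfun.bounded_linear_right expansion] .
    moreover have "(\<lambda>i. inner h (inner k (b i) *\<^sub>R b i)) sums inner h k"
      using bounded_linear.sums[OF bounded_linear_inner_right expansion] .
    ultimately show ?thesis by (simp add: blinfun.scaleR_right hb sums_unique2)
  qed
  then show ?thesis
    by (intro ex1I[of _ h]) (auto intro!: coord_eqI simp: hb[symmetric])
qed

end

section \<open>The Gaussian functionals\<close>

lemma nn_sq_add:
  fixes f g :: "'a \<Rightarrow> real"
  assumes [measurable]: "f \<in> borel_measurable M" "g \<in> borel_measurable M"
  shows "msq M (\<lambda>w. f w + g w) \<le> 2 * msq M f + 2 * msq M g"
proof -
  have "msq M (\<lambda>w. f w + g w) \<le> (\<integral>\<^sup>+ w. 2 * ennreal ((f w)\<^sup>2) + 2 * ennreal ((g w)\<^sup>2) \<partial>M)"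
  proof (intro nn_integral_mono)
    fix w
    have "0 \<le> (f w - g w)\<^sup>2" by simp
    then have "(f w + g w)\<^sup>2 \<le> 2 * (f w)\<^sup>2 + 2 * (g w)\<^sup>2" by (simp add: power2_sum power2_diff)
    then have "ennreal ((f w + g w)\<^sup>2) \<le> ennreal (2 * (f w)\<^sup>2 + 2 * (g w)\<^sup>2)" by (rule ennreal_leI)
    then show "ennreal ((f w + g w)\<^sup>2) \<le> 2 * ennreal ((f w)\<^sup>2) + 2 * ennreal ((g w)\<^sup>2)"
      by (simp add: ennreal_mult')
  qed
  then show ?thesis by (simp add: nn_integral_add nn_integral_cmult)
qed

lemma nn_sq_cmult:
  fixes f :: "'a \<Rightarrow> real"
  assumes [measurable]: "f \<in> borel_measurable M"
  shows "msq M (\<lambda>w. c * f w) = ennreal (c\<^sup>2) * msq M f"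
  by (simp add: power_mult_distrib ennreal_mult nn_integral_cmult)

lemma ennreal_square_tendsto_0D:
  fixes x :: "nat \<Rightarrow> ennreal"
  assumes "(\<lambda>n. (x n)\<^sup>2) \<longlonglongrightarrow> 0"
  shows "x \<longlonglongrightarrow> 0"
proof (rule order_tendstoI)
  fix a :: ennreal assume "0 < a"
  then have "0 < a\<^sup>2" by (simp add: zero_less_iff_neq_zero)
  from order_tendstoD(2)[OF assms this] show "\<forall>\<^sub>F n in sequentially. x n < a"
    by eventually_elim (metis leD leI power_mono zero_le)
qed auto

lemma L2_pairing_tendsto_0:
  fixes f :: "nat \<Rightarrow> 'a \<Rightarrow> real"
  assumes [measurable]: "\<And>n. f n \<in> borel_measurable M" "q \<in> borel_measurable M"
    and f: "(\<lambda>n. msq M (f n)) \<longlonglongrightarrow> 0"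
    and q: "msq M q < \<infinity>"
  shows "(\<lambda>n. \<integral>\<^sup>+ w. ennreal \<bar>f n w * q w\<bar> \<partial>M) \<longlonglongrightarrow> 0"
proof (rule ennreal_square_tendsto_0D)
  have le: "(\<integral>\<^sup>+ w. ennreal \<bar>f n w * q w\<bar> \<partial>M)\<^sup>2 \<le> msq M (f n) * msq M q" for n
    using Cauchy_Schwarz_nn_integral[of "\<lambda>w. ennreal \<bar>f n w\<bar>" M "\<lambda>w. ennreal \<bar>q w\<bar>"]
    by (simp add: ennreal_power abs_mult ennreal_mult)
  have lim: "(\<lambda>n. msq M (f n) * msq M q) \<longlonglongrightarrow> 0"
    using tendsto_mult_ennreal[OF f tendsto_const[of "msq M q"]] q by auto
  show "(\<lambda>n. (\<integral>\<^sup>+ w. ennreal \<bar>f n w * q w\<bar> \<partial>M)\<^sup>2) \<longlonglongrightarrow> 0"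
    by (rule tendsto_sandwich[OF _ _ tendsto_const lim]) (auto intro!: always_eventually le)
qed

lemma integral_tendsto_L1:
  fixes f :: "nat \<Rightarrow> 'a \<Rightarrow> 'b::{banach,second_countable_topology}"
  assumes "\<And>n. integrable M (f n)" "integrable M g"
    and "(\<lambda>n. \<integral>\<^sup>+ w. ennreal (norm (f n w - g w)) \<partial>M) \<longlonglongrightarrow> 0"
  shows "(\<lambda>n. integral\<^sup>L M (f n)) \<longlonglongrightarrow> integral\<^sup>L M g"
proof -
  have "(\<lambda>n. ennreal (norm (integral\<^sup>L M (f n) - integral\<^sup>L M g))) \<longlonglongrightarrow> 0"
  proof (rule tendsto_sandwich[OF _ _ tendsto_const assms(3)])
    show "\<forall>\<^sub>F n in sequentially. ennreal (norm (integral\<^sup>L M (f n) - integral\<^sup>L M g))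
        \<le> (\<integral>\<^sup>+ w. ennreal (norm (f n w - g w)) \<partial>M)"
    proof (intro always_eventually allI)
      fix n
      have "integral\<^sup>L M (f n) - integral\<^sup>L M g = integral\<^sup>L M (\<lambda>w. f n w - g w)"
        using assms(1,2) by simp
      then show "ennreal (norm (integral\<^sup>L M (f n) - integral\<^sup>L M g))
        \<le> (\<integral>\<^sup>+ w. ennreal (norm (f n w - g w)) \<partial>M)"
        using assms(1,2) by (simp only:) (intro integral_norm_bound_ennreal Bochner_Integration.integrable_diff)
    qed
  qed simp
  then have "(\<lambda>n. norm (integral\<^sup>L M (f n) - integral\<^sup>L M g)) \<longlonglongrightarrow> 0"
    by (subst (asm) ennreal_0[symmetric], subst (asm) tendsto_ennreal_iff) auto
  then show ?thesis by (simp add: tendsto_norm_zero_iff LIM_zero_iff)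
qed

lemma integrable_L2_mult:
  fixes f g :: "'a \<Rightarrow> real"
  assumes [measurable]: "f \<in> borel_measurable M" "g \<in> borel_measurable M"
    and f: "msq M f < \<infinity>" and g: "msq M g < \<infinity>"
  shows "integrable M (\<lambda>w. f w * g w)"
proof (rule integrableI_bounded)
  have "(\<integral>\<^sup>+ w. ennreal (norm (f w * g w)) \<partial>M) \<le> (\<integral>\<^sup>+ w. ennreal ((f w)\<^sup>2) + ennreal ((g w)\<^sup>2) \<partial>M)"
  proof (intro nn_integral_mono)
    fix w
    have "0 \<le> (\<bar>f w\<bar> - \<bar>g w\<bar>)\<^sup>2" by simp
    moreover have "0 \<le> \<bar>f w\<bar> * \<bar>g w\<bar>" by simp
    ultimately have "\<bar>f w\<bar> * \<bar>g w\<bar> \<le> (f w)\<^sup>2 + (g w)\<^sup>2" unfolding power2_diff power2_abs by linarith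
    then show "ennreal (norm (f w * g w)) \<le> ennreal ((f w)\<^sup>2) + ennreal ((g w)\<^sup>2)"
      by (simp add: abs_mult ennreal_plus[symmetric] ennreal_leI del: ennreal_plus)
  qed
  also have "\<dots> < \<infinity>" using f g by (simp add: nn_integral_add)
  finally show "(\<integral>\<^sup>+ w. ennreal (norm (f w * g w)) \<partial>M) < \<infinity>" .
qed simp

section \<open>Functionals on the Wiener space and their mean square limits\<close>

locale wiener_space = hilbert_basis b
  for b :: "nat \<Rightarrow> 'h::{real_inner,banach,second_countable_topology}" +
  fixes \<mu> :: "'w::{banach,second_countable_topology} measure"
    and j :: "'h \<Rightarrow>\<^sub>L 'w"
  assumes wiener: "abstract_wiener_space \<mu> j"
begin

sublocale prob_space \<mu>
  using wiener by (simp add: abstract_wiener_space_def)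

lemma sets_mu [measurable_cong]: "sets \<mu> = sets borel"
  using wiener by (simp add: abstract_wiener_space_def)

lemma space_mu [simp]: "space \<mu> = UNIV"
  using sets_eq_imp_space_eq[OF sets_mu] by simp

lemma measurable_of_continuous:
  fixes f :: "'w \<Rightarrow> 'b::topological_space"
  assumes "continuous_on UNIV f"
  shows "f \<in> borel_measurable \<mu>"
  using borel_measurable_continuous_onI[OF assms] by (simp add: measurable_cong_sets[OF sets_mu refl])

lemma measurable_functional [measurable]: "blinfun_apply (l :: 'w \<Rightarrow>\<^sub>L real) \<in> borel_measurable \<mu>"
  by (intro measurable_of_continuous continuous_intros)

lemma dual_embedding: "l \<cdot> (j \<cdot> k) = inner (dual_embedding j l) k"
proof -
  have "\<exists>!h. \<forall>k. l \<cdot> (j \<cdot> k) = inner h k"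
    using riesz[of "l o\<^sub>L j"] by simp
  from theI'[OF this] show ?thesis unfolding dual_embedding_def by blast
qed

lemma inner_right_eqI: "(\<And>k. inner x k = inner y k) \<Longrightarrow> x = (y :: 'h)"
  by (metis vector_eq_rdot)

lemma dual_embedding_lin: "dual_embedding j (l + s *\<^sub>R l') = dual_embedding j l + s *\<^sub>R dual_embedding j l'"
  by (rule inner_right_eqI)
     (simp add: dual_embedding[symmetric] blinfun.add_left blinfun.scaleR_left inner_add_left)

lemma dual_embedding_scale: "dual_embedding j (s *\<^sub>R l) = s *\<^sub>R dual_embedding j l"
  by (rule inner_right_eqI)
     (simp add: dual_embedding[symmetric] blinfun.scaleR_left)

lemma dual_embedding_0 [simp]: "dual_embedding j 0 = 0"
  by (rule inner_right_eqI) (simp add: dual_embedding[symmetric])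

lemma dual_embedding_nonzero:
  assumes "l \<noteq> 0" shows "dual_embedding j l \<noteq> 0"
proof
  assume "dual_embedding j l = 0"
  then have "range (blinfun_apply j) \<subseteq> {w. l \<cdot> w = 0}" by (auto simp: dual_embedding)
  moreover have "closed {w. l \<cdot> w = 0}" by (intro closed_Collect_eq continuous_intros)
  ultimately have "closure (range (blinfun_apply j)) \<subseteq> {w. l \<cdot> w = 0}" by (rule closure_minimal)
  then have "l = 0" using wiener by (intro blinfun_eqI) (auto simp: abstract_wiener_space_def)
  with assms show False by simp
qed

lemma functional_normalized:
  assumes "norm (dual_embedding j l) = 1"
  shows "distr \<mu> borel (blinfun_apply l) = std_normal_distribution"
proof -
  have "l \<noteq> 0" using assms by auto
  then have "distributed \<mu> lborel (blinfun_apply l) std_normal_density"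
    using wiener assms unfolding abstract_wiener_space_def by metis
  then have "distr \<mu> lborel (blinfun_apply l) = std_normal_distribution"
    by (simp add: distributed_distr_eq_density)
  moreover have "distr \<mu> borel (blinfun_apply l) = distr \<mu> lborel (blinfun_apply l)"
    by (rule distr_cong) auto
  ultimately show ?thesis by simp
qed

lemma functional_char: "(CLINT w|\<mu>. iexp (l \<cdot> w)) = exp (- ((norm (dual_embedding j l))\<^sup>2) / 2)"
\<comment> \<open>\<open>abstract_wiener_space\<close> is silent about the zero functional, whose
  exponential is the constant 1.\<close>
proof (cases "l = 0")
  case True
  then show ?thesis using prob_space by simp
next
  case False
  define s where "s = norm (dual_embedding j l)"
  have s: "s > 0" using dual_embedding_nonzero[OF False] by (simp add: s_def)
  define l' where "l' = (1 / s) *\<^sub>R l"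
  have "norm (dual_embedding j l') = 1" using s by (simp add: l'_def dual_embedding_scale) (simp add: s_def)
  note d = functional_normalized[OF this]
  have "(CLINT w|\<mu>. iexp (l \<cdot> w)) = (CLINT w|\<mu>. iexp (s * l' \<cdot> w))"
    using s by (simp add: l'_def blinfun.scaleR_left)
  also have "\<dots> = char (distr \<mu> borel (blinfun_apply l')) s"
    unfolding char_def by (subst integral_distr) auto
  finally show ?thesis by (simp add: d char_std_normal_distribution s_def)
qed

lemma functional_square: "msq \<mu> (\<lambda>w. l \<cdot> w) = ennreal ((norm (dual_embedding j l))\<^sup>2)"
proof (cases "l = 0")
  case False
  define s where "s = norm (dual_embedding j l)"
  have s: "s > 0" using dual_embedding_nonzero[OF False] by (simp add: s_def)
  have "distributed \<mu> lborel (blinfun_apply l) (normal_density 0 s)"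
    using wiener False unfolding abstract_wiener_space_def s_def by metis
  from distributed_nn_integral[OF this, of "\<lambda>x. ennreal (x\<^sup>2)"]
  have "msq \<mu> (\<lambda>w. l \<cdot> w) = (\<integral>\<^sup>+ x. ennreal (normal_density 0 s x * x\<^sup>2) \<partial>lborel)"
    by (simp add: ennreal_mult)
  also have "has_bochner_integral lborel (\<lambda>x. normal_density 0 s x * x\<^sup>2) (s\<^sup>2)"
    using normal_moment_even[OF s, of 0 1] by (simp add: fact_numeral)
  then have "(\<integral>\<^sup>+ x. ennreal (normal_density 0 s x * x\<^sup>2) \<partial>lborel) = ennreal (s\<^sup>2)"
    by (subst nn_integral_eq_integral) (auto dest: has_bochner_integral_integral_eq integrable.intros)
  finally show ?thesis by (simp add: s_def)
qed simp

lemma delta_borel: "is_delta \<mu> j e X \<Longrightarrow> X \<in> borel_measurable \<mu>"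
  by (simp add: is_delta_def)

lemma is_delta_functional: "is_delta \<mu> j (dual_embedding j l) (blinfun_apply l)"
  unfolding is_delta_def by (auto intro!: exI[of _ "\<lambda>_. l"])

lemma is_delta_lin:
  assumes "is_delta \<mu> j x X" "is_delta \<mu> j y Y"
  shows "is_delta \<mu> j (x + s *\<^sub>R y) (\<lambda>w. X w + s * Y w)"
proof -
  note [measurable] = assms[THEN delta_borel]
  obtain l where l: "(\<lambda>n. dual_embedding j (l n)) \<longlonglongrightarrow> x"
    "(\<lambda>n. msq \<mu> (\<lambda>w. l n \<cdot> w - X w)) \<longlonglongrightarrow> 0"
    using assms(1) unfolding is_delta_def by auto
  obtain l' where l': "(\<lambda>n. dual_embedding j (l' n)) \<longlonglongrightarrow> y"
    "(\<lambda>n. msq \<mu> (\<lambda>w. l' n \<cdot> w - Y w)) \<longlonglongrightarrow> 0"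
    using assms(2) unfolding is_delta_def by auto
  let ?A = "\<lambda>n. msq \<mu> (\<lambda>w. l n \<cdot> w - X w)" and ?B = "\<lambda>n. msq \<mu> (\<lambda>w. l' n \<cdot> w - Y w)"
  let ?C = "\<lambda>n. msq \<mu> (\<lambda>w. (l n + s *\<^sub>R l' n) \<cdot> w - (X w + s * Y w))"
  show ?thesis unfolding is_delta_def
  proof (intro conjI exI[of _ "\<lambda>n. l n + s *\<^sub>R l' n"])
    show "(\<lambda>n. dual_embedding j (l n + s *\<^sub>R l' n)) \<longlonglongrightarrow> x + s *\<^sub>R y"
      unfolding dual_embedding_lin by (intro tendsto_intros l l')
    have "?C n = msq \<mu> (\<lambda>w. (l n \<cdot> w - X w) + s * (l' n \<cdot> w - Y w))" for n
      by (simp add: blinfun.add_left blinfun.scaleR_left algebra_simps)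
    also have "\<dots> n \<le> 2 * ?A n + 2 * (ennreal (s\<^sup>2) * ?B n)" for n
      by (subst nn_sq_cmult[symmetric], simp, rule nn_sq_add) auto
    finally have le: "?C n \<le> 2 * ?A n + 2 * (ennreal (s\<^sup>2) * ?B n)" for n .
    have "(\<lambda>n. 2 * ?A n + 2 * (ennreal (s\<^sup>2) * ?B n)) \<longlonglongrightarrow> 2 * 0 + 2 * (ennreal (s\<^sup>2) * 0)"
      by (intro tendsto_add ennreal_tendsto_cmult l l') auto
    then have lim: "(\<lambda>n. 2 * ?A n + 2 * (ennreal (s\<^sup>2) * ?B n)) \<longlonglongrightarrow> 0" by simp
    show "(\<lambda>n. ?C n) \<longlonglongrightarrow> 0"
      by (rule tendsto_sandwich[OF _ _ tendsto_const lim]) (auto intro!: always_eventually le)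
  qed auto
qed

lemma is_delta_0: "is_delta \<mu> j 0 (\<lambda>_. 0)"
  using is_delta_functional[of 0] by (simp add: zero_blinfun.rep_eq)

lemma is_delta_sum:
  assumes "\<And>i. i \<in> I \<Longrightarrow> is_delta \<mu> j (x i) (X i)"
  shows "is_delta \<mu> j (\<Sum>i\<in>I. s i *\<^sub>R x i) (\<lambda>w. \<Sum>i\<in>I. s i * X i w)"
  using assms
proof (induction I rule: infinite_finite_induct)
  case (insert i I)
  have "is_delta \<mu> j ((\<Sum>i\<in>I. s i *\<^sub>R x i) + s i *\<^sub>R x i) (\<lambda>w. (\<Sum>i\<in>I. s i * X i w) + s i * X i w)"
    using insert by (intro is_delta_lin) auto
  then show ?case using insert by (simp add: add.commute)
qed (auto simp: is_delta_0)

text \<open>The factor 2 comes from \<open>nn_sq_add\<close>, the quasi-triangle inequality for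
  \<open>msq\<close>. The exact second moment is the squared norm; the cruder bound is enough for
  finiteness, for convergence to zero and for summable majorants.\<close>

lemma is_delta_square_le:
  assumes "is_delta \<mu> j x X"
  shows "msq \<mu> X \<le> ennreal (2 * (norm x)\<^sup>2)"
proof -
  note [measurable] = assms[THEN delta_borel]
  obtain l where l: "(\<lambda>n. dual_embedding j (l n)) \<longlonglongrightarrow> x"
    "(\<lambda>n. msq \<mu> (\<lambda>w. l n \<cdot> w - X w)) \<longlonglongrightarrow> 0"
    using assms(1) unfolding is_delta_def by auto
  have "msq \<mu> X = msq \<mu> (\<lambda>w. l n \<cdot> w + (-1) * (l n \<cdot> w - X w))" for n
    by simp
  also have "\<dots> n \<le> 2 * msq \<mu> (\<lambda>w. l n \<cdot> w)
     + 2 * (ennreal ((-1)\<^sup>2) * msq \<mu> (\<lambda>w. l n \<cdot> w - X w))" for n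
    by (subst nn_sq_cmult[symmetric], simp, rule nn_sq_add) auto
  finally have le: "msq \<mu> X \<le> 2 * ennreal ((norm (dual_embedding j (l n)))\<^sup>2)
     + 2 * msq \<mu> (\<lambda>w. l n \<cdot> w - X w)" for n
    by (simp add: functional_square)
  have "(\<lambda>n. 2 * ennreal ((norm (dual_embedding j (l n)))\<^sup>2)
     + 2 * msq \<mu> (\<lambda>w. l n \<cdot> w - X w)) \<longlonglongrightarrow> 2 * ennreal ((norm x)\<^sup>2) + 2 * 0"
    by (intro tendsto_add ennreal_tendsto_cmult l tendsto_ennrealI tendsto_intros) auto
  from LIMSEQ_le_const[OF this] le show ?thesis by (auto simp: ennreal_mult')
qed

lemma is_delta_L2: "is_delta \<mu> j x X \<Longrightarrow> msq \<mu> X < \<infinity>"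
  using is_delta_square_le[of x X] by (auto intro: le_less_trans)

lemma is_delta_0_AE:
  assumes "is_delta \<mu> j 0 X" shows "AE w in \<mu>. X w = 0"
proof -
  note [measurable] = assms[THEN delta_borel]
  have "msq \<mu> X = 0" using is_delta_square_le[OF assms] by simp
  then show ?thesis by (subst (asm) nn_integral_0_iff_AE) auto
qed

lemma is_delta_cong_AE:
  assumes "is_delta \<mu> j x X" "AE w in \<mu>. X w = Y w" "Y \<in> borel_measurable \<mu>"
  shows "is_delta \<mu> j x Y"
proof -
  have "msq \<mu> (\<lambda>w. l \<cdot> w - X w) = msq \<mu> (\<lambda>w. l \<cdot> w - Y w)" for l
    using assms(2) by (intro nn_integral_cong_AE) auto
  then show ?thesis using assms(1,3) by (simp add: is_delta_def)
qed

text \<open>\<open>iexp\<close> is 1-Lipschitz on the reals, so mean square convergence of the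
  functionals carries over to their characteristic functions. Frequency 1 is enough: other
  frequencies and joint transforms arise by replacing \<open>x\<close> with a linear
  combination.\<close>

lemma is_delta_char:
  assumes "is_delta \<mu> j x X"
  shows "(CLINT w|\<mu>. iexp (X w)) = exp (- ((norm x)\<^sup>2) / 2)"
proof -
  note [measurable] = assms[THEN delta_borel]
  obtain l where l: "(\<lambda>n. dual_embedding j (l n)) \<longlonglongrightarrow> x"
    "(\<lambda>n. msq \<mu> (\<lambda>w. l n \<cdot> w - X w)) \<longlonglongrightarrow> 0"
    using assms(1) unfolding is_delta_def by auto
  have int: "integrable \<mu> (\<lambda>w. iexp (Y w))" if "Y \<in> borel_measurable \<mu>" for Y
    using that by (intro integrable_const_bound[of _ 1]) auto
  have "(\<lambda>n. CLINT w|\<mu>. iexp (l n \<cdot> w)) \<longlonglongrightarrow> (CLINT w|\<mu>. iexp (X w))"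
  proof (rule integral_tendsto_L1)
    have lim: "(\<lambda>n. \<integral>\<^sup>+ w. ennreal \<bar>(l n \<cdot> w - X w) * 1\<bar> \<partial>\<mu>) \<longlonglongrightarrow> 0"
      by (rule L2_pairing_tendsto_0[OF _ _ l(2)]) (auto simp: emeasure_space_1[unfolded space_mu])
    have "norm (iexp a - iexp c) \<le> \<bar>a - c\<bar>" for a c
    proof -
      have "iexp a - iexp c = iexp c * (iexp (a - c) - 1)"
        by (simp add: algebra_simps exp_diff)
      then have "norm (iexp a - iexp c) = norm (iexp (a - c) - 1)" by (simp add: norm_mult)
      also have "\<dots> \<le> \<bar>a - c\<bar>" using iexp_approx1[of "a - c" 0] by simp
      finally show ?thesis .
    qed
    then show "(\<lambda>n. \<integral>\<^sup>+ w. ennreal (norm (iexp (l n \<cdot> w) - iexp (X w))) \<partial>\<mu>) \<longlonglongrightarrow> 0"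
      by (intro tendsto_sandwich[OF _ _ tendsto_const lim])
         (auto intro!: always_eventually nn_integral_mono ennreal_leI)
  qed (auto intro!: int)
  moreover have "(\<lambda>n. CLINT w|\<mu>. iexp (l n \<cdot> w)) \<longlonglongrightarrow> exp (- ((norm x)\<^sup>2) / 2)"
    unfolding functional_char by (intro tendsto_intros l) auto
  ultimately show ?thesis by (rule LIMSEQ_unique)
qed

end

section \<open>Independence of orthogonal Gaussian families\<close>

context prob_space
begin

text \<open>\<open>Levy_uniqueness\<close> compares probability distributions, so a nonnegative
  weight \<open>P\<close> of total mass \<open>m\<close> is normalized to a density before it is
  pushed forward by \<open>Y\<close>.\<close>

lemma weighted_distr:
  fixes P Y :: "'a \<Rightarrow> real"
  assumes P: "integrable M P" "\<And>w. 0 \<le> P w" "integral\<^sup>L M P = m" "m > 0"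
    and Y [measurable]: "Y \<in> borel_measurable M"
  defines "\<nu> \<equiv> distr (density M (\<lambda>w. ennreal (P w / m))) borel Y"
  shows "real_distribution \<nu>"
    and "\<And>g :: real \<Rightarrow> 'b::{banach,second_countable_topology}. g \<in> borel_measurable borel \<Longrightarrow>
      (\<integral>x. g x \<partial>\<nu>) = (\<integral>w. (P w / m) *\<^sub>R g (Y w) \<partial>M)"
proof -
  have [measurable]: "P \<in> borel_measurable M" using P(1) by simp
  have "emeasure (density M (\<lambda>w. ennreal (P w / m))) (space M) = (\<integral>\<^sup>+ w. ennreal (P w / m) \<partial>M)"
    by (simp add: emeasure_density cong: nn_integral_cong)
  also have "\<dots> = ennreal (\<integral>w. P w / m \<partial>M)" using P by (intro nn_integral_eq_integral) auto
  also have "\<dots> = 1" using P by simp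
  finally interpret D: prob_space "density M (\<lambda>w. ennreal (P w / m))"
    by (intro prob_spaceI) simp
  show "real_distribution \<nu>" unfolding \<nu>_def by (rule D.real_distribution_distr) simp
  show "(\<integral>x. g x \<partial>\<nu>) = (\<integral>w. (P w / m) *\<^sub>R g (Y w) \<partial>M)"
    if [measurable]: "g \<in> borel_measurable borel" for g :: "real \<Rightarrow> 'b"
    unfolding \<nu>_def using P by (subst integral_distr) (auto simp: integral_density)
qed

text \<open>
  The positive and negative parts of \<open>Z\<close>, used as densities, push forward under \<open>Y\<close> to measures with the
  same characteristic function.
\<close>

lemma fourier_zero_real:
  fixes Z Y :: "'a \<Rightarrow> real"
  assumes Z: "integrable M Z" and Y [measurable]: "Y \<in> borel_measurable M"
    and F: "\<And>t. (CLINT w|M. complex_of_real (Z w) * iexp (t * Y w)) = 0"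
    and A [measurable]: "A \<in> sets borel"
  shows "(\<integral>w. Z w * indicator A (Y w) \<partial>M) = 0"
proof -
  have [measurable]: "Z \<in> borel_measurable M" using Z by simp
  define P N where "P w = max 0 (Z w)" and "N w = max 0 (- Z w)" for w
  have PN: "Z = (\<lambda>w. P w - N w)" by (auto simp: P_def N_def fun_eq_iff max_def)
  have iP: "integrable M P" and iN: "integrable M N"
    using Z unfolding P_def N_def by auto
  define m where "m = integral\<^sup>L M P"
  \<comment> \<open>Frequency 0 shows that both parts have the same mass \<open>m\<close>, so one
    normalization serves for both.\<close>
  have "complex_of_real (integral\<^sup>L M Z) = 0" using F[of 0] by simp
  moreover have "integral\<^sup>L M Z = integral\<^sup>L M P - integral\<^sup>L M N"
    unfolding PN using iP iN by (rule Bochner_Integration.integral_diff)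
  ultimately have m': "integral\<^sup>L M N = m" by (simp add: m_def)
  show ?thesis
  proof (cases "m = 0")
    case True
    have "AE w in M. P w = 0"
      using True iP by (subst integral_nonneg_eq_0_iff_AE[symmetric]) (auto simp: m_def P_def)
    moreover have "AE w in M. N w = 0"
      using True iN m' by (subst integral_nonneg_eq_0_iff_AE[symmetric]) (auto simp: N_def)
    ultimately have "AE w in M. Z w * indicator A (Y w) = 0" by eventually_elim (simp add: PN)
    then show ?thesis by (subst integral_cong_AE[where g="\<lambda>_. 0"]) auto
  next
    case False
    have "0 \<le> m" unfolding m_def by (rule Bochner_Integration.integral_nonneg) (simp add: P_def)
    with False have m: "m > 0" by simp
    have P0: "0 \<le> P w" and N0: "0 \<le> N w" for w by (simp_all add: P_def N_def)
    note dP = weighted_distr[OF iP P0 m_def[symmetric] m Y]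
    note dN = weighted_distr[OF iN N0 m' m Y]
    define \<nu>\<^sub>1 where "\<nu>\<^sub>1 = distr (density M (\<lambda>w. ennreal (P w / m))) borel Y"
    define \<nu>\<^sub>2 where "\<nu>\<^sub>2 = distr (density M (\<lambda>w. ennreal (N w / m))) borel Y"
    note dP = dP[folded \<nu>\<^sub>1_def] and dN = dN[folded \<nu>\<^sub>2_def]
    have "char \<nu>\<^sub>1 t = char \<nu>\<^sub>2 t" for t
    proof -
      have int: "integrable M (\<lambda>w. (f w / m) *\<^sub>R iexp (t * Y w))" if "integrable M f" for f
        by (rule Bochner_Integration.integrable_bound[OF that[THEN integrable_divide, of m]]) (use that in auto)
      have "char \<nu>\<^sub>1 t - char \<nu>\<^sub>2 t
         = (CLINT w|M. (P w / m) *\<^sub>R iexp (t * Y w)) - (CLINT w|M. (N w / m) *\<^sub>R iexp (t * Y w))"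
        unfolding char_def by (simp add: dP(2) dN(2))
      also have "\<dots> = (CLINT w|M. (P w / m) *\<^sub>R iexp (t * Y w) - (N w / m) *\<^sub>R iexp (t * Y w))"
        using int iP iN by (intro Bochner_Integration.integral_diff[symmetric]) auto
      also have "\<dots> = (CLINT w|M. (complex_of_real (Z w) * iexp (t * Y w)) / complex_of_real m)"
        using m by (intro Bochner_Integration.integral_cong) (auto simp: PN scaleR_conv_of_real field_simps)
      also have "\<dots> = 0" using F[of t] by simp
      finally show ?thesis by simp
    qed
    then have "\<nu>\<^sub>1 = \<nu>\<^sub>2" by (intro Levy_uniqueness dP dN ext)
    then have "(\<integral>w. (P w / m) * indicator A (Y w) \<partial>M) = (\<integral>w. (N w / m) * indicator A (Y w) \<partial>M)"
      using dP(2)[of "indicator A :: real \<Rightarrow> real"] dN(2)[of "indicator A :: real \<Rightarrow> real"] by simp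
    then have eq: "(\<integral>w. P w * indicator A (Y w) \<partial>M) = (\<integral>w. N w * indicator A (Y w) \<partial>M)"
      using m by (simp add: field_simps)
    have i: "integrable M (\<lambda>w. f w * indicator A (Y w))" if f: "integrable M f" for f :: "'a \<Rightarrow> real"
      by (rule Bochner_Integration.integrable_bound[OF f]) (use f in \<open>auto split: split_indicator\<close>)
    from i[OF iP] i[OF iN] show ?thesis using eq by (simp add: PN left_diff_distrib)
  qed
qed

text \<open>Conjugation turns the transform of \<open>Z\<close> at \<open>- t\<close> into that of
  \<open>cnj Z\<close> at \<open>t\<close>, so the real and imaginary parts of \<open>Z\<close> have
  vanishing transforms as well. Complex weights are needed because the next induction absorbs
  exponentials into the weight.\<close>

lemma fourier_zero_complex:
  fixes Z :: "'a \<Rightarrow> complex" and Y :: "'a \<Rightarrow> real"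
  assumes Z: "integrable M Z" and Y [measurable]: "Y \<in> borel_measurable M"
    and F: "\<And>t. (CLINT w|M. Z w * iexp (t * Y w)) = 0"
    and A [measurable]: "A \<in> sets borel"
  shows "(CLINT w|M. Z w * indicator A (Y w)) = 0"
proof -
  have [measurable]: "Z \<in> borel_measurable M" using Z by simp
  have [measurable]: "(\<lambda>w. cnj (Z w)) \<in> borel_measurable M"
    using Z integrable_cnj by (intro borel_measurable_integrable) auto
  have int: "integrable M (\<lambda>w. Z w * iexp (t * Y w))" "integrable M (\<lambda>w. cnj (Z w) * iexp (t * Y w))" for t
    by (rule Bochner_Integration.integrable_bound[OF Z]; auto simp: norm_mult)+
  have F': "(CLINT w|M. cnj (Z w) * iexp (t * Y w)) = 0" for t
  proof -
    have "(CLINT w|M. cnj (Z w) * iexp (t * Y w)) = (CLINT w|M. cnj (Z w * iexp (- t * Y w)))"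
      by (intro Bochner_Integration.integral_cong) (auto simp: exp_cnj)
    also have "\<dots> = cnj (CLINT w|M. Z w * iexp (- t * Y w))" by (rule Bochner_Integration.integral_cnj)
    finally show ?thesis using F[of "- t"] by simp
  qed
  have "(\<integral>w. Re (Z w) * indicator A (Y w) \<partial>M) = 0"
  proof (rule fourier_zero_real)
    fix t
    have "(CLINT w|M. complex_of_real (Re (Z w)) * iexp (t * Y w))
        = (CLINT w|M. (Z w * iexp (t * Y w) + cnj (Z w) * iexp (t * Y w)) / 2)"
      by (intro Bochner_Integration.integral_cong refl)
         (simp add: distrib_right[symmetric] complex_add_cnj)
    also have "\<dots> = 0" using int F F' by simp
    finally show "(CLINT w|M. complex_of_real (Re (Z w)) * iexp (t * Y w)) = 0" .
  qed (use Z in auto)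
  moreover have "(\<integral>w. Im (Z w) * indicator A (Y w) \<partial>M) = 0"
  proof (rule fourier_zero_real)
    fix t
    have "(CLINT w|M. complex_of_real (Im (Z w)) * iexp (t * Y w))
        = (CLINT w|M. (Z w * iexp (t * Y w) - cnj (Z w) * iexp (t * Y w)) / (2 * \<i>))"
    proof (intro Bochner_Integration.integral_cong refl)
      have e: "complex_of_real (Im z) = (z - cnj z) / (2 * \<i>)" for z by (simp add: complex_eq_iff)
      show "complex_of_real (Im (Z w)) * iexp (t * Y w)
        = (Z w * iexp (t * Y w) - cnj (Z w) * iexp (t * Y w)) / (2 * \<i>)" for w
        unfolding e by (simp add: left_diff_distrib)
    qed
    also have "\<dots> = 0" using int F F' by simp
    finally show "(CLINT w|M. complex_of_real (Im (Z w)) * iexp (t * Y w)) = 0" .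
  qed (use Z in auto)
  moreover have i: "integrable M (\<lambda>w. Z w * indicator A (Y w))"
    by (rule Bochner_Integration.integrable_bound[OF Z]) (auto simp: norm_mult split: split_indicator)
  have e: "Re (Z w * indicator A (Y w)) = Re (Z w) * indicator A (Y w)"
    "Im (Z w * indicator A (Y w)) = Im (Z w) * indicator A (Y w)" for w
    by (auto split: split_indicator)
  ultimately show ?thesis
    using integral_Re[OF i] integral_Im[OF i] by (intro complex_eqI) (simp_all add: e)
qed

text \<open>The coordinates are treated one at a time, with the weight generalized in the induction:
  the exponentials of the remaining variables are absorbed into the weight to apply the one-variable
  case to \<open>Y k\<close>, and then the indicator for \<open>Y k\<close> is absorbed to apply the
  induction hypothesis.\<close>

lemma fourier_zero_finite_family:
  fixes Z :: "'a \<Rightarrow> complex" and Y :: "'i \<Rightarrow> 'a \<Rightarrow> real"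
  assumes "finite I" "integrable M Z" "\<And>i. i \<in> I \<Longrightarrow> Y i \<in> borel_measurable M"
    and "\<And>t. (CLINT w|M. Z w * iexp (\<Sum>i\<in>I. t i * Y i w)) = 0"
    and "\<And>i. i \<in> I \<Longrightarrow> A i \<in> sets borel"
  shows "(CLINT w|M. Z w * (\<Prod>i\<in>I. indicator (A i) (Y i w))) = 0"
  using assms
proof (induction I arbitrary: Z rule: finite_induct)
  case empty
  then show ?case by simp
next
  case (insert k I)
  have [measurable]: "Z \<in> borel_measurable M" using insert.prems(1) by simp
  have [measurable]: "Y i \<in> borel_measurable M" if "i \<in> I" for i using that insert.prems by simp
  have [measurable]: "Y k \<in> borel_measurable M" "A k \<in> sets borel" using insert.prems by simp_all
  define Z' where "Z' w = Z w * indicator (A k) (Y k w)" for w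
  have iZ': "integrable M Z'" unfolding Z'_def
    by (rule Bochner_Integration.integrable_bound[OF insert.prems(1)]) (auto simp: norm_mult split: split_indicator)
  have "(CLINT w|M. Z' w * (\<Prod>i\<in>I. indicator (A i) (Y i w))) = 0"
  proof (rule insert.IH[OF iZ'])
    fix t :: "'i \<Rightarrow> real"
    define V where "V w = Z w * iexp (\<Sum>i\<in>I. t i * Y i w)" for w
    have "(CLINT w|M. V w * indicator (A k) (Y k w)) = 0"
    proof (rule fourier_zero_complex)
      show "integrable M V" unfolding V_def
        by (rule Bochner_Integration.integrable_bound[OF insert.prems(1)]) (auto simp: norm_mult)
      fix s
      have "(\<Sum>i\<in>insert k I. (t(k := s)) i * Y i w) = s * Y k w + (\<Sum>i\<in>I. t i * Y i w)" for w
        using insert.hyps by (subst sum.insert) (auto intro!: sum.cong)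
      then have "V w * iexp (s * Y k w) = Z w * iexp (\<Sum>i\<in>insert k I. (t(k := s)) i * Y i w)" for w
        by (simp add: V_def distrib_left exp_add mult_ac)
      then show "(CLINT w|M. V w * iexp (s * Y k w)) = 0"
        using insert.prems(3)[of "t(k := s)"] by simp
    qed auto
    moreover have "V w * indicator (A k) (Y k w) = Z' w * iexp (\<Sum>i\<in>I. t i * Y i w)" for w
      by (simp add: V_def Z'_def mult_ac)
    ultimately show "(CLINT w|M. Z' w * iexp (\<Sum>i\<in>I. t i * Y i w)) = 0" by simp
  qed (use insert.prems in auto)
  then show ?case using insert.hyps by (simp add: Z'_def mult_ac)
qed

text \<open>Two decouplings. The weight \<open>iexp (s * X w)\<close> minus its mean is annihilated
  by the exponentials of the family, hence by the indicator of \<open>C\<close>. This says that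
  \<open>indicator C w - p\<close> is annihilated by the exponentials of \<open>X\<close>, hence by
  the indicators of events of \<open>X\<close>.\<close>

lemma fourier_factor_imp_prob_factor:
  fixes X :: "'a \<Rightarrow> real" and Y :: "'i \<Rightarrow> 'a \<Rightarrow> real"
  assumes I: "finite I" and X [measurable]: "X \<in> borel_measurable M"
    and Y: "\<And>i. i \<in> I \<Longrightarrow> Y i \<in> borel_measurable M"
    and F: "\<And>s t. (CLINT w|M. iexp (s * X w) * iexp (\<Sum>i\<in>I. t i * Y i w))
      = (CLINT w|M. iexp (s * X w)) * (CLINT w|M. iexp (\<Sum>i\<in>I. t i * Y i w))"
    and A: "\<And>i. i \<in> I \<Longrightarrow> A i \<in> sets borel" and B [measurable]: "B \<in> sets borel"
  defines "C \<equiv> {w \<in> space M. \<forall>i\<in>I. Y i w \<in> A i}"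
  shows "prob ((X -` B \<inter> space M) \<inter> C) = prob (X -` B \<inter> space M) * prob C"
proof -
  have [measurable]: "Y i \<in> borel_measurable M" if "i \<in> I" for i using that Y by simp
  have C: "C \<in> sets M" unfolding C_def using I Y A
    by (intro sets.sets_Collect_finite_All) (auto intro: pred_sets2)
  have pC: "(\<Prod>i\<in>I. indicator (A i) (Y i w)) = (indicator C w :: complex)" if "w \<in> space M" for w
    using that I by (auto simp: C_def indicator_def prod_zero_iff)
  have int: "integrable M (\<lambda>w. iexp (s * X w))" for s
    by (intro integrable_const_bound[of _ 1]) auto
  have Z: "(CLINT w|M. (iexp (s * X w) - (CLINT w|M. iexp (s * X w))) * (\<Prod>i\<in>I. indicator (A i) (Y i w))) = 0" for s
  proof (rule fourier_zero_finite_family[OF I _ Y _ A])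
    show "integrable M (\<lambda>w. iexp (s * X w) - (CLINT w|M. iexp (s * X w)))" using int by auto
    fix t :: "'i \<Rightarrow> real"
    have i: "integrable M (\<lambda>w. iexp (s * X w) * iexp (\<Sum>i\<in>I. t i * Y i w))"
      "integrable M (\<lambda>w. iexp (\<Sum>i\<in>I. t i * Y i w))"
      by (intro integrable_const_bound[of _ 1]; auto simp: norm_mult)+
    then show "(CLINT w|M. (iexp (s * X w) - (CLINT w|M. iexp (s * X w))) * iexp (\<Sum>i\<in>I. t i * Y i w)) = 0"
      using F[of s t] by (simp add: left_diff_distrib del: of_real_sum of_real_mult)
  qed auto
  define p where "p = prob C"
  have iC: "integrable M (\<lambda>w. indicator C w :: complex)" "integrable M (\<lambda>w. indicator C w :: real)"
    using C by (intro integrable_const_bound[of _ 1]; auto split: split_indicator)+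
  have "(\<integral>w. (indicator C w - p) * indicator B (X w) \<partial>M) = 0"
  proof (rule fourier_zero_real)
    show "integrable M (\<lambda>w. indicator C w - p)" using iC by auto
    fix s
    have "integrable M (\<lambda>w. iexp (s * X w) * indicator C w)"
      using C by (intro integrable_const_bound[of _ 1]) (auto simp: norm_mult split: split_indicator)
    moreover have "(CLINT w|M. (iexp (s * X w) - (CLINT w|M. iexp (s * X w))) * indicator C w) = 0"
      using Z[of s] by (subst Bochner_Integration.integral_cong[OF refl, where g=
        "\<lambda>w. (iexp (s * X w) - (CLINT w|M. iexp (s * X w))) * (\<Prod>i\<in>I. indicator (A i) (Y i w))"])
        (simp_all add: pC)
    moreover have "(CLINT w|M. indicator C w) = (CLINT w|M. complex_of_real (indicator C w))"
      by (intro Bochner_Integration.integral_cong) (auto split: split_indicator)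
    then have "(CLINT w|M. indicator C w) = complex_of_real p"
      unfolding integral_complex_of_real using C by (simp add: p_def)
    ultimately have "(CLINT w|M. iexp (s * X w) * indicator C w) = (CLINT w|M. iexp (s * X w)) * p"
      using iC by (simp add: left_diff_distrib)
    moreover have "complex_of_real (indicator C w - p) * iexp (s * X w)
      = iexp (s * X w) * indicator C w - p * iexp (s * X w)" for w
      by (simp add: left_diff_distrib split: split_indicator)
    ultimately show "(CLINT w|M. complex_of_real (indicator C w - p) * iexp (s * X w)) = 0"
      using int \<open>integrable M (\<lambda>w. iexp (s * X w) * indicator C w)\<close> by simp
  qed auto
  moreover have "(indicator C w - p) * indicator B (X w)
      = indicator ((X -` B \<inter> space M) \<inter> C) w - p * indicator (X -` B \<inter> space M) w" if "w \<in> space M" for w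
    using that by (auto split: split_indicator)
  ultimately have "(\<integral>w. indicator ((X -` B \<inter> space M) \<inter> C) w - p * indicator (X -` B \<inter> space M) w \<partial>M) = 0"
    by (simp cong: Bochner_Integration.integral_cong)
  moreover define D where "D = X -` B \<inter> space M"
  have D: "D \<in> sets M" unfolding D_def by simp
  have "integrable M (indicator E :: 'a \<Rightarrow> real)" if "E \<in> sets M" for E
    using that by (simp add: emeasure_eq_measure)
  then have "(\<integral>w. indicator (D \<inter> C) w - p * indicator D w \<partial>M) = prob (D \<inter> C) - p * prob D"
    using C D by (subst Bochner_Integration.integral_diff) auto
  ultimately show ?thesis by (simp add: p_def D_def)
qed

text \<open>The events depending on finitely many \<open>Y i\<close> form an intersection stable
  generator. Null sets are adjoined because the filtration is augmented by them; they preserve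
  intersection stability and are independent of every event.\<close>

lemma fourier_factor_imp_indep:
  fixes X :: "'a \<Rightarrow> real" and Y :: "'i \<Rightarrow> 'a \<Rightarrow> real"
  assumes X [measurable]: "X \<in> borel_measurable M"
    and Y: "\<And>i. i \<in> J \<Longrightarrow> Y i \<in> borel_measurable M"
    and F: "\<And>I s t. finite I \<Longrightarrow> I \<subseteq> J \<Longrightarrow> (CLINT w|M. iexp (s * X w) * iexp (\<Sum>i\<in>I. t i * Y i w))
      = (CLINT w|M. iexp (s * X w)) * (CLINT w|M. iexp (\<Sum>i\<in>I. t i * Y i w))"
  shows "indep_set (sigma_sets (space M) {X -` B \<inter> space M | B. B \<in> sets borel})
    (sigma_sets (space M) ({Y i -` A \<inter> space M | i A. i \<in> J \<and> A \<in> sets borel} \<union> null_sets M))"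
proof -
  define G where "G = {{w \<in> space M. \<forall>i\<in>I. Y i w \<in> A i} | I A.
     finite I \<and> I \<subseteq> J \<and> (\<forall>i\<in>I. A i \<in> sets borel)}"
  have Gsets: "C \<in> sets M" if CG: "C \<in> G" for C
  proof -
    obtain I A where IA: "finite I" "I \<subseteq> J" "\<forall>i\<in>I. A i \<in> sets borel"
      and C: "C = {w \<in> space M. \<forall>i\<in>I. Y i w \<in> A i}"
      using CG unfolding G_def by blast
    have "Y i -` A i \<inter> space M \<in> sets M" if "i \<in> I" for i
      using that IA Y by (intro measurable_sets[of "Y i" M borel]) auto
    moreover have "Y i -` A i \<inter> space M = {w \<in> space M. Y i w \<in> A i}" for i by auto
    ultimately show ?thesis unfolding C using IA(1) by (intro sets.sets_Collect_finite_All) simp_all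
  qed
  have "Int_stable {X -` B \<inter> space M | B. B \<in> sets borel}"
  proof (rule Int_stableI)
    fix a c assume "a \<in> {X -` B \<inter> space M | B. B \<in> sets borel}" "c \<in> {X -` B \<inter> space M | B. B \<in> sets borel}"
    then obtain B B' where "B \<in> sets borel" "B' \<in> sets borel" "a = X -` B \<inter> space M" "c = X -` B' \<inter> space M"
      by blast
    then show "a \<inter> c \<in> {X -` B \<inter> space M | B. B \<in> sets borel}"
      by (intro CollectI exI[of _ "B \<inter> B'"]) auto
  qed
  moreover have "Int_stable (G \<union> null_sets M)"
  proof (rule Int_stableI)
    fix a c assume ac: "a \<in> G \<union> null_sets M" "c \<in> G \<union> null_sets M"
    consider "a \<in> null_sets M" | "c \<in> null_sets M" | "a \<in> G" "c \<in> G" using ac by blast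
    then show "a \<inter> c \<in> G \<union> null_sets M"
    proof cases
      case 1
      then show ?thesis using ac Gsets null_set_Int2[of a M c] by auto
    next
      case 2
      then show ?thesis using ac Gsets null_set_Int1[of c M a] by auto
    next
      case 3
      from 3(1) obtain I A where IA: "finite I" "I \<subseteq> J" "\<forall>i\<in>I. A i \<in> sets borel"
        "a = {w \<in> space M. \<forall>i\<in>I. Y i w \<in> A i}"
        unfolding G_def by blast
      from 3(2) obtain I' A' where IA': "finite I'" "I' \<subseteq> J" "\<forall>i\<in>I'. A' i \<in> sets borel"
        "c = {w \<in> space M. \<forall>i\<in>I'. Y i w \<in> A' i}"
        unfolding G_def by blast
      \<comment> \<open>Padding both families with \<open>UNIV\<close> over the union of the index
        sets makes the intersection a single cylinder event.\<close>
      define A'' where "A'' i = (if i \<in> I then A i else UNIV) \<inter> (if i \<in> I' then A' i else UNIV)" for i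
      have "a \<inter> c = {w \<in> space M. \<forall>i\<in>I \<union> I'. Y i w \<in> A'' i}"
        unfolding IA(4) IA'(4) A''_def by auto
      moreover have "\<forall>i\<in>I \<union> I'. A'' i \<in> sets borel" using IA IA' by (auto simp: A''_def)
      ultimately have "a \<inter> c \<in> G"
        unfolding G_def using IA IA' by (intro CollectI exI[of _ "I \<union> I'"] exI[of _ A'']) auto
      then show ?thesis by simp
    qed
  qed
  moreover have "indep_set {X -` B \<inter> space M | B. B \<in> sets borel} (G \<union> null_sets M)"
  proof (rule indep_setI)
    show "{X -` B \<inter> space M | B. B \<in> sets borel} \<subseteq> events" by auto
    show "G \<union> null_sets M \<subseteq> events" using Gsets by auto
    fix a c assume "a \<in> {X -` B \<inter> space M | B. B \<in> sets borel}" and c: "c \<in> G \<union> null_sets M"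
    then obtain B where B: "B \<in> sets borel" "a = X -` B \<inter> space M" by blast
    then have a: "a \<in> sets M" by auto
    from c show "prob (a \<inter> c) = prob a * prob c"
    proof
      assume "c \<in> G"
      then obtain I A where IA: "finite I" "I \<subseteq> J" "\<forall>i\<in>I. A i \<in> sets borel"
        and C: "c = {w \<in> space M. \<forall>i\<in>I. Y i w \<in> A i}"
        unfolding G_def by blast
      show ?thesis unfolding C B(2)
        by (rule fourier_factor_imp_prob_factor[OF IA(1) X Y F]) (use IA B in auto)
    next
      assume "c \<in> null_sets M"
      moreover from this have "a \<inter> c \<in> null_sets M" using a by (rule null_set_Int1)
      ultimately show ?thesis by (simp add: measure_def null_setsD1)
    qed
  qed
  ultimately have "indep_set (sigma_sets (space M) {X -` B \<inter> space M | B. B \<in> sets borel})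
      (sigma_sets (space M) (G \<union> null_sets M))"
    by (intro indep_set_sigma_sets)
  note indep = this
  have "{Y i -` A \<inter> space M | i A. i \<in> J \<and> A \<in> sets borel} \<subseteq> G"
  proof safe
    fix i A assume "i \<in> J" "A \<in> sets (borel :: real measure)"
    then show "Y i -` A \<inter> space M \<in> G"
      unfolding G_def by (intro CollectI exI[of _ "{i}"] exI[of _ "\<lambda>_. A"]) auto
  qed
  then have "sigma_sets (space M) ({Y i -` A \<inter> space M | i A. i \<in> J \<and> A \<in> sets borel} \<union> null_sets M)
      \<subseteq> sigma_sets (space M) (G \<union> null_sets M)"
    by (intro sigma_sets_mono') auto
  then show ?thesis
    using indep unfolding indep_sets2_eq by blast
qed

end

context wiener_space
begin

text \<open>A finite combination of the \<open>Y i\<close> belongs to a vector \<open>k\<close>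
  orthogonal to \<open>g\<close>, so squared norms add in \<open>k + s *\<^sub>R g\<close> and the
  exponentials of \<open>is_delta_char\<close> multiply.\<close>

lemma is_delta_indep:
  assumes g: "is_delta \<mu> j g X" and Y: "\<And>i. i \<in> J \<Longrightarrow> is_delta \<mu> j (h i) (Y i)"
    and orth: "\<And>i. i \<in> J \<Longrightarrow> inner g (h i) = 0"
  shows "indep_set (sigma_sets (space \<mu>) {X -` B \<inter> space \<mu> | B. B \<in> sets borel})
    (sigma_sets (space \<mu>) ({Y i -` A \<inter> space \<mu> | i A. i \<in> J \<and> A \<in> sets borel} \<union> null_sets \<mu>))"
proof (rule fourier_factor_imp_indep)
  fix I s and t :: "'a \<Rightarrow> real" assume I: "finite I" "I \<subseteq> J"
  define k where "k = (\<Sum>i\<in>I. t i *\<^sub>R h i)"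
  define V where "V w = (\<Sum>i\<in>I. t i * Y i w)" for w
  have V: "is_delta \<mu> j k V" unfolding k_def V_def using I Y by (intro is_delta_sum) auto
  have sX: "is_delta \<mu> j (s *\<^sub>R g) (\<lambda>w. s * X w)" using is_delta_lin[OF is_delta_0 g, of s] by simp
  have "inner g k = 0" unfolding k_def using I orth by (auto simp: inner_sum_right subset_iff intro!: sum.neutral)
  then have n: "(norm (k + s *\<^sub>R g))\<^sup>2 = (norm k)\<^sup>2 + (norm (s *\<^sub>R g))\<^sup>2"
    unfolding power2_norm_eq_inner by (simp add: inner_add_left inner_add_right inner_commute)
  have "(CLINT w|\<mu>. iexp (s * X w) * iexp (V w)) = (CLINT w|\<mu>. iexp (V w + s * X w))"
    by (simp add: exp_add[symmetric] distrib_left add.commute)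
  also have "\<dots> = exp (- ((norm k)\<^sup>2 + (norm (s *\<^sub>R g))\<^sup>2) / 2)"
    using is_delta_char[OF is_delta_lin[OF V g, of s]] by (simp add: n)
  also have "- ((norm k)\<^sup>2 + (norm (s *\<^sub>R g))\<^sup>2) / 2 = (- (norm (s *\<^sub>R g))\<^sup>2 / 2) + (- (norm k)\<^sup>2 / 2)"
    by (simp add: field_simps)
  also have "complex_of_real (exp \<dots>) = (CLINT w|\<mu>. iexp (s * X w)) * (CLINT w|\<mu>. iexp (V w))"
    unfolding is_delta_char[OF V] is_delta_char[OF sX] exp_add by simp
  finally show "(CLINT w|\<mu>. iexp (s * X w) * iexp (\<Sum>i\<in>I. t i * Y i w))
      = (CLINT w|\<mu>. iexp (s * X w)) * (CLINT w|\<mu>. iexp (\<Sum>i\<in>I. t i * Y i w))"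
    unfolding V_def .
qed (use assms delta_borel in auto)

end

section \<open>Integration by parts and uniqueness of the gradient\<close>

definition dir_deriv :: "nat \<Rightarrow> ((nat \<Rightarrow> real) \<Rightarrow> real) \<Rightarrow> (nat \<Rightarrow> real) \<Rightarrow> (nat \<Rightarrow> real) \<Rightarrow> real" where
  "dir_deriv n f c x = (\<Sum>i<n. c i * partial_deriv i f x)"

lemma smooth_bounded_cong: "smooth_bounded n f \<Longrightarrow> (\<And>i. i < n \<Longrightarrow> x i = y i) \<Longrightarrow> f x = f y"
  unfolding smooth_bounded_def by blast

lemma smooth_bounded_bounded: "smooth_bounded n f \<Longrightarrow> \<exists>C\<ge>0. \<forall>x. \<bar>f x\<bar> \<le> C"
proof -
  assume "smooth_bounded n f"
  then have "bounded (range f)"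
    unfolding smooth_bounded_def by (auto dest: spec[of _ "[]"])
  then obtain C where "\<forall>x. \<bar>f x\<bar> \<le> C" unfolding bounded_iff by auto
  moreover from this have "0 \<le> C" using abs_ge_zero order_trans by blast
  ultimately show ?thesis by blast
qed

lemma smooth_bounded_partial:
  assumes "smooth_bounded n f" "i < n"
  shows "smooth_bounded n (partial_deriv i f)"
  unfolding smooth_bounded_def
proof (intro conjI allI impI)
  fix x y :: "nat \<Rightarrow> real" assume "\<forall>i<n. x i = y i"
  then have "f (x(i := t)) = f (y(i := t))" for t
    using assms(1) by (intro smooth_bounded_cong[of n f]) auto
  then show "partial_deriv i f x = partial_deriv i f y"
    using \<open>\<forall>i<n. x i = y i\<close> assms(2) by (simp add: partial_deriv_def)
next
  fix "is" assume "set is \<subseteq> {..<n}"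
  then have *: "set (is @ [i]) \<subseteq> {..<n}" using assms(2) by auto
  have e: "foldr partial_deriv is (partial_deriv i f) = foldr partial_deriv (is @ [i]) f" by simp
  show "bounded (range (foldr partial_deriv is (partial_deriv i f)))"
    unfolding e using assms(1) * unfolding smooth_bounded_def by blast
  show "(\<lambda>t. foldr partial_deriv is (partial_deriv i f) (x(k := t))) differentiable at (x k)" if "k < n" for k x
    unfolding e using assms(1) * that unfolding smooth_bounded_def by blast
qed

lemma smooth_bounded_has_partial:
  assumes "smooth_bounded n f" "i < n"
  shows "((\<lambda>t. f (x(i := t))) has_real_derivative partial_deriv i f (x(i := s))) (at s)"
proof -
  have "set [] \<subseteq> {..<n}" by simp
  then have "\<forall>i<n. \<forall>x. (\<lambda>t. foldr partial_deriv [] f (x(i := t))) differentiable at (x i)"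
    using assms(1) unfolding smooth_bounded_def by blast
  then have "(\<lambda>t. foldr partial_deriv [] f ((x(i := s))(i := t))) differentiable at ((x(i := s)) i)"
    using assms(2) by blast
  then show ?thesis
    unfolding partial_deriv_def by (simp add: DERIV_deriv_iff_real_differentiable)
qed

text \<open>One coordinate after another is changed from \<open>x\<close> to \<open>y\<close>; each
  change is controlled by the mean value theorem and a common bound \<open>C\<close> of all first
  partial derivatives.\<close>

lemma smooth_bounded_lipschitz:
  assumes f: "smooth_bounded n f"
  shows "\<exists>C\<ge>0. \<forall>x y. \<bar>f x - f y\<bar> \<le> C * (\<Sum>i<n. \<bar>x i - y i\<bar>)"
proof -
  have "\<forall>i. \<exists>C\<ge>0. i < n \<longrightarrow> (\<forall>x. \<bar>partial_deriv i f x\<bar> \<le> C)"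
    using smooth_bounded_bounded[OF smooth_bounded_partial[OF f]] by blast
  then obtain D where D: "\<And>i. D i \<ge> (0::real)" "\<And>i x. i < n \<Longrightarrow> \<bar>partial_deriv i f x\<bar> \<le> D i" by metis
  define C where "C = (\<Sum>i<n. D i)"
  have C: "\<bar>partial_deriv i f x\<bar> \<le> C" if "i < n" for i x
    using D that member_le_sum[of i "{..<n}" D] unfolding C_def by (fastforce intro: order_trans)
  have "\<bar>f x - f y\<bar> \<le> C * (\<Sum>i<k. \<bar>x i - y i\<bar>)" if "k \<le> n" "\<And>i. i \<ge> k \<Longrightarrow> x i = y i" for k x y
    using that
  proof (induction k arbitrary: x)
    case 0
    then have "x = y" by auto
    then show ?case by simp
  next
    case (Suc k)
    define z where "z = x(k := y k)"
    have "\<bar>f z - f y\<bar> \<le> C * (\<Sum>i<k. \<bar>z i - y i\<bar>)"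
      using Suc.prems by (intro Suc.IH) (auto simp: z_def le_Suc_eq not_less_eq_eq)
    also have "(\<Sum>i<k. \<bar>z i - y i\<bar>) = (\<Sum>i<k. \<bar>x i - y i\<bar>)" by (simp add: z_def)
    finally have 1: "\<bar>f z - f y\<bar> \<le> C * (\<Sum>i<k. \<bar>x i - y i\<bar>)" .
    have "norm (f (x(k := x k)) - f (x(k := y k))) \<le> C * norm (x k - y k)"
    proof (rule field_differentiable_bound[of UNIV])
      show "((\<lambda>t. f (x(k := t))) has_field_derivative partial_deriv k f (x(k := t))) (at t within UNIV)" for t
        using smooth_bounded_has_partial[OF f, of k x t] Suc.prems by simp
    qed (use C Suc.prems in auto)
    then have 2: "\<bar>f x - f z\<bar> \<le> C * \<bar>x k - y k\<bar>" by (simp add: z_def)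
    show ?case using 1 2 by (simp add: distrib_left)
  qed
  note * = this
  have "\<bar>f x - f y\<bar> \<le> C * (\<Sum>i<n. \<bar>x i - y i\<bar>)" for x y
  proof -
    define z where "z i = (if i < n then x i else y i)" for i
    have "f x = f z" by (rule smooth_bounded_cong[OF f]) (simp add: z_def)
    moreover have "\<bar>f z - f y\<bar> \<le> C * (\<Sum>i<n. \<bar>z i - y i\<bar>)" by (rule *) (auto simp: z_def)
    ultimately show ?thesis by (simp add: z_def)
  qed
  moreover have "C \<ge> 0" unfolding C_def using D by (intro sum_nonneg) auto
  ultimately show ?thesis by blast
qed

text \<open>\<open>smooth_bounded\<close> speaks of differentiability in one coordinate at a time;
  joint continuity in the product topology comes from the Lipschitz bound, which involves finitely
  many coordinates.\<close>

lemma smooth_bounded_continuous: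
  assumes f: "smooth_bounded n f"
  shows "continuous_on UNIV f"
  unfolding continuous_on_def
proof
  fix x :: "nat \<Rightarrow> real"
  obtain C where C: "\<And>x y. \<bar>f x - f y\<bar> \<le> C * (\<Sum>i<n. \<bar>x i - y i\<bar>)"
    using smooth_bounded_lipschitz[OF f] by blast
  have "((\<lambda>y. y i) \<longlongrightarrow> x i) (at x)" for i
    using continuous_on_product_coordinates[of i] unfolding continuous_on_def by auto
  then have "((\<lambda>y. C * (\<Sum>i<n. \<bar>y i - x i\<bar>)) \<longlongrightarrow> C * (\<Sum>i<n. \<bar>x i - x i\<bar>)) (at x)"
    by (intro tendsto_intros)
  then have "((\<lambda>y. C * (\<Sum>i<n. \<bar>y i - x i\<bar>)) \<longlongrightarrow> 0) (at x)" by simp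
  then have "((\<lambda>y. f y - f x) \<longlongrightarrow> 0) (at x)"
    by (rule Lim_null_comparison[rotated]) (use C in auto)
  then show "(f \<longlongrightarrow> f x) (at x within UNIV)" by (simp add: LIM_zero_iff)
qed

text \<open>The chain rule has to be assembled from separate partial derivatives.
  \<open>L k x s\<close> moves only the first \<open>k\<close> coordinates, and the induction on
  \<open>k\<close> sets one more coordinate in motion.\<close>

lemma has_derivative_along_line:
  assumes f: "smooth_bounded n f"
  shows "((\<lambda>s. f (\<lambda>i. x i + s * c i)) has_real_derivative dir_deriv n f c (\<lambda>i. x i + s * c i)) (at s)"
proof -
  define L where "L k x s = (\<lambda>i. x i + (if i < k then s * c i else 0))" for k and x :: "nat \<Rightarrow> real" and s :: real
  have "((\<lambda>s. f (L k x s)) has_real_derivative (\<Sum>i<k. c i * partial_deriv i f (L k x s))) (at s)"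
    if "k \<le> n" for k
    using that
  proof (induction k arbitrary: x s)
    case 0
    then show ?case by (simp add: L_def)
  next
    case (Suc k)
    \<comment> \<open>Two independent parameters: \<open>s\<close> moves the first \<open>k\<close>
      coordinates, \<open>t\<close> moves coordinate \<open>k\<close>. Continuity of the second
      partial derivative yields the total derivative.\<close>
    define \<phi> where "\<phi> s t = f (L k (x(k := x k + t * c k)) s)" for s t
    define d where "d s t = c k * partial_deriv k f (L k (x(k := x k + t * c k)) s)" for s t
    have L: "L k (x(k := y)) s = (L k x s)(k := y)" for y s by (auto simp: L_def)
    have LS: "L k (x(k := x k + s * c k)) s = L (Suc k) x s" for s by (auto simp: L_def fun_eq_iff less_Suc_eq)
    have k: "k < n" using Suc by simp
    have "((\<lambda>(s, t). \<phi> s t) has_derivative (\<lambda>(ts, tt).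
       (*) (\<Sum>i<k. c i * partial_deriv i f (L k (x(k := x k + s * c k)) s)) ts +
        (blinfun_scaleR_right (d s s)) \<cdot> tt)) (at (s, s) within UNIV \<times> UNIV)"
    proof (rule has_derivative_partialsI[where f=\<phi> and fy="\<lambda>s t. blinfun_scaleR_right (d s t)"])
      show "((\<lambda>s'. \<phi> s' s) has_derivative (*) (\<Sum>i<k. c i * partial_deriv i f (L k (x(k := x k + s * c k)) s))) (at s within UNIV)"
        unfolding \<phi>_def using Suc.prems
        by (intro Suc.IH[unfolded has_field_derivative_def]) simp
      show "((\<lambda>t. \<phi> s t) has_derivative blinfun_apply (blinfun_scaleR_right (d s t))) (at t within UNIV)" for s t
      proof -
        have "((\<lambda>t. f ((L k x s)(k := x k + t * c k))) has_real_derivative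
            partial_deriv k f ((L k x s)(k := x k + t * c k)) * c k) (at t)"
          by (rule DERIV_chain2[OF smooth_bounded_has_partial[OF f k]]) (auto intro!: derivative_eq_intros)
        moreover have "blinfun_apply (blinfun_scaleR_right (d s t)) = (*) (d s t)" by (auto simp: fun_eq_iff)
        ultimately show ?thesis
          by (simp add: \<phi>_def d_def L has_field_derivative_def mult.commute[of "c k"])
      qed
      have "continuous_on UNIV (partial_deriv k f)"
        by (rule smooth_bounded_continuous[OF smooth_bounded_partial[OF f k]])
      moreover have "continuous_on UNIV (\<lambda>p :: real \<times> real. L k (x(k := x k + snd p * c k)) (fst p))"
      proof (rule continuous_on_coordinatewise_then_product)
        fix i show "continuous_on UNIV (\<lambda>p :: real \<times> real. L k (x(k := x k + snd p * c k)) (fst p) i)"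
          by (cases "i = k"; cases "i < k") (auto simp: L_def intro!: continuous_intros)
      qed
      ultimately have "continuous_on UNIV (\<lambda>p :: real \<times> real. partial_deriv k f (L k (x(k := x k + snd p * c k)) (fst p)))"
        by (rule continuous_on_compose2) auto
      then have "continuous_on UNIV (\<lambda>p. blinfun_scaleR_right (d (fst p) (snd p)) :: real \<Rightarrow>\<^sub>L real)"
        unfolding d_def
        by (intro bounded_linear.continuous_on[OF bounded_linear_blinfun_scaleR_right] continuous_intros)
      then show "continuous (at (s, s) within UNIV \<times> UNIV) (\<lambda>(s, t). blinfun_scaleR_right (d s t) :: real \<Rightarrow>\<^sub>L real)"
        by (simp add: continuous_on_eq_continuous_within case_prod_unfold)
    qed auto
    \<comment> \<open>Restriction to the diagonal \<open>t = s\<close>, where \<open>LS\<close>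
      identifies the argument with \<open>L (Suc k) x s\<close>.\<close>
    from has_derivative_compose[OF has_derivative_Pair[OF has_derivative_ident has_derivative_ident] this[unfolded UNIV_Times_UNIV]]
    have "((\<lambda>s. f (L (Suc k) x s)) has_derivative
       (\<lambda>t. (\<Sum>i<k. c i * partial_deriv i f (L (Suc k) x s)) * t + (c k * partial_deriv k f (L (Suc k) x s)) * t)) (at s)"
      by (simp only: \<phi>_def d_def LS prod.case blinfun_scaleR_right.rep_eq real_scaleR_def)
    then show ?case by (simp add: has_field_derivative_def distrib_right[symmetric] add.commute)
  qed
  from this[of n] have "((\<lambda>s. f (L n x s)) has_real_derivative (\<Sum>i<n. c i * partial_deriv i f (L n x s))) (at s)"
    by simp
  moreover have e: "g (L n x s) = g (\<lambda>i. x i + s * c i)" if "smooth_bounded n g" for g s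
    by (rule smooth_bounded_cong[OF that]) (simp add: L_def)
  have "(\<Sum>i<n. c i * partial_deriv i f (L n x s)) = dir_deriv n f c (\<lambda>i. x i + s * c i)"
    unfolding dir_deriv_def by (intro sum.cong refl arg_cong2[where f="(*)"] e smooth_bounded_partial[OF f]) auto
  ultimately show ?thesis unfolding e[OF f] by simp
qed

lemma smooth_bounded_directional:
  assumes f: "smooth_bounded n f"
  shows "continuous_on UNIV (dir_deriv n f c)" "\<exists>C\<ge>0. \<forall>x. \<bar>dir_deriv n f c x\<bar> \<le> C"
proof -
  show "continuous_on UNIV (dir_deriv n f c)"
    unfolding dir_deriv_def[abs_def]
    by (intro continuous_intros smooth_bounded_continuous[of n] smooth_bounded_partial[OF f]) auto
  have "\<forall>i. \<exists>C\<ge>0. i < n \<longrightarrow> (\<forall>x. \<bar>partial_deriv i f x\<bar> \<le> C)"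
    using smooth_bounded_bounded[OF smooth_bounded_partial[OF f]] by blast
  then obtain D where D: "\<And>i. D i \<ge> (0::real)" "\<And>i x. i < n \<Longrightarrow> \<bar>partial_deriv i f x\<bar> \<le> D i" by metis
  have "\<bar>dir_deriv n f c x\<bar> \<le> (\<Sum>i<n. \<bar>c i\<bar> * D i)" for x
    unfolding dir_deriv_def using D
    by (intro order_trans[OF sum_abs] sum_mono) (auto simp: abs_mult intro!: mult_left_mono)
  moreover have "0 \<le> (\<Sum>i<n. \<bar>c i\<bar> * D i)" using D by (intro sum_nonneg) auto
  ultimately show "\<exists>C\<ge>0. \<forall>x. \<bar>dir_deriv n f c x\<bar> \<le> C" by blast
qed

section \<open>Integration by parts for the standard normal law\<close>

lemma std_normal_density_tendsto_0:
  "(std_normal_density \<longlongrightarrow> 0) at_top" "(std_normal_density \<longlongrightarrow> 0) at_bot"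
proof -
  have *: "filterlim (\<lambda>x::real. - (x * x / 2)) at_bot at_top"
  proof -
    have "filterlim (\<lambda>x::real. (1 / 2) * (x * x)) at_top at_top"
      by (rule filterlim_tendsto_pos_mult_at_top[OF tendsto_const])
         (auto intro: filterlim_at_top_mult_at_top filterlim_ident)
    then show ?thesis by (simp add: filterlim_uminus_at_bot)
  qed
  have "((\<lambda>x::real. 1 / sqrt (2 * pi) * exp (- (x * x / 2))) \<longlongrightarrow> 1 / sqrt (2 * pi) * 0) at_top"
    by (intro tendsto_intros filterlim_compose[OF exp_at_bot *])
  then show top: "(std_normal_density \<longlongrightarrow> 0) at_top"
    by (simp add: std_normal_density_def[abs_def] power2_eq_square)
  have "std_normal_density = (\<lambda>x. std_normal_density (- x))" by (simp add: std_normal_density_def fun_eq_iff)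
  then show "(std_normal_density \<longlongrightarrow> 0) at_bot"
    using top by (subst filterlim_at_bot_mirror) simp
qed

text \<open>Stein's identity: the density satisfies \<phi>' = - x \<phi>, so \<phi> F' - x \<phi> F
  is the derivative of \<phi> F, which vanishes at both infinities since \<open>F\<close> is
  bounded.\<close>

lemma std_normal_ibp:
  fixes F F' :: "real \<Rightarrow> real"
  assumes F: "\<And>x. (F has_real_derivative F' x) (at x)" and F': "continuous_on UNIV F'"
    and bd: "\<And>x. \<bar>F x\<bar> \<le> C" "\<And>x. \<bar>F' x\<bar> \<le> C'"
  shows "(\<integral>x. F' x \<partial>std_normal_distribution) = (\<integral>x. x * F x \<partial>std_normal_distribution)"
proof -
  have cF: "continuous_on UNIV F" using F by (meson DERIV_isCont continuous_at_imp_continuous_on)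
  have [measurable]: "F \<in> borel_measurable borel" "F' \<in> borel_measurable borel"
    using cF F' by (auto intro: borel_measurable_continuous_onI)
  have C: "0 \<le> C" "0 \<le> C'" using bd abs_ge_zero order_trans by blast+
  define \<phi> where "\<phi> = std_normal_density"
  have \<phi>0: "0 \<le> \<phi> x" for x by (simp add: \<phi>_def)
  have [measurable]: "\<phi> \<in> borel_measurable borel" by (simp add: \<phi>_def)
  have d\<phi>: "(\<phi> has_real_derivative - (x * \<phi> x)) (at x)" for x
    unfolding \<phi>_def std_normal_density_def[abs_def] by (auto intro!: derivative_eq_intros simp: field_simps)
  have i0: "integrable lborel \<phi>"
    using integrable_std_normal_moment[of 0] by (simp add: \<phi>_def)
  have i1: "integrable lborel (\<lambda>x. \<phi> x * x)"
    using integrable_std_normal_moment[of 1] by (simp add: \<phi>_def)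
  have int: "integrable lborel (\<lambda>x. \<phi> x * F' x)" "integrable lborel (\<lambda>x. \<phi> x * (x * F x))"
  proof -
    have le: "\<phi> x * \<bar>F' x\<bar> \<le> C' * \<phi> x" for x
      using bd(2)[of x] \<phi>0[of x] by (subst mult.commute) (rule mult_right_mono)
    show "integrable lborel (\<lambda>x. \<phi> x * F' x)"
      by (rule Bochner_Integration.integrable_bound[OF integrable_mult_right[OF i0, of C']])
         (use le \<phi>0 C in \<open>auto simp: abs_mult\<close>)
    have le': "\<bar>x\<bar> * (\<phi> x * \<bar>F x\<bar>) \<le> C * (\<bar>x\<bar> * \<phi> x)" for x
    proof -
      have "(\<bar>x\<bar> * \<phi> x) * \<bar>F x\<bar> \<le> (\<bar>x\<bar> * \<phi> x) * C"
        using bd(1)[of x] \<phi>0[of x] by (intro mult_left_mono) auto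
      then show ?thesis by (simp add: mult_ac)
    qed
    show "integrable lborel (\<lambda>x. \<phi> x * (x * F x))"
      by (rule Bochner_Integration.integrable_bound[OF integrable_mult_right[OF i1, of C]])
         (use le' \<phi>0 C in \<open>auto simp: abs_mult mult_ac\<close>)
  qed
  define G where "G x = \<phi> x * F x" for x
  have "(LBINT x=-\<infinity>..\<infinity>. \<phi> x * F' x - \<phi> x * (x * F x)) = 0 - 0"
  proof (rule interval_integral_FTC_integrable[where F=G])
    fix x
    show "(G has_vector_derivative \<phi> x * F' x - \<phi> x * (x * F x)) (at x)"
      unfolding has_real_derivative_iff_has_vector_derivative[symmetric] G_def
      by (auto intro!: derivative_eq_intros d\<phi> F simp: algebra_simps)
    have "isCont \<phi> x" "isCont F x" "isCont F' x"
      using d\<phi> F F' DERIV_isCont continuous_on_eq_continuous_at[of UNIV F'] by blast+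
    then show "isCont (\<lambda>x. \<phi> x * F' x - \<phi> x * (x * F x)) x" by (intro continuous_intros)
  next
    show "set_integrable lborel (einterval (-\<infinity>) \<infinity>) (\<lambda>x. \<phi> x * F' x - \<phi> x * (x * F x))"
      using int by (simp add: set_integrable_def)
    have lim: "(G \<longlongrightarrow> 0) A" if "(\<phi> \<longlongrightarrow> 0) A" for A
    proof (rule Lim_null_comparison)
      show "\<forall>\<^sub>F x in A. norm (G x) \<le> \<phi> x * C"
        using \<phi>0 bd by (auto simp: G_def abs_mult intro!: always_eventually mult_mono)
      show "((\<lambda>x. \<phi> x * C) \<longlongrightarrow> 0) A" using tendsto_mult_left_zero[OF that] by simp
    qed
    show "((G \<circ> real_of_ereal) \<longlongrightarrow> 0) (at_right (- \<infinity>))" "((G \<circ> real_of_ereal) \<longlongrightarrow> 0) (at_left \<infinity>)"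
      unfolding ereal_tendsto_simps1 using lim std_normal_density_tendsto_0 by (auto simp: \<phi>_def)
  qed simp
  then have "(\<integral>x. \<phi> x * F' x - \<phi> x * (x * F x) \<partial>lborel) = 0"
    by (simp add: interval_lebesgue_integral_def set_lebesgue_integral_def)
  then have "(\<integral>x. \<phi> x * F' x \<partial>lborel) = (\<integral>x. \<phi> x * (x * F x) \<partial>lborel)" using int by simp
  then show ?thesis by (simp add: integral_density \<phi>_def)
qed

section \<open>Bounded weights and cylindrical functions in mean square\<close>

lemma (in prob_space) bounded_square_integrable:
  assumes "\<And>w. \<bar>f w\<bar> \<le> (C::real)"
  shows "msq M f < \<infinity>"
proof -
  have "(f w)\<^sup>2 \<le> C\<^sup>2" for w using power_mono[OF assms[of w], of 2] by simp
  then have "msq M f \<le> (\<integral>\<^sup>+ w. ennreal (C\<^sup>2) \<partial>M)"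
    by (intro nn_integral_mono ennreal_leI)
  also have "\<dots> < \<infinity>" by (simp add: emeasure_space_1)
  finally show ?thesis .
qed

text \<open>Index pairs make one form fit two uses: the scalar coordinates of a smooth cylindrical
  function, a sum over \<open>k\<close> with a dummy second index, and those of its gradient, a
  double sum over \<open>k\<close> and \<open>i\<close>.\<close>

definition cyl_span :: "('w::real_normed_vector \<Rightarrow> real) set" where
  "cyl_span = {\<lambda>w. \<Sum>k\<in>K. c k * f k (evals lam w)
     | (K :: (nat \<times> nat) set) c f (lam :: nat \<Rightarrow> 'w \<Rightarrow>\<^sub>L real).
       finite K \<and> (\<forall>k\<in>K. \<exists>n. smooth_bounded n (f k))}"

lemma cyl_spanI:
  fixes lam :: "nat \<Rightarrow> 'w::real_normed_vector \<Rightarrow>\<^sub>L real" and K :: "(nat \<times> nat) set"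
  assumes "finite K" "\<And>k. k \<in> K \<Longrightarrow> \<exists>n. smooth_bounded n (f k)"
  shows "(\<lambda>w. \<Sum>k\<in>K. c k * f k (evals lam w)) \<in> cyl_span"
  unfolding cyl_span_def mem_Collect_eq
  by (intro exI[of _ K] exI[of _ c] exI[of _ f] exI[of _ lam]) (use assms in auto)

lemma nn_sq_mult_bounded:
  fixes f g :: "'a \<Rightarrow> real"
  assumes [measurable]: "f \<in> borel_measurable M" and g: "\<And>w. \<bar>g w\<bar> \<le> C"
    and f: "msq M f < \<infinity>"
  shows "msq M (\<lambda>w. f w * g w) < \<infinity>"
proof -
  have "(g w)\<^sup>2 \<le> C\<^sup>2" for w using power_mono[OF g[of w], of 2] by simp
  then have "msq M (\<lambda>w. f w * g w) \<le> msq M (\<lambda>w. C * f w)"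
    by (intro nn_integral_mono ennreal_leI) (simp add: power_mult_distrib mult.commute[of "C\<^sup>2"] mult_left_mono)
  also have "\<dots> < \<infinity>" using f by (subst nn_sq_cmult) (simp_all add: ennreal_mult_less_top)
  finally show ?thesis .
qed

lemma integral_mult_tendsto_L2:
  fixes f :: "nat \<Rightarrow> 'a \<Rightarrow> real"
  assumes m [measurable]: "\<And>n. f n \<in> borel_measurable M" "g \<in> borel_measurable M" "q \<in> borel_measurable M"
    and L2: "\<And>n. msq M (f n) < \<infinity>" "msq M g < \<infinity>"
      "msq M q < \<infinity>"
    and lim: "(\<lambda>n. msq M (\<lambda>w. f n w - g w)) \<longlonglongrightarrow> 0"
  shows "(\<lambda>n. \<integral>w. f n w * q w \<partial>M) \<longlonglongrightarrow> (\<integral>w. g w * q w \<partial>M)"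
proof (rule integral_tendsto_L1)
  show "(\<lambda>n. \<integral>\<^sup>+ w. ennreal (norm (f n w * q w - g w * q w)) \<partial>M) \<longlonglongrightarrow> 0"
    using L2_pairing_tendsto_0[of "\<lambda>n w. f n w - g w" M q, OF _ _ lim L2(3)] by (simp add: left_diff_distrib)
qed (auto intro!: integrable_L2_mult L2)

lemma nn_sq_diff_finite:
  fixes f g :: "'a \<Rightarrow> real"
  assumes [measurable]: "f \<in> borel_measurable M" "g \<in> borel_measurable M"
    and "msq M f < \<infinity>" "msq M g < \<infinity>"
  shows "msq M (\<lambda>w. f w - g w) < \<infinity>"
proof -
  have "msq M (\<lambda>w. f w + - g w) \<le> 2 * msq M f + 2 * msq M (\<lambda>w. - g w)"
    by (rule nn_sq_add) auto
  also have "\<dots> < \<infinity>" using assms(3,4) by (simp add: ennreal_mult_less_top)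
  finally show ?thesis by simp
qed

section \<open>Integration by parts on the Wiener space\<close>

context wiener_space
begin

lemma continuous_cylindrical:
  fixes lam :: "nat \<Rightarrow> 'w \<Rightarrow>\<^sub>L real"
  assumes "continuous_on UNIV f"
  shows "continuous_on UNIV (\<lambda>w. f (evals lam w))"
  by (rule continuous_on_compose2[OF assms]) (auto intro!: continuous_on_coordinatewise_then_product continuous_intros)

text \<open>\<open>c i\<close> is the inner product of the image of \<open>lam i\<close> with the
  unit vector of \<open>l\<close>. Subtracting \<open>c i\<close> times \<open>l\<close> removes the
  component along that vector, so the remainders belong to vectors orthogonal to it and are jointly
  independent of \<open>l\<close>.\<close>

lemma distr_functional_remainder:
  fixes lam :: "nat \<Rightarrow> 'w \<Rightarrow>\<^sub>L real"
  assumes l: "norm (dual_embedding j l) = 1"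
  defines "c \<equiv> \<lambda>i. lam i \<cdot> (j \<cdot> dual_embedding j l)"
  defines "Y \<equiv> \<lambda>w i. lam i \<cdot> w - c i * l \<cdot> w"
  shows "Y \<in> borel_measurable \<mu>"
    and "distr \<mu> borel (blinfun_apply l) \<Otimes>\<^sub>M distr \<mu> borel Y
      = distr \<mu> (borel \<Otimes>\<^sub>M borel) (\<lambda>w. (l \<cdot> w, Y w))"
proof -
  let ?h = "dual_embedding j l"
  define E where "E = {(\<lambda>w. Y w i) -` A \<inter> space \<mu> | i A. i \<in> (UNIV :: nat set) \<and> A \<in> sets (borel :: real measure)} \<union> null_sets \<mu>"
  have Yi: "is_delta \<mu> j (dual_embedding j (lam i) + (- c i) *\<^sub>R ?h) (\<lambda>w. Y w i)" for i
    using is_delta_lin[OF is_delta_functional is_delta_functional, of "lam i" "- c i" l] by (simp add: Y_def)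
  have "inner ?h (dual_embedding j (lam i) + (- c i) *\<^sub>R ?h) = 0" for i
    using l by (simp add: inner_add_right c_def dual_embedding norm_eq_1) (simp add: inner_diff_right inner_commute)
  then have indep: "indep_set (sigma_sets (space \<mu>) {blinfun_apply l -` B \<inter> space \<mu> | B. B \<in> sets borel})
      (sigma_sets (space \<mu>) E)"
    unfolding E_def by (intro is_delta_indep[OF is_delta_functional Yi]) auto
  have EP: "E \<subseteq> Pow (space \<mu>)" unfolding E_def by auto
  \<comment> \<open>Coordinatewise measurability makes the sequence-valued \<open>Y\<close>
    measurable for \<open>sigma (space \<mu>) E\<close>, so independence passes from the coordinates
    to events of the whole sequence.\<close>
  have "Y \<in> borel_measurable (sigma (space \<mu>) E)"
  proof (rule measurable_coordinatewise_then_product)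
    fix i
    show "(\<lambda>w. Y w i) \<in> borel_measurable (sigma (space \<mu>) E)"
    proof (rule measurableI)
      fix A assume "A \<in> sets (borel :: real measure)"
      then have "(\<lambda>w. Y w i) -` A \<inter> space \<mu> \<in> E" unfolding E_def by blast
      then show "(\<lambda>w. Y w i) -` A \<inter> space (sigma (space \<mu>) E) \<in> sets (sigma (space \<mu>) E)"
        using EP by (simp add: sets_measure_of space_measure_of_conv)
    qed simp
  qed
  from measurable_sets[OF this] have "{Y -` A \<inter> space \<mu> | A. A \<in> sets borel} \<subseteq> sigma_sets (space \<mu>) E"
    using EP by (auto simp: sets_measure_of space_measure_of_conv)
  note YE = this
  show Ym [measurable]: "Y \<in> borel_measurable \<mu>"
    by (rule measurable_coordinatewise_then_product) (use Yi delta_borel in auto)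
  interpret X: prob_space "distr \<mu> borel (blinfun_apply l)" by (rule prob_space_distr) simp
  interpret Y: prob_space "distr \<mu> borel Y" by (rule prob_space_distr) simp
  show "distr \<mu> borel (blinfun_apply l) \<Otimes>\<^sub>M distr \<mu> borel Y
      = distr \<mu> (borel \<Otimes>\<^sub>M borel) (\<lambda>w. (l \<cdot> w, Y w))"
  proof (rule pair_measure_eqI)
    fix A B assume "A \<in> sets (distr \<mu> borel (blinfun_apply l))" "B \<in> sets (distr \<mu> borel Y)"
    then have AB [measurable]: "A \<in> sets borel" "B \<in> sets borel" by simp_all
    have "blinfun_apply l -` A \<inter> space \<mu> \<in> sigma_sets (space \<mu>) {blinfun_apply l -` B \<inter> space \<mu> | B. B \<in> sets borel}"
      using AB by (intro sigma_sets.Basic) blast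
    moreover have "Y -` B \<inter> space \<mu> \<in> sigma_sets (space \<mu>) E" using YE AB by blast
    ultimately have "prob ((blinfun_apply l -` A \<inter> space \<mu>) \<inter> (Y -` B \<inter> space \<mu>))
        = prob (blinfun_apply l -` A \<inter> space \<mu>) * prob (Y -` B \<inter> space \<mu>)"
      by (rule indep_setD[OF indep])
    moreover have "(\<lambda>w. (l \<cdot> w, Y w)) -` (A \<times> B) \<inter> space \<mu>
        = (blinfun_apply l -` A \<inter> space \<mu>) \<inter> (Y -` B \<inter> space \<mu>)" by auto
    ultimately show "emeasure (distr \<mu> borel (blinfun_apply l)) A * emeasure (distr \<mu> borel Y) B
        = emeasure (distr \<mu> (borel \<Otimes>\<^sub>M borel) (\<lambda>w. (l \<cdot> w, Y w))) (A \<times> B)"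
      by (simp add: emeasure_distr emeasure_eq_measure ennreal_mult del: space_mu)
  qed (auto intro: X.sigma_finite_measure_axioms Y.sigma_finite_measure_axioms)
qed

text \<open>
  With \<open>c\<^sub>i\<close> the derivative of \<open>lam i\<close> in the direction of \<open>l\<close>, the functional \<open>l\<close> is independent of the family
  \<open>lam i - c\<^sub>i l\<close>; conditionally on the latter the claim is one-dimensional.
\<close>

lemma gaussian_ibp:
  fixes lam :: "nat \<Rightarrow> 'w \<Rightarrow>\<^sub>L real" and f f' :: "(nat \<Rightarrow> real) \<Rightarrow> real"
  assumes l: "norm (dual_embedding j l) = 1"
    and f: "continuous_on UNIV f" "\<And>x. \<bar>f x\<bar> \<le> C"
    and f': "continuous_on UNIV f'" "\<And>x. \<bar>f' x\<bar> \<le> C'"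
    and d: "\<And>x s. ((\<lambda>s. f (\<lambda>i. x i + s * lam i \<cdot> (j \<cdot> dual_embedding j l)))
      has_real_derivative f' (\<lambda>i. x i + s * lam i \<cdot> (j \<cdot> dual_embedding j l))) (at s)"
  shows "(\<integral>w. f' (evals lam w) \<partial>\<mu>) = (\<integral>w. l \<cdot> w * f (evals lam w) \<partial>\<mu>)"
proof -
  define c where "c i = lam i \<cdot> (j \<cdot> dual_embedding j l)" for i
  define Y where "Y w i = lam i \<cdot> w - c i * l \<cdot> w" for w i
  let ?X = "blinfun_apply l"
  have Ym [measurable]: "Y \<in> borel_measurable \<mu>"
    and distr: "distr \<mu> borel ?X \<Otimes>\<^sub>M distr \<mu> borel Y = distr \<mu> (borel \<Otimes>\<^sub>M borel) (\<lambda>w. (?X w, Y w))"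
    using distr_functional_remainder[OF l, of lam] unfolding Y_def[abs_def] c_def[abs_def] by auto
  define \<nu> where "\<nu> = distr \<mu> borel Y"
  have [simp]: "sets \<nu> = sets borel" "space \<nu> = UNIV" by (simp_all add: \<nu>_def)
  interpret N: prob_space std_normal_distribution
    using functional_normalized[OF l] prob_space_distr[of ?X borel] by simp
  interpret \<nu>: prob_space \<nu> unfolding \<nu>_def by (rule prob_space_distr) simp
  interpret pair_sigma_finite std_normal_distribution \<nu> ..
  have distr': "std_normal_distribution \<Otimes>\<^sub>M \<nu> = distr \<mu> (borel \<Otimes>\<^sub>M borel) (\<lambda>w. (?X w, Y w))"
    using distr functional_normalized[OF l] by (simp add: \<nu>_def)
  \<comment> \<open>\<open>A\<close> undoes the splitting: it adds the component along
    \<open>l\<close> back to the remainder.\<close>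
  define A where "A x y = (\<lambda>i. y i + x * c i)" for x and y :: "nat \<Rightarrow> real"
  have AXY: "A (?X w) (Y w) = (evals lam w)" for w by (simp add: A_def Y_def)
  have [measurable]: "(\<lambda>y. y i) \<in> borel_measurable (borel :: (nat \<Rightarrow> real) measure)" for i
    by (rule borel_measurable_continuous_onI) simp
  have A [measurable]: "(\<lambda>p. A (fst p) (snd p)) \<in> borel_measurable (borel \<Otimes>\<^sub>M borel)"
    unfolding A_def by (rule measurable_coordinatewise_then_product) measurable
  have [measurable]: "f \<in> borel_measurable borel" "f' \<in> borel_measurable borel"
    using f f' by (auto intro: borel_measurable_continuous_onI)
  have fubini: "(\<integral>w. g (?X w) (Y w) \<partial>\<mu>) = (\<integral>y. (\<integral>x. g x y \<partial>std_normal_distribution) \<partial>\<nu>)"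
    if m [measurable]: "(\<lambda>p. g (fst p) (snd p)) \<in> borel_measurable (borel \<Otimes>\<^sub>M borel)"
      and i: "integrable \<mu> (\<lambda>w. g (?X w) (Y w))" for g :: "real \<Rightarrow> (nat \<Rightarrow> real) \<Rightarrow> real"
  proof -
    have "integrable (std_normal_distribution \<Otimes>\<^sub>M \<nu>) (\<lambda>p. g (fst p) (snd p))"
      unfolding distr' using i by (subst integrable_distr_eq) auto
    then have "(\<integral>y. (\<integral>x. g x y \<partial>std_normal_distribution) \<partial>\<nu>)
        = (\<integral>p. g (fst p) (snd p) \<partial>(std_normal_distribution \<Otimes>\<^sub>M \<nu>))"
      using integral_snd[of g] by (simp add: case_prod_unfold)
    also have "\<dots> = (\<integral>w. g (?X w) (Y w) \<partial>\<mu>)"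
      unfolding distr' by (subst integral_distr) auto
    finally show ?thesis by simp
  qed
  have "(\<integral>w. f' (evals lam w) \<partial>\<mu>) = (\<integral>w. f' (A (?X w) (Y w)) \<partial>\<mu>)" by (simp add: AXY)
  also have "\<dots> = (\<integral>y. (\<integral>x. f' (A x y) \<partial>std_normal_distribution) \<partial>\<nu>)"
    by (rule fubini[of "\<lambda>x y. f' (A x y)"])
       (auto simp: AXY intro!: integrable_const_bound[of _ C'] f' measurable_of_continuous continuous_cylindrical)
  also have "\<dots> = (\<integral>y. (\<integral>x. x * f (A x y) \<partial>std_normal_distribution) \<partial>\<nu>)"
  proof (rule Bochner_Integration.integral_cong[OF refl])
    fix y
    show "(\<integral>x. f' (A x y) \<partial>std_normal_distribution) = (\<integral>x. x * f (A x y) \<partial>std_normal_distribution)"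
    \<comment> \<open>With \<open>y\<close> frozen the integrand lives on a line in direction
      \<open>c\<close>, and hypothesis \<open>d\<close> supplies its derivative.\<close>
    proof (rule std_normal_ibp[where C=C and C'=C'])
      show "((\<lambda>x. f (A x y)) has_real_derivative f' (A x y)) (at x)" for x
        unfolding A_def c_def by (rule d)
      show "continuous_on UNIV (\<lambda>x. f' (A x y))"
        by (rule continuous_on_compose2[OF f'(1)])
           (auto simp: A_def intro!: continuous_on_coordinatewise_then_product continuous_intros)
    qed (use f f' in auto)
  qed
  also have "\<dots> = (\<integral>w. ?X w * f (A (?X w) (Y w)) \<partial>\<mu>)"
  proof (rule fubini[of "\<lambda>x y. x * f (A x y)", symmetric])
    show "integrable \<mu> (\<lambda>w. ?X w * f (A (?X w) (Y w)))"
      unfolding AXY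
      by (intro integrable_L2_mult is_delta_L2[OF is_delta_functional] measurable_functional
            bounded_square_integrable[of _ C] measurable_of_continuous continuous_cylindrical f)
  qed measurable
  finally show ?thesis by (simp add: AXY)
qed

text \<open>By the Leibniz rule, \<open>gaussian_ibp\<close> for the product moves the derivative
  from \<open>F\<close> to \<open>G\<close>; the weight \<open>l \<cdot> w * G w - dG w\<close> is
  the divergence of \<open>G\<close> in the direction \<open>h\<close>.\<close>

lemma gaussian_ibp_product:
  fixes lam lam' :: "nat \<Rightarrow> 'w \<Rightarrow>\<^sub>L real"
  assumes l: "norm (dual_embedding j l) = 1" and f: "smooth_bounded n f" and g: "smooth_bounded m g"
  defines "h \<equiv> dual_embedding j l"
  defines "F \<equiv> \<lambda>w. f (evals lam w)" and "G \<equiv> \<lambda>w. g (evals lam' w)"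
  defines "dF \<equiv> \<lambda>w. dir_deriv n f (evals lam (j \<cdot> h)) (evals lam w)"
  defines "dG \<equiv> \<lambda>w. dir_deriv m g (evals lam' (j \<cdot> h)) (evals lam' w)"
  shows "(\<integral>w. dF w * G w \<partial>\<mu>) = (\<integral>w. F w * (l \<cdot> w * G w - dG w) \<partial>\<mu>)"
proof -
  define c where "c i = lam i \<cdot> (j \<cdot> h)" for i
  define c' where "c' i = lam' i \<cdot> (j \<cdot> h)" for i
  \<comment> \<open>Interleaving the two families makes the product a function of a single one.\<close>
  define lam2 where "lam2 i = (if even i then lam (i div 2) else lam' (i div 2))" for i
  define c2 where "c2 i = lam2 i \<cdot> (j \<cdot> h)" for i
  define ev od where "ev x = (\<lambda>i. x (2 * i))" and "od x = (\<lambda>i. x (Suc (2 * i)))" for x :: "nat \<Rightarrow> real"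
  define df where "df = dir_deriv n f c"
  define dg where "dg = dir_deriv m g c'"
  have cont: "continuous_on UNIV ev" "continuous_on UNIV od"
    unfolding ev_def od_def by (auto intro!: continuous_on_coordinatewise_then_product)
  note fc = smooth_bounded_continuous[OF f] smooth_bounded_directional(1)[OF f, of c, folded df_def]
  note gc = smooth_bounded_continuous[OF g] smooth_bounded_directional(1)[OF g, of c', folded dg_def]
  obtain Cf Cf' Cg Cg' where Cf: "\<And>x. \<bar>f x\<bar> \<le> Cf" "\<And>x. \<bar>df x\<bar> \<le> Cf'"
    and Cg: "\<And>x. \<bar>g x\<bar> \<le> Cg" "\<And>x. \<bar>dg x\<bar> \<le> Cg'"
    using smooth_bounded_bounded[OF f] smooth_bounded_bounded[OF g] smooth_bounded_directional(2)[OF f, of c]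
      smooth_bounded_directional(2)[OF g, of c'] unfolding df_def dg_def by metis
  have pos: "0 \<le> Cf" "0 \<le> Cf'" "0 \<le> Cg" "0 \<le> Cg'" using Cf Cg abs_ge_zero order_trans by blast+
  have split: "ev (evals lam2 w) = (evals lam w)"
    "od (evals lam2 w) = (evals lam' w)" for w
    by (simp_all add: ev_def od_def lam2_def)
  have line: "ev (\<lambda>i. x i + s * c2 i) = (\<lambda>i. ev x i + s * c i)" "od (\<lambda>i. x i + s * c2 i) = (\<lambda>i. od x i + s * c' i)" for x s
    by (simp_all add: ev_def od_def c2_def lam2_def c_def c'_def)
  have "(\<integral>w. (\<lambda>x. df (ev x) * g (od x) + f (ev x) * dg (od x)) (evals lam2 w) \<partial>\<mu>)
    = (\<integral>w. l \<cdot> w * (\<lambda>x. f (ev x) * g (od x)) (evals lam2 w) \<partial>\<mu>)"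
  proof (rule gaussian_ibp[OF l, where C="Cf * Cg" and C'="Cf' * Cg + Cf * Cg'"])
    show "continuous_on UNIV (\<lambda>x. f (ev x) * g (od x))"
      "continuous_on UNIV (\<lambda>x. df (ev x) * g (od x) + f (ev x) * dg (od x))"
      by (auto intro!: continuous_intros continuous_on_compose2[OF fc(1)] continuous_on_compose2[OF fc(2)]
          continuous_on_compose2[OF gc(1)] continuous_on_compose2[OF gc(2)] cont)
    show "\<bar>f (ev x) * g (od x)\<bar> \<le> Cf * Cg" for x using Cf Cg pos by (auto simp: abs_mult intro!: mult_mono)
    have "\<bar>df (ev x) * g (od x) + f (ev x) * dg (od x)\<bar> \<le> \<bar>df (ev x)\<bar> * \<bar>g (od x)\<bar> + \<bar>f (ev x)\<bar> * \<bar>dg (od x)\<bar>" for x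
      by (metis abs_mult abs_triangle_ineq)
    then show "\<bar>df (ev x) * g (od x) + f (ev x) * dg (od x)\<bar> \<le> Cf' * Cg + Cf * Cg'" for x
      by (rule order_trans) (use Cf Cg pos in \<open>auto intro!: add_mono mult_mono\<close>)
    fix x s
    let ?c = "\<lambda>i. lam2 i \<cdot> (j \<cdot> dual_embedding j l)"
    show "((\<lambda>s. f (ev (\<lambda>i. x i + s * ?c i))
        * g (od (\<lambda>i. x i + s * ?c i)))
      has_real_derivative df (ev (\<lambda>i. x i + s * ?c i))
        * g (od (\<lambda>i. x i + s * ?c i))
        + f (ev (\<lambda>i. x i + s * ?c i))
        * dg (od (\<lambda>i. x i + s * ?c i))) (at s)"
      unfolding h_def[symmetric] c2_def[symmetric] line df_def dg_def
      by (rule DERIV_cong[OF DERIV_mult[OF has_derivative_along_line[OF f] has_derivative_along_line[OF g]]])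
         (simp add: mult.commute)
  qed
  then have *: "(\<integral>w. dF w * G w + F w * dG w \<partial>\<mu>) = (\<integral>w. l \<cdot> w * (F w * G w) \<partial>\<mu>)"
    by (simp add: split F_def G_def dF_def dG_def df_def dg_def c_def[abs_def] c'_def[abs_def])
  have [measurable]: "F \<in> borel_measurable \<mu>" "G \<in> borel_measurable \<mu>" "dF \<in> borel_measurable \<mu>" "dG \<in> borel_measurable \<mu>"
    unfolding F_def G_def dF_def dG_def using fc gc
    by (auto intro!: measurable_of_continuous continuous_cylindrical simp: df_def dg_def c_def[abs_def] c'_def[abs_def])
  have FG: "\<bar>F w\<bar> \<le> Cf" "\<bar>G w\<bar> \<le> Cg" "\<bar>dF w\<bar> \<le> Cf'" "\<bar>dG w\<bar> \<le> Cg'" for w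
    using Cf Cg by (simp_all add: F_def G_def dF_def dG_def df_def dg_def c_def[abs_def] c'_def[abs_def])
  have i1: "integrable \<mu> (\<lambda>w. dF w * G w)" "integrable \<mu> (\<lambda>w. F w * dG w)"
    by (rule integrable_const_bound[of _ "Cf' * Cg"], use FG pos in \<open>auto simp: abs_mult intro!: mult_mono\<close>)
       (rule integrable_const_bound[of _ "Cf * Cg'"], use FG pos in \<open>auto simp: abs_mult intro!: mult_mono\<close>)
  have i2: "integrable \<mu> (\<lambda>w. l \<cdot> w * (F w * G w))"
    using FG pos by (intro integrable_L2_mult is_delta_L2[OF is_delta_functional] bounded_square_integrable[of _ "Cf * Cg"])
      (auto simp: abs_mult intro!: mult_mono)
  have "(\<integral>w. F w * (l \<cdot> w * G w - dG w) \<partial>\<mu>) = (\<integral>w. l \<cdot> w * (F w * G w) - F w * dG w \<partial>\<mu>)"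
    by (simp add: algebra_simps)
  then show ?thesis using * i1 i2 by simp
qed

lemma cylindrical_L2:
  fixes lam :: "nat \<Rightarrow> 'w \<Rightarrow>\<^sub>L real"
  assumes "smooth_bounded n f"
  shows "(\<lambda>w. f (evals lam w)) \<in> borel_measurable \<mu>"
    "msq \<mu> (\<lambda>w. f (evals lam w)) < \<infinity>"
    "\<exists>C. \<forall>w. \<bar>f (evals lam w)\<bar> \<le> C"
proof -
  obtain C where C: "\<And>x. \<bar>f x\<bar> \<le> C" using smooth_bounded_bounded[OF assms] by blast
  show "(\<lambda>w. f (evals lam w)) \<in> borel_measurable \<mu>"
    by (intro measurable_of_continuous continuous_cylindrical smooth_bounded_continuous[OF assms])
  show "msq \<mu> (\<lambda>w. f (evals lam w)) < \<infinity>"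
    by (rule bounded_square_integrable) (rule C)
  show "\<exists>C. \<forall>w. \<bar>f (evals lam w)\<bar> \<le> C" using C by blast
qed

lemma dir_deriv_L2:
  fixes lam :: "nat \<Rightarrow> 'w \<Rightarrow>\<^sub>L real"
  assumes "smooth_bounded n f"
  shows "(\<lambda>w. dir_deriv n f c (evals lam w)) \<in> borel_measurable \<mu>"
    "msq \<mu> (\<lambda>w. dir_deriv n f c (evals lam w)) < \<infinity>"
proof -
  obtain C where C: "\<And>x. \<bar>dir_deriv n f c x\<bar> \<le> C" using smooth_bounded_directional(2)[OF assms] by blast
  show "(\<lambda>w. dir_deriv n f c (evals lam w)) \<in> borel_measurable \<mu>"
    by (intro measurable_of_continuous continuous_cylindrical smooth_bounded_directional(1)[OF assms])
  show "msq \<mu> (\<lambda>w. dir_deriv n f c (evals lam w)) < \<infinity>"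
    by (rule bounded_square_integrable) (rule C)
qed

lemma ibp_weight_L2:
  fixes lam :: "nat \<Rightarrow> 'w \<Rightarrow>\<^sub>L real" and l :: "'w \<Rightarrow>\<^sub>L real" and c :: "nat \<Rightarrow> real"
  assumes g: "smooth_bounded m g"
  defines "q \<equiv> \<lambda>w. l \<cdot> w * g (evals lam w)
     - dir_deriv m g c (evals lam w)"
  shows "q \<in> borel_measurable \<mu>" "msq \<mu> q < \<infinity>"
proof -
  note [measurable] = cylindrical_L2(1)[OF g, of lam] dir_deriv_L2(1)[OF g, of c lam]
  obtain C where C: "\<And>w. \<bar>g (evals lam w)\<bar> \<le> C" using cylindrical_L2(3)[OF g] by blast
  show "q \<in> borel_measurable \<mu>" unfolding q_def by measurable
  show "msq \<mu> q < \<infinity>"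
    unfolding q_def
    by (intro nn_sq_diff_finite nn_sq_mult_bounded[OF _ C] dir_deriv_L2(2)[OF g]
        is_delta_L2[OF is_delta_functional]) measurable
qed

lemma cyl_span_bounded:
  assumes "\<phi> \<in> cyl_span"
  shows "\<phi> \<in> borel_measurable \<mu>" "\<exists>C. \<forall>w. \<bar>\<phi> w\<bar> \<le> C"
proof -
  obtain c f and K :: "(nat \<times> nat) set" and lam :: "nat \<Rightarrow> 'w \<Rightarrow>\<^sub>L real"
    where \<phi>: "\<phi> = (\<lambda>w. \<Sum>k\<in>K. c k * f k (evals lam w))"
    and f: "\<forall>k\<in>K. \<exists>n. smooth_bounded n (f k)"
    using assms unfolding cyl_span_def by blast
  have f: "\<exists>n. smooth_bounded n (f k)" if "k \<in> K" for k using f that by blast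
  show "\<phi> \<in> borel_measurable \<mu>"
    unfolding \<phi> by (intro borel_measurable_sum borel_measurable_times borel_measurable_const) (use f cylindrical_L2(1) in blast)
  have "\<forall>k. \<exists>C. k \<in> K \<longrightarrow> (\<forall>w. \<bar>f k (evals lam w)\<bar> \<le> C)"
    using f cylindrical_L2(3) by meson
  then obtain C where C: "\<And>k w. k \<in> K \<Longrightarrow> \<bar>f k (evals lam w)\<bar> \<le> C k" by metis
  have "\<bar>\<phi> w\<bar> \<le> (\<Sum>k\<in>K. \<bar>c k\<bar> * C k)" for w
    unfolding \<phi> using C by (intro order_trans[OF sum_abs] sum_mono) (auto simp: abs_mult intro!: mult_left_mono)
  then show "\<exists>C. \<forall>w. \<bar>\<phi> w\<bar> \<le> C" by blast
qed

lemma cyl_span_L2: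
  assumes "\<phi> \<in> cyl_span"
  shows "\<phi> \<in> borel_measurable \<mu>" "msq \<mu> \<phi> < \<infinity>"
proof -
  show "\<phi> \<in> borel_measurable \<mu>" by (rule cyl_span_bounded(1)[OF assms])
  obtain C where "\<And>w. \<bar>\<phi> w\<bar> \<le> C" using cyl_span_bounded(2)[OF assms] by blast
  then show "msq \<mu> \<phi> < \<infinity>" by (rule bounded_square_integrable)
qed

lemma cylindrical_coordinates:
  assumes "smooth_cylindrical j U G"
  shows "(\<lambda>w. inner (U w) v) \<in> cyl_span" "(\<lambda>w. inner (G w \<cdot> h) v) \<in> cyl_span"
proof -
  obtain f lam a and m n :: nat where f: "\<forall>k<m. smooth_bounded n (f k)"
    and U: "\<forall>w. U w = (\<Sum>k<m. f k (evals lam w) *\<^sub>R a k)"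
    and G: "\<forall>w h. G w \<cdot> h = (\<Sum>k<m. (\<Sum>i<n. partial_deriv i (f k) (evals lam w) *
                             lam i \<cdot> (j \<cdot> h)) *\<^sub>R a k)"
    using assms unfolding smooth_cylindrical_def by blast
  have eU: "(\<lambda>w. inner (U w) v) = (\<lambda>w. \<Sum>p\<in>{..<m} \<times> {0::nat}. inner (a (fst p)) v * f (fst p) (evals lam w))"
    using U by (simp add: inner_sum_left mult.commute sum.cartesian_product' fun_eq_iff)
  show "(\<lambda>w. inner (U w) v) \<in> cyl_span"
    unfolding eU by (rule cyl_spanI[where f="\<lambda>p. f (fst p)"]) (auto intro!: exI[of _ n] f[rule_format])
  have eG: "(\<lambda>w. inner (G w \<cdot> h) v) = (\<lambda>w. \<Sum>p\<in>{..<m} \<times> {..<n}.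
      ((lam (snd p)) \<cdot> (j \<cdot> h) * inner (a (fst p)) v)
      * partial_deriv (snd p) (f (fst p)) (evals lam w))"
    using G by (simp add: inner_sum_left sum_distrib_left sum_distrib_right mult_ac sum.cartesian_product' fun_eq_iff)
  show "(\<lambda>w. inner (G w \<cdot> h) v) \<in> cyl_span"
    unfolding eG by (rule cyl_spanI[where f="\<lambda>p. partial_deriv (snd p) (f (fst p))"]) (auto intro!: exI[of _ n] smooth_bounded_partial f[rule_format])
qed

lemma smooth_cylindrical_ibp:
  assumes UG: "smooth_cylindrical j U G" and l: "norm (dual_embedding j l) = 1" and g: "smooth_bounded m g"
  defines "h \<equiv> dual_embedding j l"
  shows "(\<integral>w. inner (G w \<cdot> h) v * g (evals lam' w) \<partial>\<mu>)
    = (\<integral>w. inner (U w) v * (l \<cdot> w * g (evals lam' w)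
        - dir_deriv m g (evals lam' (j \<cdot> h)) (evals lam' w)) \<partial>\<mu>)"
proof -
  obtain f lam a and m' n :: nat where f: "\<forall>k<m'. smooth_bounded n (f k)"
    and U: "\<forall>w. U w = (\<Sum>k<m'. f k (evals lam w) *\<^sub>R a k)"
    and G: "\<forall>w h. G w \<cdot> h = (\<Sum>k<m'. (\<Sum>i<n. partial_deriv i (f k) (evals lam w) *
                             lam i \<cdot> (j \<cdot> h)) *\<^sub>R a k)"
    using UG unfolding smooth_cylindrical_def by blast
  define F where "F k w = f k (evals lam w)" for k w
  define dF where "dF k w = dir_deriv n (f k) (evals lam (j \<cdot> h)) (evals lam w)" for k w
  define g' where "g' w = g (evals lam' w)" for w
  define dg where "dg w = dir_deriv m g (evals lam' (j \<cdot> h)) (evals lam' w)" for w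
  define q where "q w = l \<cdot> w * g' w - dg w" for w
  note q = ibp_weight_L2[OF g, of l lam' "\<lambda>i. lam' i \<cdot> (j \<cdot> h)", folded g'_def dg_def, folded q_def]
  have m: "F k \<in> borel_measurable \<mu>" "msq \<mu> (F k) < \<infinity>"
    "dF k \<in> borel_measurable \<mu>" "msq \<mu> (dF k) < \<infinity>" if "k < m'" for k
    using f that cylindrical_L2 dir_deriv_L2 unfolding F_def[abs_def] dF_def[abs_def] by blast+
  have mg: "g' \<in> borel_measurable \<mu>" "msq \<mu> g' < \<infinity>"
    using cylindrical_L2[OF g] unfolding g'_def[abs_def] by blast+
  have key: "(\<integral>w. dF k w * g' w \<partial>\<mu>) = (\<integral>w. F k w * q w \<partial>\<mu>)" if "k < m'" for k
    using gaussian_ibp_product[OF l _ g, of n "f k" lam lam'] f that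
    unfolding F_def dF_def g'_def dg_def q_def h_def by blast
  have "(\<integral>w. inner (G w \<cdot> h) v * g' w \<partial>\<mu>) = (\<integral>w. (\<Sum>k<m'. inner (a k) v * (dF k w * g' w)) \<partial>\<mu>)"
    using G by (simp add: inner_sum_left sum_distrib_left sum_distrib_right mult_ac dF_def dir_deriv_def)
  also have "\<dots> = (\<Sum>k<m'. inner (a k) v * (\<integral>w. dF k w * g' w \<partial>\<mu>))"
    by (subst Bochner_Integration.integral_sum) (auto intro!: integrable_mult_right integrable_L2_mult m mg)
  also have "\<dots> = (\<Sum>k<m'. inner (a k) v * (\<integral>w. F k w * q w \<partial>\<mu>))" using key by simp
  also have "\<dots> = (\<integral>w. (\<Sum>k<m'. inner (a k) v * (F k w * q w)) \<partial>\<mu>)"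
    by (subst Bochner_Integration.integral_sum) (auto intro!: integrable_mult_right integrable_L2_mult m q)
  also have "\<dots> = (\<integral>w. inner (U w) v * q w \<partial>\<mu>)"
    using U by (simp add: inner_sum_left sum_distrib_left sum_distrib_right mult_ac F_def)
  finally show ?thesis unfolding q_def g'_def dg_def .
qed

section \<open>Passage to the closed gradient and its uniqueness\<close>

lemma gradient_coordinate_approx:
  assumes D: "is_malliavin_gradient \<mu> j u D" and h: "norm h \<le> 1" and v: "norm v \<le> 1"
  shows "(\<lambda>w. inner (D w \<cdot> h) v) \<in> borel_measurable \<mu>"
    "msq \<mu> (\<lambda>w. inner (D w \<cdot> h) v) < \<infinity>"
    "(\<lambda>w. inner (u w) v) \<in> borel_measurable \<mu>"
    "msq \<mu> (\<lambda>w. inner (u w) v) < \<infinity>"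
    "\<exists>U G. (\<forall>n. smooth_cylindrical j (U n) (G n)) \<and>
      (\<lambda>n. msq \<mu> (\<lambda>w. inner (U n w) v - inner (u w) v)) \<longlonglongrightarrow> 0 \<and>
      (\<lambda>n. msq \<mu> (\<lambda>w. inner (G n w \<cdot> h) v - inner (D w \<cdot> h) v)) \<longlonglongrightarrow> 0" (is ?ex)
proof -
  have inner_le: "(inner x v)\<^sup>2 \<le> (norm x)\<^sup>2" for x :: 'h
  proof -
    have "\<bar>inner x v\<bar> \<le> norm x" using Cauchy_Schwarz_ineq2[of x v] v by (simp add: mult_left_le order_trans)
    then show ?thesis using power_mono[of "\<bar>inner x v\<bar>" "norm x" 2] by simp
  qed
  have hs: "ennreal ((inner (A \<cdot> h) v)\<^sup>2) \<le> hs_norm2 A" for A :: "'h \<Rightarrow>\<^sub>L 'h"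
    using norm_sq_le_hs_norm2[OF orthonormal_basis_range h, of A] inner_le[of "A \<cdot> h"]
    by (meson ennreal_leI order_trans)
  show "(\<lambda>w. inner (D w \<cdot> h) v) \<in> borel_measurable \<mu>"
    using D unfolding is_malliavin_gradient_def by (intro borel_measurable_inner) auto
  show "(\<lambda>w. inner (u w) v) \<in> borel_measurable \<mu>"
    using D unfolding is_malliavin_gradient_def by (intro borel_measurable_inner) auto
  have "msq \<mu> (\<lambda>w. inner (u w) v) \<le> msq \<mu> (\<lambda>w. norm (u w))"
    by (intro nn_integral_mono ennreal_leI inner_le)
  also have "\<dots> < \<infinity>" using D unfolding is_malliavin_gradient_def by blast
  finally show "msq \<mu> (\<lambda>w. inner (u w) v) < \<infinity>" .
  have "msq \<mu> (\<lambda>w. inner (D w \<cdot> h) v) \<le> (\<integral>\<^sup>+ w. hs_norm2 (D w) \<partial>\<mu>)"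
    by (intro nn_integral_mono hs)
  also have "\<dots> < \<infinity>" using D unfolding is_malliavin_gradient_def by blast
  finally show "msq \<mu> (\<lambda>w. inner (D w \<cdot> h) v) < \<infinity>" .
  obtain U G where UG: "\<forall>n. smooth_cylindrical j (U n) (G n)"
    and U: "(\<lambda>n. msq \<mu> (\<lambda>w. norm (U n w - u w))) \<longlonglongrightarrow> 0"
    and G: "(\<lambda>n. \<integral>\<^sup>+ w. hs_norm2 (G n w - D w) \<partial>\<mu>) \<longlonglongrightarrow> 0"
    using D unfolding is_malliavin_gradient_def by blast
  have "(\<lambda>n. msq \<mu> (\<lambda>w. inner (U n w) v - inner (u w) v)) \<longlonglongrightarrow> 0"
    by (rule tendsto_sandwich[OF _ _ tendsto_const U])
       (auto intro!: always_eventually nn_integral_mono ennreal_leI inner_le simp: inner_diff_left[symmetric])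
  moreover have "(\<lambda>n. msq \<mu> (\<lambda>w. inner (G n w \<cdot> h) v - inner (D w \<cdot> h) v)) \<longlonglongrightarrow> 0"
    by (rule tendsto_sandwich[OF _ _ tendsto_const G])
       (auto intro!: always_eventually nn_integral_mono hs simp: inner_diff_left[symmetric] blinfun.diff_left[symmetric])
  ultimately show ?ex
    using UG by blast
qed

text \<open>Integration by parts survives the limit because the test function and its weight are
  square integrable. The right-hand side contains \<open>u\<close> but not \<open>D\<close>, so the
  pairings with cylindrical functions agree for all versions of the gradient.\<close>

lemma malliavin_gradient_weak:
  assumes D: "is_malliavin_gradient \<mu> j u D" and l: "norm (dual_embedding j l) = 1" and g: "smooth_bounded m g"
    and v: "norm v \<le> 1"
  defines "h \<equiv> dual_embedding j l"
  shows "(\<integral>w. inner (D w \<cdot> h) v * g (evals lam w) \<partial>\<mu>)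
    = (\<integral>w. inner (u w) v * (l \<cdot> w * g (evals lam w)
        - dir_deriv m g (evals lam (j \<cdot> h)) (evals lam w)) \<partial>\<mu>)"
proof -
  let ?q = "\<lambda>w. l \<cdot> w * g (evals lam w) - dir_deriv m g (evals lam (j \<cdot> h)) (evals lam w)"
  have h: "norm h \<le> 1" using l by (simp add: h_def)
  obtain U G where UG: "\<And>n. smooth_cylindrical j (U n) (G n)"
    and U: "(\<lambda>n. msq \<mu> (\<lambda>w. inner (U n w) v - inner (u w) v)) \<longlonglongrightarrow> 0"
    and G: "(\<lambda>n. msq \<mu> (\<lambda>w. inner (G n w \<cdot> h) v - inner (D w \<cdot> h) v)) \<longlonglongrightarrow> 0"
    using gradient_coordinate_approx(5)[OF D h v] by blast
  note q = ibp_weight_L2[OF g, of l lam "\<lambda>i. lam i \<cdot> (j \<cdot> h)"]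
  have "(\<lambda>n. \<integral>w. inner (G n w \<cdot> h) v * g (evals lam w) \<partial>\<mu>)
      \<longlonglongrightarrow> (\<integral>w. inner (D w \<cdot> h) v * g (evals lam w) \<partial>\<mu>)"
    by (intro integral_mult_tendsto_L2 cyl_span_L2 cylindrical_coordinates[OF UG]
        gradient_coordinate_approx(1,2)[OF D h v] cylindrical_L2[OF g] G)
  moreover have "(\<lambda>n. \<integral>w. inner (U n w) v * ?q w \<partial>\<mu>) \<longlonglongrightarrow> (\<integral>w. inner (u w) v * ?q w \<partial>\<mu>)"
    by (intro integral_mult_tendsto_L2 cyl_span_L2 cylindrical_coordinates[OF UG]
        gradient_coordinate_approx(3,4)[OF D h v] q U)
  ultimately show ?thesis
    using smooth_cylindrical_ibp[OF UG l g, of _ v lam] LIMSEQ_unique unfolding h_def by simp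
qed


text \<open>
  The difference \<open>Z\<close> of two versions is orthogonal to all cylindrical functions; as it is an \<open>L\<^sup>2\<close>-limit
  of such functions, no density of cylindrical functions in \<open>L\<^sup>2(\<mu>)\<close> is needed.
\<close>

lemma malliavin_gradient_unique_coordinate:
  assumes D: "is_malliavin_gradient \<mu> j u D" and D': "is_malliavin_gradient \<mu> j u D'"
    and l: "norm (dual_embedding j l) = 1" and v: "norm v \<le> 1"
  defines "h \<equiv> dual_embedding j l"
  shows "AE w in \<mu>. inner (D w \<cdot> h) v = inner (D' w \<cdot> h) v"
proof -
  have h: "norm h \<le> 1" using l by (simp add: h_def)
  define X where "X w = inner (D w \<cdot> h) v" for w
  define X' where "X' w = inner (D' w \<cdot> h) v" for w
  obtain U G where G: "\<And>n. smooth_cylindrical j (U n) (G n)"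
    and Glim: "(\<lambda>n. msq \<mu> (\<lambda>w. inner (G n w \<cdot> h) v - X w)) \<longlonglongrightarrow> 0"
    using gradient_coordinate_approx(5)[OF D h v] unfolding X_def by blast
  obtain U' G' where G': "\<And>n. smooth_cylindrical j (U' n) (G' n)"
    and Glim': "(\<lambda>n. msq \<mu> (\<lambda>w. inner (G' n w \<cdot> h) v - X' w)) \<longlonglongrightarrow> 0"
    using gradient_coordinate_approx(5)[OF D' h v] unfolding X'_def by blast
  define P where "P n w = inner (G n w \<cdot> h) v" for n w
  define P' where "P' n w = inner (G' n w \<cdot> h) v" for n w
  have span: "P n \<in> cyl_span" "P' n \<in> cyl_span" for n
    unfolding P_def[abs_def] P'_def[abs_def] by (intro cylindrical_coordinates[OF G] cylindrical_coordinates[OF G'])+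
  note P = cyl_span_L2[OF span(1)] and P' = cyl_span_L2[OF span(2)]
  have X: "X \<in> borel_measurable \<mu>" "msq \<mu> X < \<infinity>"
    using gradient_coordinate_approx(1,2)[OF D h v] unfolding X_def[abs_def] by auto
  have X': "X' \<in> borel_measurable \<mu>" "msq \<mu> X' < \<infinity>"
    using gradient_coordinate_approx(1,2)[OF D' h v] unfolding X'_def[abs_def] by auto
  note [measurable] = X(1) X'(1) P(1) P'(1)
  define Z where "Z w = X w - X' w" for w
  have Z [measurable]: "Z \<in> borel_measurable \<mu>" and Z2: "msq \<mu> Z < \<infinity>"
    unfolding Z_def[abs_def] by (measurable, rule nn_sq_diff_finite[OF X(1) X'(1) X(2) X'(2)])
  have orth: "(\<integral>w. \<phi> w * Z w \<partial>\<mu>) = 0" if \<phi>: "\<phi> \<in> cyl_span" for \<phi>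
  proof -
    obtain c f and K :: "(nat \<times> nat) set" and lam :: "nat \<Rightarrow> 'w \<Rightarrow>\<^sub>L real"
      where eq: "\<phi> = (\<lambda>w. \<Sum>k\<in>K. c k * f k (evals lam w))"
      and f: "\<forall>k\<in>K. \<exists>n. smooth_bounded n (f k)"
      using \<phi> unfolding cyl_span_def by blast
    define F where "F k w = f k (evals lam w)" for k w
    have *: "integrable \<mu> (\<lambda>w. F k w * Z w)" "(\<integral>w. F k w * Z w \<partial>\<mu>) = 0" if k: "k \<in> K" for k
    proof -
      obtain n where n: "smooth_bounded n (f k)" using f k by blast
      note F = cylindrical_L2(1,2)[OF n, of lam, folded F_def]
      show "integrable \<mu> (\<lambda>w. F k w * Z w)" by (intro integrable_L2_mult F Z Z2)
      have "(\<integral>w. X w * F k w \<partial>\<mu>) = (\<integral>w. X' w * F k w \<partial>\<mu>)"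
        unfolding X_def X'_def F_def h_def
        using malliavin_gradient_weak[OF D l n v, of lam] malliavin_gradient_weak[OF D' l n v, of lam] by simp
      moreover have "integrable \<mu> (\<lambda>w. X w * F k w)" "integrable \<mu> (\<lambda>w. X' w * F k w)"
        by (intro integrable_L2_mult F X X')+
      ultimately have "(\<integral>w. X w * F k w - X' w * F k w \<partial>\<mu>) = 0" by simp
      then show "(\<integral>w. F k w * Z w \<partial>\<mu>) = 0" by (simp add: Z_def algebra_simps)
    qed
    have "(\<integral>w. \<phi> w * Z w \<partial>\<mu>) = (\<integral>w. (\<Sum>k\<in>K. c k * (F k w * Z w)) \<partial>\<mu>)"
      by (simp add: eq F_def sum_distrib_right mult.assoc)
    also have "\<dots> = (\<Sum>k\<in>K. c k * (\<integral>w. F k w * Z w \<partial>\<mu>))"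
      by (subst Bochner_Integration.integral_sum) (auto intro!: integrable_mult_right *)
    finally show ?thesis using * by simp
  qed
  define R where "R n w = P n w - P' n w" for n w
  have R [measurable]: "R n \<in> borel_measurable \<mu>" and R2: "msq \<mu> (R n) < \<infinity>" for n
    unfolding R_def[abs_def] by (measurable, rule nn_sq_diff_finite[OF P(1) P'(1) P(2) P'(2)])
  have ZR: "(\<integral>w. R n w * Z w \<partial>\<mu>) = 0" for n
  proof -
    have "(\<integral>w. P n w * Z w - P' n w * Z w \<partial>\<mu>) = 0"
      using orth[OF span(1)] orth[OF span(2)]
      by (subst Bochner_Integration.integral_diff) (auto intro!: integrable_L2_mult P P' Z Z2)
    then show ?thesis by (simp add: R_def algebra_simps)
  qed
  \<comment> \<open>\<open>Z\<close> is orthogonal to \<open>R n\<close>, so by Pythagoras it is no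
    larger than \<open>Z - R n\<close>; this difference is the sum of the two approximation errors,
    and both tend to zero.\<close>
  have "msq \<mu> Z \<le> 2 * msq \<mu> (\<lambda>w. P n w - X w)
      + 2 * msq \<mu> (\<lambda>w. P' n w - X' w)" for n
  proof -
    have i: "integrable \<mu> (\<lambda>w. Z w * Z w)" "integrable \<mu> (\<lambda>w. R n w * Z w)" "integrable \<mu> (\<lambda>w. R n w * R n w)"
      by (intro integrable_L2_mult Z Z2 R R2)+
    have e: "(Z w - R n w)\<^sup>2 = Z w * Z w - 2 * (R n w * Z w) + R n w * R n w" for w
      by (simp add: power2_eq_square algebra_simps)
    have iZR: "integrable \<mu> (\<lambda>w. (Z w - R n w)\<^sup>2)" unfolding e using i by auto
    have "(\<integral>w. (Z w - R n w)\<^sup>2 \<partial>\<mu>) = (\<integral>w. Z w * Z w \<partial>\<mu>) + (\<integral>w. R n w * R n w \<partial>\<mu>)"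
      unfolding e using i ZR[of n] by simp
    moreover have "0 \<le> (\<integral>w. R n w * R n w \<partial>\<mu>)" by (rule Bochner_Integration.integral_nonneg) simp
    ultimately have "(\<integral>w. (Z w)\<^sup>2 \<partial>\<mu>) \<le> (\<integral>w. (Z w - R n w)\<^sup>2 \<partial>\<mu>)" by (simp add: power2_eq_square)
    moreover have "msq \<mu> Z = ennreal (\<integral>w. (Z w)\<^sup>2 \<partial>\<mu>)"
      using i by (intro nn_integral_eq_integral) (auto simp: power2_eq_square)
    moreover have "msq \<mu> (\<lambda>w. Z w - R n w) = ennreal (\<integral>w. (Z w - R n w)\<^sup>2 \<partial>\<mu>)"
      using iZR by (intro nn_integral_eq_integral) auto
    ultimately have "msq \<mu> Z \<le> msq \<mu> (\<lambda>w. Z w - R n w)"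
      by (simp add: ennreal_leI)
    also have "\<dots> = msq \<mu> (\<lambda>w. - (P n w - X w) + (P' n w - X' w))"
      by (simp add: Z_def R_def algebra_simps)
    also have "\<dots> \<le> 2 * msq \<mu> (\<lambda>w. - (P n w - X w))
      + 2 * msq \<mu> (\<lambda>w. P' n w - X' w)"
      by (rule nn_sq_add) auto
    also have "(\<lambda>w. (- (P n w - X w))\<^sup>2) = (\<lambda>w. (P n w - X w)\<^sup>2)" by (simp only: power2_minus)
    finally show ?thesis .
  qed
  moreover have "(\<lambda>n. 2 * msq \<mu> (\<lambda>w. P n w - X w)
      + 2 * msq \<mu> (\<lambda>w. P' n w - X' w)) \<longlonglongrightarrow> 2 * 0 + 2 * 0"
    using Glim Glim' unfolding P_def P'_def by (intro tendsto_add ennreal_tendsto_cmult) auto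
  ultimately have "msq \<mu> Z \<le> 2 * 0 + 2 * 0" by (intro LIMSEQ_le_const) auto
  then have "AE w in \<mu>. Z w = 0" by (simp add: nn_integral_0_iff_AE)
  then show ?thesis by (simp add: Z_def X_def X'_def)
qed

text \<open>Integration by parts covers only directions coming from continuous functionals. Each
  basis vector is approximated by a sequence of such directions, so countably many null sets are
  merged, and a bounded operator is determined on the basis.\<close>

theorem malliavin_gradient_unique:
  assumes D: "is_malliavin_gradient \<mu> j u D" and D': "is_malliavin_gradient \<mu> j u D'"
    and dual_dense: "\<And>h. \<exists>l. (\<lambda>n. dual_embedding j (l n)) \<longlonglongrightarrow> h"
  shows "AE w in \<mu>. D w = D' w"
proof -
  have one: "AE w in \<mu>. D w \<cdot> dual_embedding j l = D' w \<cdot> dual_embedding j l" for l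
  proof (cases "dual_embedding j l = 0")
    case False
    define s where "s = norm (dual_embedding j l)"
    have s: "s > 0" using False by (simp add: s_def)
    define l' where "l' = (1 / s) *\<^sub>R l"
    have l': "norm (dual_embedding j l') = 1" using s by (simp add: l'_def dual_embedding_scale) (simp add: s_def)
    have "AE w in \<mu>. \<forall>k. inner (D w \<cdot> dual_embedding j l') (b k)
        = inner (D' w \<cdot> dual_embedding j l') (b k)"
      unfolding AE_all_countable
      by (intro allI malliavin_gradient_unique_coordinate[OF D D' l']) simp
    then show ?thesis
    proof eventually_elim
      case (elim w)
      then have "D w \<cdot> dual_embedding j l' = D' w \<cdot> dual_embedding j l'"
        by (intro coord_eqI) blast
      then show ?case using s by (simp add: l'_def dual_embedding_scale blinfun.scaleR_right)
    qed
  qed simp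
  have "\<forall>m. \<exists>l. (\<lambda>n. dual_embedding j (l n)) \<longlonglongrightarrow> b m" using dual_dense by blast
  from choice[OF this] obtain l where l: "\<And>m. (\<lambda>n. dual_embedding j (l m n)) \<longlonglongrightarrow> b m" by blast
  have "AE w in \<mu>. \<forall>m n. D w \<cdot> (dual_embedding j (l m n)) = D' w \<cdot> (dual_embedding j (l m n))"
    unfolding AE_all_countable using one by blast
  then show ?thesis
  proof eventually_elim
    case (elim w)
    have b: "D w \<cdot> b m = D' w \<cdot> b m" for m
    proof (rule LIMSEQ_unique)
      show "(\<lambda>n. D w \<cdot> (dual_embedding j (l m n))) \<longlonglongrightarrow> D w \<cdot> b m"
        by (intro tendsto_intros l)
      show "(\<lambda>n. D w \<cdot> (dual_embedding j (l m n))) \<longlonglongrightarrow> D' w \<cdot> b m"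
        unfolding elim[rule_format] by (intro tendsto_intros l)
    qed
    show ?case
    proof (rule blinfun_eqI)
      fix x
      have "(\<lambda>k. inner x (b k) *\<^sub>R A \<cdot> b k) sums A \<cdot> x" for A :: "'h \<Rightarrow>\<^sub>L 'h"
        using bounded_linear.sums[OF blinfun.bounded_linear_right expansion[of x], of A]
        by (simp add: blinfun.scaleR_right)
      from this[of "D w"] this[of "D' w"] show "D w \<cdot> x = D' w \<cdot> x"
        using b sums_unique2 by fastforce
    qed
  qed
qed

end

section \<open>The weighted shift\<close>

context hilbert_basis
begin

text \<open>The two offsets serve shifts in both directions: \<open>m = 0\<close> for powers of the
  backward shift, \<open>n = 0\<close> for the remainder of a forward orbit.\<close>

lemma norm_le_of_coords:
  assumes K: "0 \<le> K" and "\<And>k. k < m \<Longrightarrow> inner x (b k) = 0"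
    and le: "\<And>k. \<bar>inner x (b (k + m))\<bar> \<le> K * \<bar>inner y (b (k + n))\<bar>"
  shows "norm x \<le> K * norm y"
proof -
  have "(\<Sum>k<N. (inner x (b k))\<^sup>2) \<le> (K * norm y)\<^sup>2" for N
  proof -
    have "(\<Sum>k<N. (inner x (b k))\<^sup>2) \<le> (\<Sum>k<m + N. (inner x (b k))\<^sup>2)"
      by (intro sum_mono2) auto
    also have "\<dots> = (\<Sum>k<m. (inner x (b k))\<^sup>2) + (\<Sum>k<N. (inner x (b (k + m)))\<^sup>2)"
      by (induction N) (simp_all add: add.commute)
    also have "(\<Sum>k<m. (inner x (b k))\<^sup>2) = 0" using assms(2) by simp
    also have "(\<Sum>k<N. (inner x (b (k + m)))\<^sup>2) \<le> (\<Sum>k<N. K\<^sup>2 * (inner y (b (k + n)))\<^sup>2)"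
    proof (intro sum_mono)
      fix k
      show "(inner x (b (k + m)))\<^sup>2 \<le> K\<^sup>2 * (inner y (b (k + n)))\<^sup>2"
        using power_mono[OF le[of k], of 2] by (simp add: power_mult_distrib)
    qed
    also have "\<dots> \<le> K\<^sup>2 * (norm y)\<^sup>2"
      unfolding sum_distrib_left[symmetric]
      by (intro mult_left_mono bessel_finite) (auto simp: orthonormal)
    finally show ?thesis by (simp add: power_mult_distrib)
  qed
  then have "(norm x)\<^sup>2 \<le> (K * norm y)\<^sup>2"
    using parseval_sums[of x] unfolding sums_def by (intro LIMSEQ_le_const2) auto
  then show ?thesis using K by (simp add: abs_le_square_iff[symmetric] abs_mult)
qed

end

section \<open>Complex scalars on pairs, Neumann series and a criterion for quasinilpotence\<close>

definition cmul :: "complex \<Rightarrow> 'h \<times> 'h \<Rightarrow> 'h \<times> 'h::real_normed_vector" where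
  "cmul z p = (Re z *\<^sub>R fst p - Im z *\<^sub>R snd p, Re z *\<^sub>R snd p + Im z *\<^sub>R fst p)"

lemma cmul_cmul: "cmul z (cmul w p) = cmul (z * w) p"
  by (simp add: cmul_def algebra_simps)

lemma cmul_1 [simp]: "cmul 1 p = p"
  by (simp add: cmul_def)

lemma bounded_linear_cmul: "bounded_linear (cmul z)"
  unfolding cmul_def[abs_def]
  by (intro bounded_linear_Pair bounded_linear_add bounded_linear_sub bounded_linear_const_scaleR
      bounded_linear_fst bounded_linear_snd)

lemma norm_fst_le': "norm (fst p) \<le> norm p" and norm_snd_le': "norm (snd p) \<le> norm p"
  using norm_fst_le[of "fst p" "snd p"] norm_snd_le[of "snd p" "fst p"] by simp_all

lemma norm_cmul_le: "norm (cmul z p) \<le> 4 * norm z * norm p"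
proof -
  have "norm (cmul z p) \<le> norm (fst (cmul z p)) + norm (snd (cmul z p))"
    using norm_Pair_le[of "fst (cmul z p)" "snd (cmul z p)"] by simp
  also have "\<dots> \<le> (\<bar>Re z\<bar> * norm (fst p) + \<bar>Im z\<bar> * norm (snd p)) + (\<bar>Re z\<bar> * norm (snd p) + \<bar>Im z\<bar> * norm (fst p))"
    unfolding cmul_def fst_conv snd_conv
    by (intro add_mono order_trans[OF norm_triangle_ineq4] order_trans[OF norm_triangle_ineq]) auto
  also have "\<dots> \<le> (norm z * norm p + norm z * norm p) + (norm z * norm p + norm z * norm p)"
    by (intro add_mono mult_mono abs_Re_le_cmod abs_Im_le_cmod) (auto simp: norm_fst_le' norm_snd_le')
  finally show ?thesis by simp
qed

text \<open>\<open>F n\<close> is the \<open>n\<close>-th power of \<open>E\<close>, and the witness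
  is the sum of all powers. The two equations say that it inverts \<open>id_blinfun - E\<close> on
  both sides.\<close>

lemma neumann_series:
  fixes E :: "'a::banach \<Rightarrow>\<^sub>L 'a"
  assumes F: "F 0 = id_blinfun" "\<And>n. F (Suc n) = E o\<^sub>L F n" and s: "summable (\<lambda>n. norm (F n))"
  shows "\<exists>N. N o\<^sub>L E = N - id_blinfun \<and> E o\<^sub>L N = N - id_blinfun"
proof (intro exI conjI)
  have sF: "summable F" using s by (rule summable_norm_cancel)
  have tail: "(\<Sum>n. F (Suc n)) = suminf F - id_blinfun" using suminf_split_head[OF sF] F(1) by simp
  have "F n \<cdot> (E \<cdot> p) = (F (Suc n)) \<cdot> p" for n p
    by (induction n) (simp_all add: F)
  then have F': "F n o\<^sub>L E = F (Suc n)" for n by (intro blinfun_eqI) simp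
  show "suminf F o\<^sub>L E = suminf F - id_blinfun"
    unfolding tail[symmetric] F'[symmetric]
    by (rule bounded_linear.suminf[OF bounded_bilinear.bounded_linear_left[OF bounded_bilinear_blinfun_compose] sF])
  show "E o\<^sub>L suminf F = suminf F - id_blinfun"
    unfolding tail[symmetric] F(2)
    by (rule bounded_linear.suminf[OF bounded_bilinear.bounded_linear_right[OF bounded_bilinear_blinfun_compose] sF])
qed

text \<open>For nonzero \<open>z\<close> the operator A - z is z (A/z - 1), and the powers of A/z
  are dominated by a multiple of \<open>norm w ^ n * p n\<close> with \<open>w = 1 / z\<close>, so
  the Neumann series converges. The kernel vector \<open>x0\<close> puts 0 into the
  spectrum.\<close>

lemma quasinilpotentI:
  fixes T :: "'h::banach \<Rightarrow>\<^sub>L 'h"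
  assumes ker: "T \<cdot> x0 = 0" "x0 \<noteq> 0"
    and p: "\<And>n x. norm ((blinfun_apply T ^^ n) x) \<le> p n * norm x"
    and s: "\<And>R. R > 0 \<Longrightarrow> summable (\<lambda>n. R ^ n * p n)"
  shows "quasinilpotent T"
proof -
  have "0 \<in> op_spectrum T"
  proof (rule ccontr)
    assume "0 \<notin> op_spectrum T"
    then obtain R :: "('h \<times> 'h) \<Rightarrow>\<^sub>L ('h \<times> 'h)" where "\<And>p. R \<cdot> (complexified_minus T 0 p) = p"
      unfolding op_spectrum_def by blast
    from this[of "(x0, 0)"] have "R \<cdot> 0 = (x0, 0)"
      by (simp add: complexified_minus_def ker zero_prod_def)
    then have "(x0, 0 :: 'h) = 0" by simp
    then show False using ker by (simp add: prod_eq_iff)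
  qed
  moreover have "z \<notin> op_spectrum T" if z: "z \<noteq> 0" for z
  proof -
    define w where "w = 1 / z"
    have zw: "z * w = 1" "w * z = 1" using z by (simp_all add: w_def)
    define M :: "('h \<times> 'h) \<Rightarrow>\<^sub>L ('h \<times> 'h)" where "M = Blinfun (cmul w)"
    have M: "M \<cdot> p = cmul w p" for p
      unfolding M_def by (simp add: bounded_linear_Blinfun_apply bounded_linear_cmul)
    define Tc where "Tc p = (T \<cdot> fst p, T \<cdot> snd p)" for p
    have "bounded_linear (\<lambda>p. cmul w (Tc p))"
      unfolding Tc_def
      by (intro bounded_linear_compose[OF bounded_linear_cmul] bounded_linear_Pair
          bounded_linear_compose[OF blinfun.bounded_linear_right] bounded_linear_fst bounded_linear_snd)
    then obtain E where E: "\<And>p. E \<cdot> p = cmul w (Tc p)"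
      using bounded_linear_Blinfun_apply by metis
    define F where "F n = ((\<lambda>A. E o\<^sub>L A) ^^ n) id_blinfun" for n
    have F: "F 0 = id_blinfun" "\<And>n. F (Suc n) = E o\<^sub>L F n" by (simp_all add: F_def)
    have Fn: "F n \<cdot> p = cmul (w ^ n) ((blinfun_apply T ^^ n) (fst p), (blinfun_apply T ^^ n) (snd p))" for n p
    proof (induction n)
      case (Suc n)
      have "Tc (cmul a q) = cmul a (Tc q)" for a q
        by (simp add: Tc_def cmul_def blinfun.diff_right blinfun.add_right blinfun.scaleR_right)
      then show ?case by (simp add: F Suc E cmul_cmul) (simp add: Tc_def)
    qed (simp add: F)
    \<comment> \<open>8 is the product of the 4 in \<open>norm_cmul_le\<close> and the 2 from
      bounding a pair by the sum of its components.\<close>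
    have le: "norm (F n) \<le> 8 * (norm w ^ n * p n)" for n
    proof (rule norm_blinfun_bound)
      have "0 \<le> p n * norm x0" using norm_ge_zero p by (rule order_trans)
      then have pn: "0 \<le> p n" using ker by (simp add: zero_le_mult_iff)
      then show "0 \<le> 8 * (norm w ^ n * p n)" by simp
      fix q
      let ?q = "((blinfun_apply T ^^ n) (fst q), (blinfun_apply T ^^ n) (snd q))"
      have "norm ?q \<le> norm (fst ?q) + norm (snd ?q)" using norm_Pair_le[of "fst ?q" "snd ?q"] by simp
      also have "\<dots> \<le> p n * norm (fst q) + p n * norm (snd q)" using p by (simp add: add_mono)
      also have "\<dots> \<le> p n * norm q + p n * norm q"
        by (intro add_mono mult_left_mono pn) (auto simp: norm_fst_le' norm_snd_le')
      finally have "4 * norm (w ^ n) * norm ?q \<le> 4 * norm (w ^ n) * (p n * norm q + p n * norm q)"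
        by (rule mult_left_mono) simp
      with norm_cmul_le[of "w ^ n" ?q]
      show "norm (F n \<cdot> q) \<le> 8 * (norm w ^ n * p n) * norm q"
        unfolding Fn by (simp add: norm_power mult_ac)
    qed
    have "summable (\<lambda>n. 8 * (norm w ^ n * p n))"
      using z by (intro summable_mult s) (simp add: w_def)
    then have "summable (\<lambda>n. norm (F n))"
      by (rule summable_comparison_test'[of _ 0]) (use le in simp)
    from neumann_series[of F E, OF F this] obtain N
      where "N o\<^sub>L E = N - id_blinfun \<and> E o\<^sub>L N = N - id_blinfun" ..
    then have N: "N o\<^sub>L E = N - id_blinfun" "E o\<^sub>L N = N - id_blinfun" by auto
    have NE: "N \<cdot> (E \<cdot> p) = N \<cdot> p - p"
      "E \<cdot> (N \<cdot> p) = N \<cdot> p - p" for p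
      using arg_cong[OF N(1), of "\<lambda>A. A \<cdot> p"] arg_cong[OF N(2), of "\<lambda>A. A \<cdot> p"]
      by (simp_all add: blinfun.diff_left)
    have cm: "complexified_minus T z q = cmul z (E \<cdot> q - q)" for q
    proof -
      interpret bounded_linear "cmul z" by (rule bounded_linear_cmul)
      have "cmul z (E \<cdot> q - q) = Tc q - cmul z q" by (simp add: diff E cmul_cmul zw)
      then show ?thesis by (cases q) (simp add: complexified_minus_def Tc_def cmul_def)
    qed
    \<comment> \<open>\<open>- N\<close> inverts \<open>E - id_blinfun\<close> and \<open>M\<close>
      inverts multiplication by \<open>z\<close>; \<open>cm\<close> factors the operator in this
      way.\<close>
    define R where "R = - (N o\<^sub>L M)"
    have "R \<cdot> (complexified_minus T z q) = q" for q
      by (simp add: R_def blinfun.minus_left M cm cmul_cmul zw blinfun.diff_right NE)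
    moreover have "complexified_minus T z (R \<cdot> q) = q" for q
      by (simp add: R_def blinfun.minus_left blinfun.minus_right cm M NE cmul_cmul zw)
    ultimately show ?thesis unfolding op_spectrum_def by blast
  qed
  ultimately show ?thesis unfolding quasinilpotent_def by blast
qed

section \<open>The weighted backward and forward shifts\<close>

locale geometric_shift = hilbert_basis b
  for b :: "nat \<Rightarrow> 'h::{real_inner,banach,second_countable_topology}" +
  fixes r :: real
  assumes r: "0 < r" "r < 1"
begin

text \<open>This is the operator T of the overview for a basis counted from 0, which explains the
  exponent \<open>Suc k\<close>; \<open>forward\<close> is its adjoint.\<close>

definition backward :: "'h \<Rightarrow> 'h" where
  "backward x = (\<Sum>k. (r ^ Suc k * inner x (b (Suc k))) *\<^sub>R b k)"

definition forward :: "'h \<Rightarrow> 'h" where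
  "forward x = (\<Sum>k. (case k of 0 \<Rightarrow> 0 | Suc i \<Rightarrow> r ^ Suc i * inner x (b i)) *\<^sub>R b k)"

text \<open>Equals \<open>r ^ (n * (n + 1) div 2)\<close>, the norm of the \<open>n\<close>-th power
  of \<open>backward\<close>, attained at \<open>b n\<close>.\<close>

definition weight_prod :: "nat \<Rightarrow> real" where
  "weight_prod n = (\<Prod>m<n. r ^ Suc m)"

lemma weight_prod_pos: "0 < weight_prod n"
  using r by (simp add: weight_prod_def prod_pos)

lemma weight_le_1: "r ^ n \<le> 1" "0 \<le> r ^ n" "0 < r ^ n"
  using r by (simp_all add: power_le_one)

lemma weighted_square_le: "(r ^ n * x)\<^sup>2 \<le> x\<^sup>2"
proof -
  have "(r ^ n)\<^sup>2 \<le> 1" using weight_le_1[of n] by (simp add: power_le_one)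
  then show ?thesis by (simp add: power_mult_distrib mult_left_le_one_le)
qed

lemma backward_coord: "inner (backward x) (b i) = r ^ Suc i * inner x (b (Suc i))"
  unfolding backward_def
proof (rule riesz_sum(2))
  fix n
  have "(\<Sum>k<n. (r ^ Suc k * inner x (b (Suc k)))\<^sup>2) \<le> (\<Sum>k<n. (inner x (b (Suc k)))\<^sup>2)"
    by (intro sum_mono weighted_square_le)
  also have "\<dots> \<le> (norm x)\<^sup>2" by (rule bessel_finite) (auto simp: orthonormal)
  finally show "(\<Sum>k<n. (r ^ Suc k * inner x (b (Suc k)))\<^sup>2) \<le> (norm x)\<^sup>2" .
qed

lemma forward_coord_sum_le:
  "(\<Sum>k<n. (case k of 0 \<Rightarrow> 0 | Suc i \<Rightarrow> r ^ Suc i * inner x (b i))\<^sup>2) \<le> (norm x)\<^sup>2"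
proof -
  have "(\<Sum>k<n. (case k of 0 \<Rightarrow> 0 | Suc i \<Rightarrow> r ^ Suc i * inner x (b i))\<^sup>2)
      \<le> (\<Sum>k<Suc n. (case k of 0 \<Rightarrow> 0 | Suc i \<Rightarrow> r ^ Suc i * inner x (b i))\<^sup>2)" by simp
  also have "\<dots> = (\<Sum>k<n. (r ^ Suc k * inner x (b k))\<^sup>2)" by (subst sum.lessThan_Suc_shift) simp
  also have "\<dots> \<le> (\<Sum>k<n. (inner x (b k))\<^sup>2)" by (intro sum_mono weighted_square_le)
  also have "\<dots> \<le> (norm x)\<^sup>2" by (rule bessel_lessThan)
  finally show ?thesis .
qed

lemma forward_coord: "inner (forward x) (b 0) = 0" "inner (forward x) (b (Suc i)) = r ^ Suc i * inner x (b i)"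
  unfolding forward_def riesz_sum(2)[OF forward_coord_sum_le] by simp_all

lemma forward_sums: "(\<lambda>k. (r ^ Suc k * inner x (b k)) *\<^sub>R b (Suc k)) sums forward x"
proof -
  have "(\<lambda>k. (case k of 0 \<Rightarrow> 0 | Suc i \<Rightarrow> r ^ Suc i * inner x (b i)) *\<^sub>R b k) sums forward x"
    unfolding forward_def by (intro summable_sums riesz_sum(1)[OF forward_coord_sum_le])
  then show ?thesis
    using sums_Suc_iff[of "\<lambda>k. (case k of 0 \<Rightarrow> 0 | Suc i \<Rightarrow> r ^ Suc i * inner x (b i)) *\<^sub>R b k" "forward x"]
    by simp
qed

text \<open>The product of the weights with exponents from i + 1 to i + k splits into
  \<open>r ^ (i * k)\<close> and a factor independent of the coordinate. The first factor carries
  all comparisons between coordinates, the second the superexponential decay.\<close>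

lemma backward_pow_coord: "inner ((backward ^^ k) x) (b i) = r ^ (i * k) * weight_prod k * inner x (b (i + k))"
proof (induction k arbitrary: i)
  case (Suc k)
  have "inner ((backward ^^ Suc k) x) (b i) = r ^ Suc i * (r ^ (Suc i * k) * weight_prod k * inner x (b (Suc i + k)))"
    by (simp add: backward_coord Suc)
  also have "r ^ Suc i * (r ^ (Suc i * k) * weight_prod k * inner x (b (Suc i + k)))
    = r ^ (i * Suc k) * weight_prod (Suc k) * inner x (b (i + Suc k))"
    by (simp add: weight_prod_def power_add algebra_simps)
  finally show ?case .
qed (simp add: weight_prod_def)

lemma forward_pow_coord: "inner ((forward ^^ k) x) (b (i + k)) = r ^ (i * k) * weight_prod k * inner x (b i)"
proof (induction k)
  case (Suc k)
  have "inner ((forward ^^ Suc k) x) (b (i + Suc k)) = r ^ Suc (i + k) * (r ^ (i * k) * weight_prod k * inner x (b i))"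
    by (simp add: forward_coord Suc)
  also have "\<dots> = r ^ (i * Suc k) * weight_prod (Suc k) * inner x (b i)"
    by (simp add: weight_prod_def power_add algebra_simps)
  finally show ?case .
qed (simp add: weight_prod_def)

lemma forward_pow_coord_less: "i < k \<Longrightarrow> inner ((forward ^^ k) x) (b i) = 0"
proof (induction k arbitrary: i)
  case (Suc k)
  then show ?case by (cases i) (simp_all add: forward_coord)
qed simp

lemma norm_backward_pow_le: "norm ((backward ^^ n) x) \<le> weight_prod n * norm x"
proof (rule norm_le_of_coords[where m=0 and n=n])
  fix k
  have "r ^ (k * n) * (weight_prod n * \<bar>inner x (b (k + n))\<bar>) \<le> 1 * (weight_prod n * \<bar>inner x (b (k + n))\<bar>)"
    using weight_le_1 weight_prod_pos[of n] by (intro mult_right_mono) auto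
  then show "\<bar>inner ((backward ^^ n) x) (b (k + 0))\<bar> \<le> weight_prod n * \<bar>inner x (b (k + n))\<bar>"
    using weight_le_1 weight_prod_pos[of n] by (simp add: backward_pow_coord abs_mult mult.assoc)
qed (use weight_prod_pos[of n] in auto)

lemma bounded_linear_backward: "bounded_linear backward"
proof (rule bounded_linear_intro)
  show "backward (x + y) = backward x + backward y" for x y
    by (rule coord_eqI) (simp add: backward_coord inner_add_left distrib_left)
  show "backward (s *\<^sub>R x) = s *\<^sub>R backward x" for s x
    by (rule coord_eqI) (simp add: backward_coord)
  show "norm (backward x) \<le> norm x * weight_prod 1" for x
    using norm_backward_pow_le[of 1 x] by (simp add: mult.commute)
qed

lemma quasinilpotent_backward: "quasinilpotent (Blinfun backward)"
proof (rule quasinilpotentI)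
  have a: "blinfun_apply (Blinfun backward) = backward"
    by (simp add: bounded_linear_Blinfun_apply bounded_linear_backward)
  show "Blinfun backward \<cdot> b 0 = 0"
    unfolding a by (rule coord_eqI) (simp add: backward_coord orthonormal)
  show "b 0 \<noteq> 0" using norm_b[of 0] by force
  show "norm ((blinfun_apply (Blinfun backward) ^^ n) x) \<le> weight_prod n * norm x" for n x
    unfolding a by (rule norm_backward_pow_le)
  fix R :: real assume R: "R > 0"
  have "(\<lambda>n. R * r ^ Suc n) \<longlonglongrightarrow> R * 0"
    by (intro tendsto_intros LIMSEQ_Suc LIMSEQ_power_zero) (use r in auto)
  then have "\<forall>\<^sub>F n in sequentially. R * r ^ Suc n < 1 / 2" by (rule order_tendstoD) simp
  then obtain N where N: "\<And>n. n \<ge> N \<Longrightarrow> R * r ^ Suc n < 1 / 2" by (auto simp: eventually_sequentially)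
  show "summable (\<lambda>n. R ^ n * weight_prod n)"
  \<comment> \<open>Consecutive terms have ratio \<open>R * r ^ Suc n\<close>, which is below 1/2
    from \<open>N\<close> on.\<close>
  proof (rule summable_ratio_test[of "1/2" N])
    fix n assume "n \<ge> N"
    have "norm (R ^ Suc n * weight_prod (Suc n)) = (R * r ^ Suc n) * (R ^ n * weight_prod n)"
      using R r weight_prod_pos[of n] by (simp add: weight_prod_def abs_mult)
    also have "\<dots> \<le> 1 / 2 * (R ^ n * weight_prod n)"
      using N[OF \<open>n \<ge> N\<close>] R weight_prod_pos[of n] by (intro mult_right_mono) auto
    finally show "norm (R ^ Suc n * weight_prod (Suc n)) \<le> 1 / 2 * norm (R ^ n * weight_prod n)"
      using R weight_prod_pos[of n] by simp
  qed simp
qed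

section \<open>Invariant subspaces of the forward shift\<close>

definition tail :: "nat \<Rightarrow> 'h \<Rightarrow> 'h" where
  "tail m y = y - (\<Sum>k<m. inner y (b k) *\<^sub>R b k)"

lemma tail_coord: "inner (tail m y) (b k) = (if k < m then 0 else inner y (b k))"
proof -
  have "inner (\<Sum>i<m. inner y (b i) *\<^sub>R b i) (b k) = (\<Sum>i<m. if i = k then inner y (b i) else 0)"
    unfolding inner_sum_left by (intro sum.cong) (auto simp: orthonormal)
  then show ?thesis by (simp add: tail_def inner_diff_left)
qed

lemma norm_tail: "(norm (tail m y))\<^sup>2 = (inner y (b m))\<^sup>2 + (norm (tail (Suc m) y))\<^sup>2"
proof -
  have e: "tail m y = inner y (b m) *\<^sub>R b m + tail (Suc m) y" by (simp add: tail_def)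
  have "inner (b m) (tail (Suc m) y) = 0" using tail_coord[of "Suc m" y m] by (simp add: inner_commute)
  then show ?thesis
    unfolding e power2_norm_eq_inner
    by (simp add: inner_add_left inner_add_right inner_commute orthonormal power2_eq_square)
qed

lemma tail_tendsto: "(\<lambda>m. norm (tail m y)) \<longlonglongrightarrow> 0"
proof -
  have "(\<lambda>m. tail m y) \<longlonglongrightarrow> y - y"
    unfolding tail_def by (intro tendsto_diff tendsto_const expansion[unfolded sums_def])
  then show ?thesis by (simp add: tendsto_norm_zero)
qed

text \<open>
  Donoghue's argument: for \<open>x\<close> with leading coordinate \<open>\<xi>\<close> at \<open>n\<close>, the rescaled orbit of \<open>x\<close> is
  \<open>\<xi> b\<^bsub>n+k\<^esub>\<close> plus an error of size \<open>r\<^sup>k \<parallel>x\<parallel>\<close> in the later coordinates, so the squared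
  tails \<open>a\<^sub>k\<close> of a vector orthogonal to the orbit satisfy \<open>a\<^sub>k \<le> (1 + C r\<^bsup>2k\<^esup>) a\<^bsub>k+1\<^esub>\<close>.
  The product of these factors converges, whereas \<open>a\<^sub>k\<close> tends to zero.
\<close>

lemma orthogonal_to_forward_orbit:
  assumes x: "\<And>i. i < n \<Longrightarrow> inner x (b i) = 0" "inner x (b n) \<noteq> 0"
    and orth: "\<And>k. inner y ((forward ^^ k) x) = 0" and i: "n \<le> i"
  shows "inner y (b i) = 0"
proof -
  define \<xi> where "\<xi> = inner x (b n)"
  define C where "C = (norm x)\<^sup>2 / \<xi>\<^sup>2"
  define a where "a k = (norm (tail (n + k) y))\<^sup>2" for k
  have \<xi>: "\<xi> \<noteq> 0" using x by (simp add: \<xi>_def)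
  have C0: "0 \<le> C" by (simp add: C_def)
  have step: "a k \<le> (1 + C * (r\<^sup>2) ^ k) * a (Suc k)" for k
  proof -
    \<comment> \<open>\<open>p * \<xi>\<close> is the coordinate of the \<open>k\<close>-th orbit
      vector at \<open>n + k\<close>, its first possibly nonzero one; \<open>R\<close> below is what
      remains after removing it.\<close>
    define p where "p = r ^ (n * k) * weight_prod k"
    have p: "p > 0" unfolding p_def using weight_le_1 weight_prod_pos by simp
    define R where "R = (forward ^^ k) x - (p * \<xi>) *\<^sub>R b (n + k)"
    have R0: "inner R (b i) = 0" if "i \<le> n + k" for i
    proof (cases "i < k")
      case False
      define i' where "i' = i - k"
      have i': "i = i' + k" "i' \<le> n" using False that by (simp_all add: i'_def)
      show ?thesis using i'(2) x(1)[of i']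
        by (cases "i' = n") (simp_all add: R_def i'(1) inner_diff_left forward_pow_coord orthonormal p_def \<xi>_def)
    qed (simp add: R_def inner_diff_left forward_pow_coord_less orthonormal)
    have nR: "norm R \<le> (p * r ^ k) * norm x"
    proof (rule norm_le_of_coords[where m=k and n=0])
      show "0 \<le> p * r ^ k" using p weight_le_1 by simp
      show "inner R (b i) = 0" if "i < k" for i using that by (intro R0) simp
      fix i
      show "\<bar>inner R (b (i + k))\<bar> \<le> p * r ^ k * \<bar>inner x (b (i + 0))\<bar>"
      proof (cases "i \<le> n")
        case True
        then show ?thesis using R0[of "i + k"] p weight_le_1 by simp
      next
        case False
        then have "inner R (b (i + k)) = r ^ (i * k) * weight_prod k * inner x (b i)"
          by (simp add: R_def inner_diff_left forward_pow_coord orthonormal)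
        \<comment> \<open>A coordinate beyond \<open>n\<close> starts at index at least n + 1, so
          its weight is smaller than the leading one by a further factor
          \<open>r ^ k\<close>.\<close>
        moreover have "r ^ (i * k) \<le> r ^ (n * k + k)"
          using False r mult_le_mono1[of "Suc n" i k] by (intro power_decreasing) (auto simp: add.commute)
        then have "r ^ (i * k) * weight_prod k \<le> p * r ^ k"
          using weight_prod_pos[of k] by (simp add: p_def power_add mult_ac)
        ultimately show ?thesis
          using weight_le_1 weight_prod_pos[of k] by (simp add: abs_mult mult_right_mono)
      qed
    qed
    \<comment> \<open>\<open>R\<close> has no coordinates up to \<open>n + k\<close>, so only the
      tail of \<open>y\<close> beyond that index meets it.\<close>
    have "inner (\<Sum>i<Suc (n + k). inner y (b i) *\<^sub>R b i) R = 0"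
      unfolding inner_sum_left using R0 by (intro sum.neutral) (simp add: inner_commute[of _ R])
    then have "inner (tail (Suc (n + k)) y) R = inner y R"
      by (simp only: tail_def inner_diff_left diff_zero)
    moreover have "0 = p * \<xi> * inner y (b (n + k)) + inner y R"
      using orth[of k] by (simp add: R_def inner_diff_right)
    ultimately have "p * \<bar>\<xi> * inner y (b (n + k))\<bar> = \<bar>inner (tail (Suc (n + k)) y) R\<bar>"
      using p by (simp add: abs_mult) (metis abs_minus_cancel abs_mult abs_of_pos add.inverse_unique mult.assoc)
    also have "\<dots> \<le> norm (tail (Suc (n + k)) y) * norm R" by (rule Cauchy_Schwarz_ineq2)
    also have "\<dots> \<le> norm (tail (Suc (n + k)) y) * (p * r ^ k * norm x)" using nR by (rule mult_left_mono) simp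
    finally have "p * \<bar>\<xi> * inner y (b (n + k))\<bar> \<le> p * (r ^ k * norm x * norm (tail (Suc (n + k)) y))"
      by (simp add: mult_ac)
    then have "\<bar>\<xi> * inner y (b (n + k))\<bar> \<le> r ^ k * norm x * norm (tail (Suc (n + k)) y)"
      using p by simp
    then have "\<xi>\<^sup>2 * (inner y (b (n + k)))\<^sup>2 \<le> (r ^ k * norm x * norm (tail (Suc (n + k)) y))\<^sup>2"
      using power_mono[of "\<bar>\<xi> * inner y (b (n + k))\<bar>" "r ^ k * norm x * norm (tail (Suc (n + k)) y)" 2]
      by (simp only: power2_abs power_mult_distrib[of \<xi>] abs_ge_zero)
    then have "(inner y (b (n + k)))\<^sup>2 \<le> C * (r\<^sup>2) ^ k * a (Suc k)"
      using \<xi> by (simp add: C_def a_def field_simps power_mult_distrib power_mult[symmetric] mult.commute)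
    then show ?thesis
      using norm_tail[of "n + k" y] by (simp add: a_def distrib_right)
  qed
  have a0: "0 \<le> a k" for k by (simp add: a_def)
  \<comment> \<open>Iterating \<open>step\<close> with 1 + t \<le> exp t turns the product of the
    factors into the exponential of a geometric sum, bounded uniformly in \<open>k\<close>.\<close>
  have "a 0 \<le> exp (C * (\<Sum>m<k. (r\<^sup>2) ^ m)) * a k" for k
  proof (induction k)
    case (Suc k)
    have "1 + C * (r\<^sup>2) ^ k \<le> exp (C * (r\<^sup>2) ^ k)" by (rule exp_ge_add_one_self)
    then have "a k \<le> exp (C * (r\<^sup>2) ^ k) * a (Suc k)"
      using step[of k] a0[of "Suc k"] by (meson mult_right_mono order_trans)
    then have "exp (C * (\<Sum>m<k. (r\<^sup>2) ^ m)) * a k \<le> exp (C * (\<Sum>m<k. (r\<^sup>2) ^ m)) * (exp (C * (r\<^sup>2) ^ k) * a (Suc k))"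
      by (rule mult_left_mono) simp
    from order_trans[OF Suc this] show ?case by (simp add: distrib_left exp_add mult_ac)
  qed simp
  moreover have "(\<Sum>m<k. (r\<^sup>2) ^ m) \<le> 1 / (1 - r\<^sup>2)" for k
  proof -
    have "r\<^sup>2 < 1" using r by (simp add: power_less_one_iff abs_square_less_1)
    then show ?thesis
      using sum_le_suminf[of "\<lambda>m. (r\<^sup>2) ^ m" "{..<k}"] by (simp add: suminf_geometric summable_geometric)
  qed
  ultimately have bound: "a 0 \<le> exp (C * (1 / (1 - r\<^sup>2))) * a k" for k
    using C0 a0 by (meson exp_le_cancel_iff mult_left_mono mult_right_mono order_trans)
  have "(\<lambda>k. exp (C * (1 / (1 - r\<^sup>2))) * a k) \<longlonglongrightarrow> exp (C * (1 / (1 - r\<^sup>2))) * 0\<^sup>2"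
    unfolding a_def using LIMSEQ_ignore_initial_segment[OF tail_tendsto[of y], of n]
    by (intro tendsto_intros) (simp add: add.commute)
  from LIMSEQ_le_const[OF this] bound have "a 0 \<le> exp (C * (1 / (1 - r\<^sup>2))) * 0\<^sup>2" by blast
  then have "tail n y = 0" by (simp add: a_def)
  then show ?thesis using tail_coord[of n y i] i by simp
qed

text \<open>\<open>N \<theta>\<close> is the first index seen by the range at \<theta>. If two
  parameters share it, take \<open>z\<close> in the larger range only and let \<open>y\<close> be
  its component orthogonal to the smaller range. A vector \<open>x\<close> of the smaller range with
  a nonzero coordinate at that index has its orbit there, so \<open>y\<close> has no coordinates
  from the index on; earlier ones vanish by minimality. Thus \<open>y = 0\<close>, a contradiction,
  and \<open>N\<close> would inject an uncountable interval into the naturals. The parameter 0 is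
  left out because its range is zero.\<close>

lemma no_invariant_resolution:
  assumes res: "resolution_of_identity \<pi>" and strict: "resolution_strictly_increasing \<pi>"
    and inv: "\<And>\<theta> h. \<theta> \<in> {0..1} \<Longrightarrow> forward (\<pi> \<theta> \<cdot> h) \<in> range (blinfun_apply (\<pi> \<theta>))"
  shows False
proof -
  define M where "M \<theta> = range (blinfun_apply (\<pi> \<theta>))" for \<theta>
  have proj: "orthogonal_projection (\<pi> \<theta>)" if "\<theta> \<in> {0..1}" for \<theta>
    using res that by (simp add: resolution_of_identity_def)
  have idem: "\<pi> \<theta> \<cdot> (\<pi> \<theta> \<cdot> x) = \<pi> \<theta> \<cdot> x" if "\<theta> \<in> {0..1}" for \<theta> x
    using proj[OF that] unfolding orthogonal_projection_def by (metis blinfun_apply_blinfun_compose)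
  have self: "inner (\<pi> \<theta> \<cdot> x) y = inner x (\<pi> \<theta> \<cdot> y)" if "\<theta> \<in> {0..1}" for \<theta> x y
    using proj[OF that] unfolding orthogonal_projection_def by blast
  have orbit: "(forward ^^ k) x \<in> M \<theta>" if "\<theta> \<in> {0..1}" "x \<in> M \<theta>" for \<theta> x k
    using that inv by (induction k) (auto simp: M_def)
  have less: "M \<theta> \<subset> M \<theta>'" if "\<theta> \<in> {0..1}" "\<theta>' \<in> {0..1}" "\<theta> < \<theta>'" for \<theta> \<theta>'
    using strict that by (simp add: resolution_strictly_increasing_def M_def)
  define N where "N \<theta> = (LEAST n. \<exists>x\<in>M \<theta>. inner x (b n) \<noteq> 0)" for \<theta>
  have ex: "\<exists>n. \<exists>x\<in>M \<theta>. inner x (b n) \<noteq> 0" if "\<theta> \<in> {0<..1}" for \<theta>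
  proof (rule ccontr)
    assume "\<nexists>n. \<exists>x\<in>M \<theta>. inner x (b n) \<noteq> 0"
    then have "M \<theta> \<subseteq> {0}" by (auto intro!: coord_eqI)
    moreover have "0 \<in> M 0" by (auto simp: M_def intro!: image_eqI[of _ _ 0] blinfun.zero_right[symmetric])
    ultimately show False using less[of 0 \<theta>] that by auto
  qed
  have False if th: "\<theta> \<in> {0<..1}" "\<theta>' \<in> {0<..1}" "\<theta> < \<theta>'" "N \<theta> = N \<theta>'" for \<theta> \<theta>'
  proof -
    obtain x where x: "x \<in> M \<theta>" "inner x (b (N \<theta>)) \<noteq> 0"
      using LeastI_ex[OF ex[OF th(1)]] unfolding N_def by blast
    have min: "inner z (b i) = 0" if "z \<in> M \<theta>'" "i < N \<theta>'" for z i
      using not_less_Least that unfolding N_def by blast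
    have sub: "M \<theta> \<subset> M \<theta>'" using th by (intro less) auto
    then obtain z where z: "z \<in> M \<theta>'" "z \<notin> M \<theta>" by blast
    define y where "y = z - \<pi> \<theta> \<cdot> z"
    have Pz: "\<pi> \<theta> \<cdot> z \<in> M \<theta>'" using sub by (auto simp: M_def)
    have "inner y v = 0" if v: "v \<in> M \<theta>" for v
    proof -
      obtain v' where "v = \<pi> \<theta> \<cdot> v'" using v unfolding M_def by blast
      then show ?thesis using idem[of \<theta>] self[of \<theta>] th by (simp add: y_def inner_diff_left)
    qed
    then have orth: "inner y ((forward ^^ k) x) = 0" for k using orbit[of \<theta> x k] x(1) th(1) by simp
    have "x \<in> M \<theta>'" using sub x(1) by auto
    then have x0: "inner x (b i) = 0" if "i < N \<theta>" for i using that th(4) by (intro min) auto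
    have "inner y (b i) = 0" for i
    proof (cases "i < N \<theta>")
      case True
      then show ?thesis using min[OF z(1), of i] min[OF Pz, of i] th(4) by (simp add: y_def inner_diff_left)
    next
      case False
      then show ?thesis using orthogonal_to_forward_orbit[OF x0 x(2) orth] by simp
    qed
    then have "y = 0" by (intro coord_eqI) simp
    then have "z \<in> M \<theta>" by (simp add: y_def M_def)
    with z show False by simp
  qed
  then have "inj_on N {0<..1}" by (intro inj_onI) (metis linorder_neqE)
  then have "countable {0<..1::real}" by (rule countableI)
  then show False using uncountable_half_open_interval_2[of 0 "1::real"] by simp
qed

end

section \<open>The random variable \<open>u\<close>\<close>

text \<open>Sine functions with free amplitude and phase are closed under partial derivatives:
  differentiation in the same coordinate shifts the phase by pi/2, in any other coordinate it makes
  the amplitude 0.\<close>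

lemma foldr_partial_deriv_sin:
  "\<exists>A' C'. foldr partial_deriv is (\<lambda>x. A * sin (s * x k + C)) = (\<lambda>x. A' * sin (s * x k + C'))"
proof (induction "is")
  case (Cons i "is")
  then obtain A' C' where IH: "foldr partial_deriv is (\<lambda>x. A * sin (s * x k + C)) = (\<lambda>x. A' * sin (s * x k + C'))"
    by blast
  show ?case
  proof (cases "i = k")
    case True
    have "((\<lambda>t. A' * sin (s * t + C')) has_real_derivative A' * s * cos (s * x + C')) (at x)" for x
      by (auto intro!: derivative_eq_intros)
    then have "deriv (\<lambda>t. A' * sin (s * t + C')) x = A' * s * cos (s * x + C')" for x
      by (rule DERIV_imp_deriv)
    then have "partial_deriv i (\<lambda>x. A' * sin (s * x k + C')) = (\<lambda>x. (A' * s) * sin (s * x k + (C' + pi / 2)))"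
      by (simp add: partial_deriv_def True cos_sin_eq add.assoc[symmetric] sin_add)
    then show ?thesis unfolding foldr.simps comp_def IH by blast
  next
    case False
    then have "partial_deriv i (\<lambda>x. A' * sin (s * x k + C')) = (\<lambda>x. 0 * sin (s * x k + C'))"
      by (simp add: partial_deriv_def)
    then show ?thesis unfolding foldr.simps comp_def IH by blast
  qed
qed auto

text \<open>A bounded substitute for the coordinate \<open>x k\<close>: for small \<open>s\<close>
  the function is close to \<open>x k\<close> and its partial derivative
  \<open>cos (s * x k)\<close> is close to 1.\<close>

lemma smooth_bounded_sin:
  assumes "k < n"
  shows "smooth_bounded n (\<lambda>x. sin (s * x k) / s)"
proof -
  have e: "(\<lambda>x. sin (s * x k) / s) = (\<lambda>x :: nat \<Rightarrow> real. (1 / s) * sin (s * x k + 0))" by simp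
  show ?thesis
    unfolding smooth_bounded_def
  proof (intro conjI allI impI)
    fix x y :: "nat \<Rightarrow> real" assume "\<forall>i<n. x i = y i"
    then show "sin (s * x k) / s = sin (s * y k) / s" using assms by simp
  next
    fix "is"
    obtain A C where f: "foldr partial_deriv is (\<lambda>x. sin (s * x k) / s) = (\<lambda>x. A * sin (s * x k + C))"
      unfolding e using foldr_partial_deriv_sin by blast
    have "\<bar>A * sin (s * x k + C)\<bar> \<le> \<bar>A\<bar>" for x
      using mult_left_mono[OF abs_sin_le_one, of "\<bar>A\<bar>" "s * x k + C"] by (simp add: abs_mult)
    then show "bounded (range (foldr partial_deriv is (\<lambda>x. sin (s * x k) / s)))"
      unfolding f bounded_iff by auto
    fix i and x :: "nat \<Rightarrow> real"
    show "(\<lambda>t. foldr partial_deriv is (\<lambda>x. sin (s * x k) / s) (x(i := t))) differentiable at (x i)"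
    proof (cases "i = k")
      case True
      have "((\<lambda>t. A * sin (s * t + C)) has_real_derivative A * s * cos (s * x i + C)) (at (x i))"
        by (auto intro!: derivative_eq_intros)
      then show ?thesis unfolding f using True by (auto simp: real_differentiable_def)
    qed (simp add: f)
  qed
qed

lemma partial_deriv_sin:
  assumes "s \<noteq> 0"
  shows "partial_deriv i (\<lambda>x. sin (s * x k) / s) x = (if i = k then cos (s * x k) else 0)"
proof (cases "i = k")
  case True
  have "((\<lambda>t. sin (s * t) / s) has_real_derivative cos (s * y)) (at y)" for y
    using assms by (auto intro!: derivative_eq_intros)
  then have "deriv (\<lambda>t. sin (s * t) / s) y = cos (s * y)" for y by (rule DERIV_imp_deriv)
  then show ?thesis using True by (simp add: partial_deriv_def)
qed (simp add: partial_deriv_def)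

lemma sin_scaled_tendsto: "(\<lambda>n. sin (inverse (real (Suc n)) * x) / inverse (real (Suc n))) \<longlonglongrightarrow> x"
proof -
  have "((\<lambda>t. sin (t * x)) has_real_derivative x) (at 0)"
    by (auto intro!: derivative_eq_intros)
  then have "((\<lambda>h. sin (h * x) / h) \<longlongrightarrow> x) (at 0)" by (simp add: DERIV_def)
  moreover have "filterlim (\<lambda>n. inverse (real (Suc n))) (at 0) sequentially"
    using LIMSEQ_inverse_real_of_nat by (auto simp: filterlim_at)
  ultimately show ?thesis by (rule filterlim_compose)
qed

lemma abs_sin_scaled_le:
  fixes s x :: real
  assumes "s > 0" shows "\<bar>sin (s * x) / s\<bar> \<le> \<bar>x\<bar>"
  using abs_sin_x_le_abs_x[of "s * x"] assms by (simp add: abs_mult field_simps)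

section \<open>Convergence of the series for u and its pairings\<close>

locale wiener_shift = wiener_space b \<mu> j + geometric_shift b r
  for b :: "nat \<Rightarrow> 'h::{real_inner,banach,second_countable_topology}"
    and \<mu> :: "'w::{banach,second_countable_topology} measure" and j :: "'h \<Rightarrow>\<^sub>L 'w" and r :: real +
  fixes \<delta> :: "'h \<Rightarrow> 'w \<Rightarrow> real" and u :: "'w \<Rightarrow> 'h"
  assumes delta: "is_delta \<mu> j h (\<delta> h)"
    and u: "u w = (\<Sum>i. (r ^ Suc i * \<delta> (b (Suc i)) w) *\<^sub>R b i)"
begin

lemma delta_measurable [measurable]: "\<delta> h \<in> borel_measurable \<mu>"
  using delta by (rule delta_borel)

lemma u_measurable [measurable]: "u \<in> borel_measurable \<mu>"
  unfolding u[abs_def] by measurable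

text \<open>From |x| \<le> 1 + x^2 and second moments at most 2, the \<open>i\<close>-th term has
  expected absolute value at most \<open>3 * r ^ Suc i\<close>. Off the resulting almost sure set
  the \<open>suminf\<close> defining \<open>u\<close> may be an unspecified value.\<close>

lemma AE_summable: "AE w in \<mu>. summable (\<lambda>i. \<bar>r ^ Suc i * \<delta> (b (Suc i)) w\<bar>)"
proof -
  have "(\<integral>\<^sup>+ w. ennreal \<bar>r ^ Suc i * \<delta> (b (Suc i)) w\<bar> \<partial>\<mu>) \<le> ennreal (3 * r ^ Suc i)" for i
  proof -
    let ?X = "\<delta> (b (Suc i))"
    have "\<bar>x\<bar> \<le> 1 + x\<^sup>2" for x :: real
    proof -
      have "0 \<le> (\<bar>x\<bar> - 1)\<^sup>2" by simp
      then have "2 * \<bar>x\<bar> \<le> 1 + x\<^sup>2" unfolding power2_diff by simp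
      then show ?thesis by linarith
    qed
    then have "\<bar>r ^ Suc i * ?X w\<bar> \<le> r ^ Suc i * (1 + (?X w)\<^sup>2)" for w
      using weight_le_1(2)[of "Suc i"] unfolding abs_mult by (simp only: abs_of_nonneg mult_left_mono)
    then have "(\<integral>\<^sup>+ w. ennreal \<bar>r ^ Suc i * ?X w\<bar> \<partial>\<mu>) \<le> (\<integral>\<^sup>+ w. ennreal (r ^ Suc i) * (1 + ennreal ((?X w)\<^sup>2)) \<partial>\<mu>)"
      using weight_le_1(2)[of "Suc i"]
      by (intro nn_integral_mono) (simp only: ennreal_1[symmetric] ennreal_plus[symmetric] ennreal_mult[symmetric]
          ennreal_leI zero_le_power2 zero_le_one add_nonneg_nonneg)
    also have "\<dots> = ennreal (r ^ Suc i) * (1 + msq \<mu> ?X)"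
      by (simp add: nn_integral_cmult nn_integral_add emeasure_space_1[unfolded space_mu])
    also have "\<dots> \<le> ennreal (r ^ Suc i) * (1 + ennreal 2)"
      using is_delta_square_le[OF delta, of "b (Suc i)"] by (intro mult_left_mono add_left_mono) auto
    also have "1 + ennreal 2 = ennreal 3" by simp
    also have "ennreal (r ^ Suc i) * ennreal 3 = ennreal (3 * r ^ Suc i)"
      using weight_le_1(2)[of "Suc i"] by (subst ennreal_mult[symmetric]) (auto simp: mult.commute)
    finally show ?thesis .
  qed
  then have "(\<integral>\<^sup>+ w. (\<Sum>i. ennreal \<bar>r ^ Suc i * \<delta> (b (Suc i)) w\<bar>) \<partial>\<mu>) \<le> (\<Sum>i. ennreal (3 * r ^ Suc i))"
    by (subst nn_integral_suminf) (auto intro!: suminf_le)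
  also have "\<dots> < \<infinity>"
  proof -
    have s: "summable (\<lambda>i. 3 * r ^ Suc i)" using r by (simp add: summable_geometric)
    show ?thesis using r by (subst suminf_ennreal2[OF _ s]) auto
  qed
  finally have "(\<integral>\<^sup>+ w. (\<Sum>i. ennreal \<bar>r ^ Suc i * \<delta> (b (Suc i)) w\<bar>) \<partial>\<mu>) \<noteq> \<infinity>" by simp
  then have "AE w in \<mu>. (\<Sum>i. ennreal \<bar>r ^ Suc i * \<delta> (b (Suc i)) w\<bar>) \<noteq> \<infinity>"
    by (intro nn_integral_noteq_infinite) auto
  then show ?thesis by eventually_elim (auto intro!: summable_suminf_not_top)
qed

lemma AE_inner_u_sums:
  "AE w in \<mu>. \<forall>h. (\<lambda>i. (r ^ Suc i * inner h (b i)) * \<delta> (b (Suc i)) w) sums inner (u w) h"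
  using AE_summable
proof eventually_elim
  case (elim w)
  have "summable (\<lambda>i. norm ((r ^ Suc i * \<delta> (b (Suc i)) w) *\<^sub>R b i))" using elim by simp
  then have "summable (\<lambda>i. (r ^ Suc i * \<delta> (b (Suc i)) w) *\<^sub>R b i)" by (rule summable_norm_cancel)
  then have "(\<lambda>i. (r ^ Suc i * \<delta> (b (Suc i)) w) *\<^sub>R b i) sums u w" unfolding u by (rule summable_sums)
  from bounded_linear.sums[OF bounded_linear_inner_left this] show ?case
    by (simp add: inner_commute mult_ac)
qed

lemma AE_coord_u: "AE w in \<mu>. \<forall>k. inner (u w) (b k) = r ^ Suc k * \<delta> (b (Suc k)) w"
  using AE_inner_u_sums
proof eventually_elim
  case (elim w)
  have "inner (u w) (b k) = r ^ Suc k * \<delta> (b (Suc k)) w" for k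
  proof -
    have "(\<lambda>i. if i = k then r ^ Suc i * \<delta> (b (Suc i)) w else 0) sums inner (u w) (b k)"
      using elim[rule_format, of "b k"]
      by (rule sums_cong[THEN iffD1, rotated]) (auto simp: orthonormal)
    from sums_unique2[OF this sums_single] show ?thesis .
  qed
  then show ?case by blast
qed

lemma nn_integral_norm_sq:
  assumes "AE w in \<mu>. \<forall>k. inner (x w) (b k) = X k w" and [measurable]: "\<And>k. X k \<in> borel_measurable \<mu>"
  shows "msq \<mu> (\<lambda>w. norm (x w)) = (\<Sum>k. msq \<mu> (X k))"
proof -
  have "msq \<mu> (\<lambda>w. norm (x w)) = (\<integral>\<^sup>+ w. (\<Sum>k. ennreal ((X k w)\<^sup>2)) \<partial>\<mu>)"
    using assms(1) by (intro nn_integral_cong_AE) (auto simp: parseval_ennreal[symmetric])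
  then show ?thesis by (simp add: nn_integral_suminf)
qed

text \<open>The partial sums of \<open>inner (u w) h\<close> are versions for the partial sums of
  \<open>forward h\<close>. They converge almost everywhere to \<open>inner (u w) h\<close> and in
  mean square to \<open>\<delta> (forward h)\<close>; Fatou identifies the two limits.\<close>

lemma inner_u_is_delta: "is_delta \<mu> j (forward h) (\<lambda>w. inner (u w) h)"
proof -
  define S where "S n w = (\<Sum>i<n. (r ^ Suc i * inner h (b i)) * \<delta> (b (Suc i)) w)" for n w
  define x where "x n = (\<Sum>i<n. (r ^ Suc i * inner h (b i)) *\<^sub>R b (Suc i))" for n
  have S: "is_delta \<mu> j (x n) (S n)" for n
    unfolding S_def x_def by (intro is_delta_sum delta)
  have [measurable]: "S n \<in> borel_measurable \<mu>" for n using S by (rule delta_borel)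
  let ?Y = "\<delta> (forward h)"
  have le: "msq \<mu> (\<lambda>w. S n w - ?Y w) \<le> ennreal (2 * (norm (x n - forward h))\<^sup>2)" for n
    using is_delta_square_le[OF is_delta_lin[OF S delta, of n "-1" "forward h"]] by simp
  have "(\<lambda>n. ennreal (2 * (norm (x n - forward h))\<^sup>2)) \<longlonglongrightarrow> ennreal (2 * (norm (forward h - forward h))\<^sup>2)"
    unfolding x_def by (intro tendsto_ennrealI tendsto_intros forward_sums[unfolded sums_def])
  then have lim: "(\<lambda>n. ennreal (2 * (norm (x n - forward h))\<^sup>2)) \<longlonglongrightarrow> 0" by simp
  have lim0: "(\<lambda>n. msq \<mu> (\<lambda>w. S n w - ?Y w)) \<longlonglongrightarrow> 0"
    by (rule tendsto_sandwich[OF _ _ tendsto_const lim]) (auto intro!: always_eventually le)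
  have "msq \<mu> (\<lambda>w. inner (u w) h - ?Y w) = (\<integral>\<^sup>+ w. liminf (\<lambda>n. ennreal ((S n w - ?Y w)\<^sup>2)) \<partial>\<mu>)"
  proof (rule nn_integral_cong_AE)
    show "AE w in \<mu>. ennreal ((inner (u w) h - ?Y w)\<^sup>2) = liminf (\<lambda>n. ennreal ((S n w - ?Y w)\<^sup>2))"
      using AE_inner_u_sums
    proof eventually_elim
      case (elim w)
      then have "(\<lambda>n. S n w) \<longlonglongrightarrow> inner (u w) h" unfolding sums_def S_def by blast
      then have "(\<lambda>n. ennreal ((S n w - ?Y w)\<^sup>2)) \<longlonglongrightarrow> ennreal ((inner (u w) h - ?Y w)\<^sup>2)"
        by (intro tendsto_ennrealI tendsto_intros)
      then show ?case by (intro lim_imp_Liminf[symmetric]) auto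
    qed
  qed
  also have "\<dots> \<le> liminf (\<lambda>n. msq \<mu> (\<lambda>w. S n w - ?Y w))" by (rule nn_integral_liminf) simp
  also have "\<dots> = 0" using lim0 by (intro lim_imp_Liminf) auto
  finally have "AE w in \<mu>. inner (u w) h - ?Y w = 0" by (simp add: nn_integral_0_iff_AE)
  then have "AE w in \<mu>. ?Y w = inner (u w) h" by eventually_elim simp
  then show ?thesis by (rule is_delta_cong_AE[OF delta]) simp
qed

section \<open>Adaptedness forces invariant ranges\<close>

lemma adapted_imp_invariant:
  assumes P: "orthogonal_projection P"
    and ad: "(\<lambda>w. inner (u w) (P \<cdot> h))
        \<in> borel_measurable (sigma (space \<mu>) ({\<delta> (P \<cdot> h) -` A \<inter> space \<mu> | h A. A \<in> sets borel} \<union> null_sets \<mu>))"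
  shows "forward (P \<cdot> h) \<in> range (blinfun_apply P)"
proof -
  let ?P = "blinfun_apply P"
  define E where "E = {\<delta> (?P h) -` A \<inter> space \<mu> | h A. A \<in> sets borel} \<union> null_sets \<mu>"
  have EP: "E \<subseteq> Pow (space \<mu>)" unfolding E_def by auto
  define f where "f = forward (?P h)"
  define g where "g = f - ?P f"
  \<comment> \<open>\<open>X\<close> is the variable of \<open>g\<close>: subtracting
    \<open>\<delta> (?P f)\<close> keeps it measurable for the sigma-algebra of the projection and
    leaves a vector orthogonal to the range.\<close>
  define X where "X w = inner (u w) (?P h) - \<delta> (?P f) w" for w
  have X: "is_delta \<mu> j g X"
  proof -
    have "X = (\<lambda>w. inner (u w) (?P h) + (-1) * \<delta> (?P f) w)" "g = forward (?P h) + (-1) *\<^sub>R ?P f"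
      by (simp_all add: X_def fun_eq_iff g_def f_def)
    then show ?thesis using is_delta_lin[OF inner_u_is_delta delta, of "?P h" "-1" "?P f"] by (simp only:)
  qed
  have [measurable]: "X \<in> borel_measurable \<mu>" using X by (rule delta_borel)
  have "inner g (?P k) = 0" for k
    using P unfolding orthogonal_projection_def g_def inner_diff_left
    by (metis blinfun_apply_blinfun_compose diff_self)
  then have indep: "indep_set (sigma_sets (space \<mu>) {X -` B \<inter> space \<mu> | B. B \<in> sets borel})
    (sigma_sets (space \<mu>) ({\<delta> (?P i) -` A \<inter> space \<mu> | i A. i \<in> UNIV \<and> A \<in> sets borel} \<union> null_sets \<mu>))"
    by (intro is_delta_indep[OF X delta]) auto
  have "\<delta> (?P f) \<in> borel_measurable (sigma (space \<mu>) E)"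
  proof (rule measurableI)
    fix A assume "A \<in> sets (borel :: real measure)"
    then have "\<delta> (?P f) -` A \<inter> space \<mu> \<in> E" unfolding E_def by blast
    then show "\<delta> (?P f) -` A \<inter> space (sigma (space \<mu>) E) \<in> sets (sigma (space \<mu>) E)"
      using EP by (simp add: sets_measure_of space_measure_of_conv)
  qed simp
  then have "X \<in> borel_measurable (sigma (space \<mu>) E)"
    unfolding X_def[abs_def] using ad unfolding E_def[symmetric] by (intro borel_measurable_diff)
  from measurable_sets[OF this] have "{X -` A \<inter> space \<mu> | A. A \<in> sets borel} \<subseteq> sigma_sets (space \<mu>) E"
    using EP by (auto simp: sets_measure_of space_measure_of_conv)
  then have sub: "sigma_sets (space \<mu>) {X -` A \<inter> space \<mu> | A. A \<in> sets borel} \<subseteq> sigma_sets (space \<mu>) E"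
    by (rule sigma_sets_mono)
  \<comment> \<open>The events of \<open>X\<close> lie in the very sigma-algebra that
    \<open>X\<close> is independent of.\<close>
  have "indep_var borel X borel X"
    using indep sub unfolding indep_var_eq indep_sets2_eq E_def by auto
  then have iv: "indep_var borel ((\<lambda>x. iexp x) \<circ> X) borel ((\<lambda>x. iexp (- x)) \<circ> X)"
    by (rule indep_var_compose) auto
  have int: "integrable \<mu> (\<lambda>w. iexp (Y w))" if "Y \<in> borel_measurable \<mu>" for Y
    using that by (intro integrable_const_bound[of _ 1]) auto
  \<comment> \<open>The integrand on the left is 1, while each factor on the right is the
    exponential of minus half the squared norm of \<open>g\<close>; hence that norm is zero.\<close>
  have "(CLINT w|\<mu>. iexp (X w) * iexp (- X w)) = (CLINT w|\<mu>. iexp (X w)) * (CLINT w|\<mu>. iexp (- X w))"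
    using indep_var_lebesgue_integral[OF iv] int[of X] int[of "\<lambda>w. - X w"] by (simp add: comp_def)
  moreover have "(CLINT w|\<mu>. iexp (X w) * iexp (- X w)) = 1"
    by (simp add: exp_minus prob_space[unfolded space_mu])
  moreover have "(CLINT w|\<mu>. iexp (- X w)) = exp (- ((norm g)\<^sup>2) / 2)"
    using is_delta_char[OF is_delta_lin[OF is_delta_0 X, of "-1"]] by simp
  ultimately have "1 = complex_of_real (exp (- ((norm g)\<^sup>2) / 2) * exp (- ((norm g)\<^sup>2) / 2))"
    using is_delta_char[OF X] by simp
  then have "exp (- ((norm g)\<^sup>2) / 2) * exp (- ((norm g)\<^sup>2) / 2) = 1" by (metis of_real_1 of_real_eq_iff)
  then have "exp (- ((norm g)\<^sup>2)) = 1" by (simp add: exp_add[symmetric])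
  then have "g = 0" by simp
  then show ?thesis unfolding g_def f_def by (metis eq_iff_diff_eq_0 rangeI)
qed

theorem not_adapted:
  assumes "resolution_of_identity \<pi>" "resolution_strictly_increasing \<pi>"
  shows "\<not> adapted \<mu> \<delta> \<pi> u"
proof
  assume "adapted \<mu> \<delta> \<pi> u"
  then have "forward (\<pi> \<theta> \<cdot> h) \<in> range (blinfun_apply (\<pi> \<theta>))" if "\<theta> \<in> {0..1}" for \<theta> h
    using that assms(1) unfolding adapted_def induced_filtration_def resolution_of_identity_def
    by (intro adapted_imp_invariant) auto
  with no_invariant_resolution[OF assms] show False by blast
qed

text \<open>The second estimate concerns the gradient of the function in the first, so one
  \<open>l\<close> and one \<open>s\<close> must serve both: \<open>l\<close> is chosen close to
  \<open>e\<close>, then \<open>s\<close> small by dominated convergence. Each error splits into two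
  pieces, both doubled by \<open>nn_sq_add\<close>, which accounts for
  \<open>\<epsilon> / 4\<close>.\<close>

lemma smooth_functional_approx:
  assumes e: "is_delta \<mu> j e X" and \<epsilon>: "\<epsilon> > 0"
  shows "\<exists>l s. s > 0 \<and> msq \<mu> (\<lambda>w. sin (s * l \<cdot> w) / s - X w) \<le> ennreal \<epsilon>
    \<and> msq \<mu> (\<lambda>w. norm (cos (s * l \<cdot> w) *\<^sub>R dual_embedding j l - e)) \<le> ennreal \<epsilon>"
proof -
  have [measurable]: "X \<in> borel_measurable \<mu>" using e by (rule delta_borel)
  obtain l where l: "(\<lambda>n. dual_embedding j (l n)) \<longlonglongrightarrow> e"
    "(\<lambda>n. msq \<mu> (\<lambda>w. l n \<cdot> w - X w)) \<longlonglongrightarrow> 0"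
    using e unfolding is_delta_def by auto
  have "\<forall>\<^sub>F n in sequentially. msq \<mu> (\<lambda>w. l n \<cdot> w - X w) < ennreal (\<epsilon> / 4)"
    using \<epsilon> by (intro order_tendstoD[OF l(2)]) auto
  moreover have "(\<lambda>n. (norm (dual_embedding j (l n) - e))\<^sup>2) \<longlonglongrightarrow> (norm (e - e))\<^sup>2"
    by (intro tendsto_intros l)
  from order_tendstoD(2)[OF this, of "\<epsilon> / 4"]
  have "\<forall>\<^sub>F n in sequentially. (norm (dual_embedding j (l n) - e))\<^sup>2 < \<epsilon> / 4" using \<epsilon> by simp
  ultimately have "\<forall>\<^sub>F n in sequentially. msq \<mu> (\<lambda>w. l n \<cdot> w - X w) < ennreal (\<epsilon> / 4)
      \<and> (norm (dual_embedding j (l n) - e))\<^sup>2 < \<epsilon> / 4" by (rule eventually_conj)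
  then obtain n0 where n0: "msq \<mu> (\<lambda>w. l n0 \<cdot> w - X w) < ennreal (\<epsilon> / 4)"
      "(norm (dual_embedding j (l n0) - e))\<^sup>2 < \<epsilon> / 4" by (auto simp: eventually_sequentially)
  define L where "L = l n0"
  define s where "s n = inverse (real (Suc n))" for n
  have s: "s n > 0" for n by (simp add: s_def)
  have s0: "s \<longlonglongrightarrow> 0" unfolding s_def by (rule LIMSEQ_inverse_real_of_nat)
  define F where "F n w = sin (s n * L \<cdot> w) / s n" for n w
  define d where "d = dual_embedding j L"
  define C where "C n w = cos (s n * L \<cdot> w) *\<^sub>R d" for n w
  have [measurable]: "F n \<in> borel_measurable \<mu>" "C n \<in> borel_measurable \<mu>" for n
    unfolding F_def[abs_def] C_def[abs_def] by measurable
  have "(\<lambda>n. msq \<mu> (\<lambda>w. F n w - L \<cdot> w)) \<longlonglongrightarrow> (\<integral>\<^sup>+ w. 0 \<partial>\<mu>)"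
  \<comment> \<open>The majorant comes from |sin (s x) / s| \<le> |x|, so the difference is at most
    2 |x|.\<close>
  proof (rule nn_integral_dominated_convergence[where w="\<lambda>w. 4 * ennreal ((L \<cdot> w)\<^sup>2)"])
    show "AE w in \<mu>. ennreal ((F n w - L \<cdot> w)\<^sup>2) \<le> 4 * ennreal ((L \<cdot> w)\<^sup>2)" for n
    proof (rule AE_I2)
      fix w
      have "\<bar>F n w - L \<cdot> w\<bar> \<le> 2 * \<bar>L \<cdot> w\<bar>"
        using abs_sin_scaled_le[OF s[of n], of "L \<cdot> w"] unfolding F_def by linarith
      from power_mono[OF this, of 2] have "(F n w - L \<cdot> w)\<^sup>2 \<le> 4 * (L \<cdot> w)\<^sup>2"
        by (simp add: power_mult_distrib)
      from ennreal_leI[OF this] show "ennreal ((F n w - L \<cdot> w)\<^sup>2) \<le> 4 * ennreal ((L \<cdot> w)\<^sup>2)"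
        by (simp add: ennreal_mult')
    qed
    show "(\<integral>\<^sup>+ w. 4 * ennreal ((L \<cdot> w)\<^sup>2) \<partial>\<mu>) < \<infinity>"
      by (simp add: nn_integral_cmult functional_square ennreal_mult_less_top)
    show "AE w in \<mu>. (\<lambda>n. ennreal ((F n w - L \<cdot> w)\<^sup>2)) \<longlonglongrightarrow> 0"
    proof (rule AE_I2)
      fix w
      have "(\<lambda>n. ennreal ((F n w - L \<cdot> w)\<^sup>2)) \<longlonglongrightarrow> ennreal ((L \<cdot> w - L \<cdot> w)\<^sup>2)"
        unfolding F_def s_def by (intro tendsto_ennrealI tendsto_intros sin_scaled_tendsto)
      then show "(\<lambda>n. ennreal ((F n w - L \<cdot> w)\<^sup>2)) \<longlonglongrightarrow> 0" by simp
    qed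
  qed measurable
  then have "\<forall>\<^sub>F n in sequentially. msq \<mu> (\<lambda>w. F n w - L \<cdot> w) < ennreal (\<epsilon> / 4)"
    using \<epsilon> by (intro order_tendstoD) auto
  moreover
  have "(\<lambda>n. msq \<mu> (\<lambda>w. norm (C n w - d))) \<longlonglongrightarrow> (\<integral>\<^sup>+ w. 0 \<partial>\<mu>)"
  proof (rule nn_integral_dominated_convergence[where w="\<lambda>w. ennreal ((2 * norm d)\<^sup>2)"])
    show "AE w in \<mu>. ennreal ((norm (C n w - d))\<^sup>2) \<le> ennreal ((2 * norm d)\<^sup>2)" for n
    proof (intro AE_I2 ennreal_leI power_mono)
      fix w
      have "norm (C n w) \<le> norm d"
        by (simp add: C_def mult_left_le_one_le)
      then show "norm (C n w - d) \<le> 2 * norm d"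
        using norm_triangle_ineq4[of "C n w" d] by linarith
    qed simp
    show "msq \<mu> (\<lambda>w. 2 * norm d) < \<infinity>"
      by (simp add: emeasure_space_1[unfolded space_mu])
    show "AE w in \<mu>. (\<lambda>n. ennreal ((norm (C n w - d))\<^sup>2)) \<longlonglongrightarrow> 0"
    proof (rule AE_I2)
      fix w
      have "(\<lambda>n. ennreal ((norm (C n w - d))\<^sup>2)) \<longlonglongrightarrow> ennreal ((norm (cos (0 * L \<cdot> w) *\<^sub>R d - d))\<^sup>2)"
        unfolding C_def by (intro tendsto_ennrealI tendsto_intros s0)
      then show "(\<lambda>n. ennreal ((norm (C n w - d))\<^sup>2)) \<longlonglongrightarrow> 0"
        by simp
    qed
  qed measurable
  then have "\<forall>\<^sub>F n in sequentially. msq \<mu> (\<lambda>w. norm (C n w - d)) < ennreal (\<epsilon> / 4)"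
    using \<epsilon> by (intro order_tendstoD) auto
  ultimately have "\<forall>\<^sub>F n in sequentially. msq \<mu> (\<lambda>w. F n w - L \<cdot> w) < ennreal (\<epsilon> / 4)
      \<and> msq \<mu> (\<lambda>w. norm (C n w - d)) < ennreal (\<epsilon> / 4)"
    by (rule eventually_conj)
  then obtain n1 where n1: "msq \<mu> (\<lambda>w. F n1 w - L \<cdot> w) < ennreal (\<epsilon> / 4)"
      "msq \<mu> (\<lambda>w. norm (C n1 w - d)) < ennreal (\<epsilon> / 4)"
    by (auto simp: eventually_sequentially)
  have quarter: "2 * ennreal (\<epsilon> / 4) + 2 * ennreal (\<epsilon> / 4) = ennreal \<epsilon>"
  proof -
    have "2 * ennreal (\<epsilon> / 4) = ennreal (\<epsilon> / 2)" using \<epsilon> ennreal_mult'[of 2 "\<epsilon> / 4"] by simp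
    then show ?thesis using \<epsilon> by (simp add: ennreal_plus[symmetric] del: ennreal_plus)
  qed
  have "msq \<mu> (\<lambda>w. F n1 w - X w) = msq \<mu> (\<lambda>w. (F n1 w - L \<cdot> w) + (L \<cdot> w - X w))"
    by simp
  also have "\<dots> \<le> 2 * msq \<mu> (\<lambda>w. F n1 w - L \<cdot> w)
      + 2 * msq \<mu> (\<lambda>w. L \<cdot> w - X w)"
    by (rule nn_sq_add) measurable
  also have "\<dots> \<le> 2 * ennreal (\<epsilon> / 4) + 2 * ennreal (\<epsilon> / 4)"
    using n0 n1 by (intro add_mono mult_left_mono) (auto simp: L_def less_imp_le)
  finally have 1: "msq \<mu> (\<lambda>w. F n1 w - X w) \<le> ennreal \<epsilon>"
    unfolding quarter .
  have "msq \<mu> (\<lambda>w. norm (C n1 w - e)) \<le> msq \<mu> (\<lambda>w. norm (C n1 w - d)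
          + norm (d - e))"
    by (intro nn_integral_mono ennreal_leI power_mono) (auto intro: norm_diff_triangle_le)
  also have "\<dots> \<le> 2 * msq \<mu> (\<lambda>w. norm (C n1 w - d))
      + 2 * msq \<mu> (\<lambda>w. norm (d - e))"
    by (rule nn_sq_add) measurable
  also have "\<dots> \<le> 2 * ennreal (\<epsilon> / 4) + 2 * ennreal (\<epsilon> / 4)"
    using n0 n1 by (intro add_mono mult_left_mono)
      (auto simp: L_def d_def less_imp_le emeasure_space_1[unfolded space_mu] intro!: ennreal_leI)
  finally have 2: "msq \<mu> (\<lambda>w. norm (C n1 w - e)) \<le> ennreal \<epsilon>"
    unfolding quarter .
  from s[of n1] 1 2 show ?thesis unfolding F_def C_def d_def by blast
qed

text \<open>The first \<open>n\<close> terms carry the approximation error, the others are only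
  bounded by 2, the constant of \<open>is_delta_square_le\<close> for unit vectors. The squared
  weight is at most \<open>r ^ k * r ^ k\<close>: one factor is kept for summation, and for
  \<open>k \<ge> n\<close> the other yields \<open>r ^ n\<close>.\<close>

lemma suminf_weighted_le:
  fixes t :: "nat \<Rightarrow> ennreal"
  assumes t: "\<And>k. k < n \<Longrightarrow> t k \<le> ennreal \<epsilon>" "\<And>k. k \<ge> n \<Longrightarrow> t k \<le> 2" and \<epsilon>: "\<epsilon> \<ge> 0"
  shows "(\<Sum>k. ennreal ((r ^ Suc k)\<^sup>2) * t k) \<le> ennreal ((\<epsilon> + 2 * r ^ n) / (1 - r))"
proof -
  have "ennreal ((r ^ Suc k)\<^sup>2) * t k \<le> ennreal (r ^ k * (\<epsilon> + 2 * r ^ n))" for k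
  proof -
    have a: "(r ^ Suc k)\<^sup>2 \<le> r ^ k * r ^ k"
      unfolding power2_eq_square using r weight_le_1[of k]
      by (intro mult_mono) (auto simp: mult_left_le_one_le)
    show ?thesis
    proof (cases "k < n")
      case True
      have "ennreal ((r ^ Suc k)\<^sup>2) * t k \<le> ennreal ((r ^ Suc k)\<^sup>2) * ennreal \<epsilon>"
        using t(1)[OF True] by (rule mult_left_mono) simp
      also have "\<dots> = ennreal ((r ^ Suc k)\<^sup>2 * \<epsilon>)" using \<epsilon> by (simp add: ennreal_mult)
      also have "(r ^ Suc k)\<^sup>2 * \<epsilon> \<le> r ^ k * (\<epsilon> + 2 * r ^ n)"
      proof (intro mult_mono order_trans[OF a])
        show "r ^ k * r ^ k \<le> r ^ k" using weight_le_1[of k] by (simp add: mult_left_le)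
      qed (use weight_le_1 \<epsilon> in auto)
      finally show ?thesis by (simp add: ennreal_leI)
    next
      case False
      have "ennreal ((r ^ Suc k)\<^sup>2) * t k \<le> ennreal ((r ^ Suc k)\<^sup>2) * ennreal 2"
        using t(2)[of k] False by (intro mult_left_mono) auto
      also have "\<dots> = ennreal ((r ^ Suc k)\<^sup>2 * 2)" by (subst ennreal_mult) auto
      also have "(r ^ Suc k)\<^sup>2 * 2 \<le> (r ^ k * r ^ n) * 2"
        using a weight_le_1[of k] power_decreasing[of n k r] r False
        by (intro mult_right_mono order_trans[OF a] mult_left_mono) auto
      also have "\<dots> \<le> r ^ k * (\<epsilon> + 2 * r ^ n)" using \<epsilon> weight_le_1[of k] by (simp add: distrib_left)
      finally show ?thesis by (simp add: ennreal_leI)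
    qed
  qed
  then have "(\<Sum>k. ennreal ((r ^ Suc k)\<^sup>2) * t k) \<le> (\<Sum>k. ennreal (r ^ k * (\<epsilon> + 2 * r ^ n)))"
    by (intro suminf_le) auto
  also have "\<dots> = ennreal ((\<epsilon> + 2 * r ^ n) / (1 - r))"
  proof (rule sums_unique[symmetric])
    have "(\<lambda>k. r ^ k * (\<epsilon> + 2 * r ^ n)) sums (1 / (1 - r) * (\<epsilon> + 2 * r ^ n))"
      using r by (intro sums_mult2 geometric_sums) auto
    moreover have "0 \<le> r ^ k * (\<epsilon> + 2 * r ^ n)" for k using r \<epsilon> by simp
    ultimately show "(\<lambda>k. ennreal (r ^ k * (\<epsilon> + 2 * r ^ n))) sums ennreal ((\<epsilon> + 2 * r ^ n) / (1 - r))"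
      using r \<epsilon> by (subst sums_ennreal) auto
  qed
  finally show ?thesis .
qed

end

section \<open>The gradient of u\<close>

context wiener_shift
begin

lemma hs_norm2_le_rows:
  assumes "\<And>h k. inner (A \<cdot> h) (b k) = inner (v k) h"
  shows "hs_norm2 A \<le> (\<Sum>k. ennreal ((norm (v k))\<^sup>2))"
  by (rule hs_norm2_bound[OF orthonormal_basis_range]) (simp add: parseval_ennreal[symmetric] assms)

lemma apply_backward: "blinfun_apply (Blinfun backward) = backward"
  by (simp add: bounded_linear_Blinfun_apply bounded_linear_backward)

lemma delta_basis_square_le: "msq \<mu> (\<delta> (b k)) \<le> 2"
  using is_delta_square_le[OF delta, of "b k"] by simp

text \<open>As \<open>u\<close> is linear in the Gaussian variables, its gradient is constant. The
  approximants keep the first \<open>n\<close> terms and replace each variable by a sine of mean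
  square error \<open>1 / (n + 1)\<close>; the two summands of \<open>bound\<close> account for the
  replacement and for the discarded tail.\<close>

lemma malliavin_gradient_u: "is_malliavin_gradient \<mu> j u (\<lambda>_. Blinfun backward)"
proof -
  let ?D = "Blinfun backward"
  define bound where "bound n = ennreal ((inverse (real (Suc n)) + 2 * r ^ n) / (1 - r))" for n
  have "(\<lambda>n. (inverse (real (Suc n)) + 2 * r ^ n) / (1 - r)) \<longlonglongrightarrow> (0 + 2 * 0) / (1 - r)"
    using r by (intro tendsto_intros LIMSEQ_inverse_real_of_nat LIMSEQ_power_zero) auto
  from tendsto_ennrealI[OF this] have bound0: "bound \<longlonglongrightarrow> 0" by (simp add: bound_def[abs_def])
  \<comment> \<open>\<open>q\<close> consists of a functional and a frequency; bundling them lets a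
    single choice over all pairs of \<open>n\<close> and \<open>k\<close> produce every
    approximant.\<close>
  define Q where "Q n k q \<longleftrightarrow> snd q > 0
      \<and> msq \<mu> (\<lambda>w. sin (snd q * fst q \<cdot> w) / snd q - \<delta> (b (Suc k)) w) \<le> ennreal (inverse (real (Suc n)))
      \<and> msq \<mu> (\<lambda>w. norm (cos (snd q * fst q \<cdot> w) *\<^sub>R dual_embedding j (fst q) - b (Suc k))) \<le> ennreal (inverse (real (Suc n)))"
    for n k and q :: "('w \<Rightarrow>\<^sub>L real) \<times> real"
  have "\<exists>q. Q (fst p) (snd p) q" for p
    using smooth_functional_approx[OF delta, of "inverse (real (Suc (fst p)))" "b (Suc (snd p))"]
    unfolding Q_def by auto
  then obtain q where q: "\<And>p. Q (fst p) (snd p) (q p)" by metis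
  define l where "l n k = fst (q (n, k))" for n k
  define s where "s n k = snd (q (n, k))" for n k
  have s: "s n k > 0" for n k using q[of "(n, k)"] by (simp add: s_def Q_def)
  have approx: "msq \<mu> (\<lambda>w. sin (s n k * l n k \<cdot> w) / s n k - \<delta> (b (Suc k)) w) \<le> ennreal (inverse (real (Suc n)))"
    "msq \<mu> (\<lambda>w. norm (cos (s n k * l n k \<cdot> w) *\<^sub>R dual_embedding j (l n k) - b (Suc k))) \<le> ennreal (inverse (real (Suc n)))"
    for n k
    using q[of "(n, k)"] unfolding Q_def s_def l_def fst_conv snd_conv by blast+
  define a where "a k = r ^ Suc k *\<^sub>R b k" for k
  define U where "U n w = (\<Sum>k<n. (sin (s n k * l n k \<cdot> w) / s n k) *\<^sub>R a k)" for n w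
  define G where "G n w = Blinfun (\<lambda>h. \<Sum>k<n. (cos (s n k * l n k \<cdot> w) * l n k \<cdot> (j \<cdot> h)) *\<^sub>R a k)" for n w
  have G: "G n w \<cdot> h = (\<Sum>k<n. (cos (s n k * l n k \<cdot> w) * l n k \<cdot> (j \<cdot> h)) *\<^sub>R a k)" for n w h
  proof -
    have "bounded_linear (\<lambda>h. \<Sum>k<n. (cos (s n k * l n k \<cdot> w) * l n k \<cdot> (j \<cdot> h)) *\<^sub>R a k)"
      by (intro bounded_linear_sum bounded_linear_scaleR_const bounded_linear_const_mult
          bounded_linear_compose[OF blinfun.bounded_linear_right blinfun.bounded_linear_right])
    then show ?thesis unfolding G_def by (simp add: bounded_linear_Blinfun_apply)
  qed
  have cyl: "smooth_cylindrical j (U n) (G n)" for n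
    unfolding smooth_cylindrical_def
  proof (intro exI[of _ n] exI[of _ "\<lambda>k x. sin (s n k * x k) / s n k"] exI[of _ "l n"] exI[of _ a] conjI allI impI)
    show "smooth_bounded n (\<lambda>x. sin (s n k * x k) / s n k)" if "k < n" for k
      using that by (rule smooth_bounded_sin)
    show "U n w = (\<Sum>k<n. (sin (s n k * l n k \<cdot> w) / s n k) *\<^sub>R a k)" for w
      by (simp add: U_def)
    have "(\<Sum>i<n. partial_deriv i (\<lambda>x. sin (s n k * x k) / s n k) (evals (l n) w) * l n i \<cdot> (j \<cdot> h))
       = (\<Sum>i<n. if i = k then cos (s n k * l n k \<cdot> w) * l n k \<cdot> (j \<cdot> h) else 0)" for k w h
      using s[of n k] by (intro sum.cong) (auto simp: partial_deriv_sin)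
    then show "G n w \<cdot> h = (\<Sum>k<n. (\<Sum>i<n. partial_deriv i (\<lambda>x. sin (s n k * x k) / s n k) (evals (l n) w)
        * l n i \<cdot> (j \<cdot> h)) *\<^sub>R a k)" for w h
      unfolding G by (intro sum.cong) auto
  qed
  have inner_sum_a: "inner (\<Sum>i<n. c i *\<^sub>R a i) (b k) = (if k < n then c k * r ^ Suc k else 0)" for n c k
  proof -
    have "inner (\<Sum>i<n. c i *\<^sub>R a i) (b k) = (\<Sum>i<n. if i = k then c k * r ^ Suc k else 0)"
      unfolding inner_sum_left by (intro sum.cong) (auto simp: a_def orthonormal)
    then show ?thesis by simp
  qed
  have Ulim: "msq \<mu> (\<lambda>w. norm (U n w - u w)) \<le> bound n" for n
  proof -
    define Y where "Y k w = (if k < n then sin (s n k * l n k \<cdot> w) / s n k else 0) - \<delta> (b (Suc k)) w" for k w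
    have [measurable]: "Y k \<in> borel_measurable \<mu>" for k
      unfolding Y_def[abs_def] by (cases "k < n") (simp_all, measurable)
    have "AE w in \<mu>. \<forall>k. inner (U n w - u w) (b k) = r ^ Suc k * Y k w"
      using AE_coord_u
      by eventually_elim (simp add: inner_diff_left U_def inner_sum_a Y_def algebra_simps)
    from nn_integral_norm_sq[OF this]
    have "msq \<mu> (\<lambda>w. norm (U n w - u w)) = (\<Sum>k. msq \<mu> (\<lambda>w. r ^ Suc k * Y k w))"
      by simp
    also have "\<dots> = (\<Sum>k. ennreal ((r ^ Suc k)\<^sup>2) * msq \<mu> (Y k))"
      by (intro suminf_cong nn_sq_cmult) simp
    also have "\<dots> \<le> bound n"
      unfolding bound_def
      by (rule suminf_weighted_le) (use approx delta_basis_square_le in \<open>auto simp: Y_def\<close>)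
    finally show ?thesis .
  qed
  have Glim: "(\<integral>\<^sup>+ w. hs_norm2 (G n w - ?D) \<partial>\<mu>) \<le> bound n" for n
  proof -
    define V where "V k w = (if k < n then cos (s n k * l n k \<cdot> w) *\<^sub>R dual_embedding j (l n k) else 0) - b (Suc k)" for k w
    have [measurable]: "V k \<in> borel_measurable \<mu>" for k
      unfolding V_def[abs_def] by (cases "k < n") (simp_all, measurable)
    have "inner ((G n w - ?D) \<cdot> h) (b k) = inner (r ^ Suc k *\<^sub>R V k w) h" for w h k
      by (simp add: blinfun.diff_left inner_diff_left G inner_sum_a apply_backward backward_coord V_def
          dual_embedding inner_commute[of h] algebra_simps)
    then have "(\<integral>\<^sup>+ w. hs_norm2 (G n w - ?D) \<partial>\<mu>) \<le> (\<integral>\<^sup>+ w. (\<Sum>k. ennreal ((norm (r ^ Suc k *\<^sub>R V k w))\<^sup>2)) \<partial>\<mu>)"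
      by (intro nn_integral_mono hs_norm2_le_rows)
    also have "\<dots> = (\<Sum>k. msq \<mu> (\<lambda>w. norm (r ^ Suc k *\<^sub>R V k w)))"
      by (rule nn_integral_suminf) measurable
    also have "\<dots> = (\<Sum>k. msq \<mu> (\<lambda>w. r ^ Suc k * norm (V k w)))"
      using r by simp
    also have "\<dots> = (\<Sum>k. ennreal ((r ^ Suc k)\<^sup>2) * msq \<mu> (\<lambda>w. norm (V k w)))"
      by (intro suminf_cong nn_sq_cmult) measurable
    also have "\<dots> \<le> bound n"
      unfolding bound_def
      by (rule suminf_weighted_le) (use approx in \<open>auto simp: V_def emeasure_space_1[unfolded space_mu]\<close>)
    finally show ?thesis .
  qed
  have "msq \<mu> (\<lambda>w. norm (u w)) = (\<Sum>k. msq \<mu> (\<lambda>w. r ^ Suc k * \<delta> (b (Suc k)) w))"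
    by (rule nn_integral_norm_sq[OF AE_coord_u]) simp
  also have "\<dots> = (\<Sum>k. ennreal ((r ^ Suc k)\<^sup>2) * msq \<mu> (\<lambda>w. \<delta> (b (Suc k)) w))"
    by (intro suminf_cong nn_sq_cmult) simp
  \<comment> \<open>With no approximated terms, \<open>n = 0\<close> and \<epsilon> = 0, the
    weighted estimate becomes a plain finiteness bound.\<close>
  also have "\<dots> \<le> ennreal ((0 + 2 * r ^ 0) / (1 - r))"
    by (rule suminf_weighted_le) (use delta_basis_square_le in auto)
  also have "\<dots> < \<infinity>" by simp
  finally have u2: "msq \<mu> (\<lambda>w. norm (u w)) < \<infinity>" .
  have "hs_norm2 ?D \<le> (\<Sum>k. ennreal ((norm (r ^ Suc k *\<^sub>R b (Suc k)))\<^sup>2))"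
    by (rule hs_norm2_le_rows) (simp add: apply_backward backward_coord, simp add: inner_commute)
  also have "\<dots> = (\<Sum>k. ennreal ((r ^ Suc k)\<^sup>2) * 1)" by simp
  also have "\<dots> \<le> ennreal ((0 + 2 * r ^ 0) / (1 - r))"
    by (rule suminf_weighted_le) auto
  also have "\<dots> < \<infinity>" by simp
  finally have "(\<integral>\<^sup>+ w. hs_norm2 ?D \<partial>\<mu>) < \<infinity>" by (simp add: emeasure_space_1[unfolded space_mu])
  moreover have "(\<lambda>n. msq \<mu> (\<lambda>w. norm (U n w - u w))) \<longlonglongrightarrow> 0"
    by (rule tendsto_sandwich[OF _ _ tendsto_const bound0]) (auto intro!: always_eventually Ulim)
  moreover have "(\<lambda>n. \<integral>\<^sup>+ w. hs_norm2 (G n w - ?D) \<partial>\<mu>) \<longlonglongrightarrow> 0"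
    by (rule tendsto_sandwich[OF _ _ tendsto_const bound0]) (auto intro!: always_eventually Glim)
  ultimately show ?thesis
    unfolding is_malliavin_gradient_def using u2 cyl
    by (intro conjI exI[of _ U] exI[of _ G]) auto
qed

theorem quasinilpotent_gradient_u: "quasinilpotent_gradient \<mu> j u"
  unfolding quasinilpotent_gradient_def
proof (intro allI impI)
  fix D assume D: "is_malliavin_gradient \<mu> j u D"
  \<comment> \<open>Density of the functionals in H comes with the variables:
    \<open>is_delta\<close> for each \<open>h\<close> already contains an approximating
    sequence.\<close>
  have "\<exists>l. (\<lambda>n. dual_embedding j (l n)) \<longlonglongrightarrow> h" for h
    using delta[of h] unfolding is_delta_def by blast
  from malliavin_gradient_unique[OF D malliavin_gradient_u this]
  show "AE w in \<mu>. quasinilpotent (D w)"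
    by eventually_elim (simp add: quasinilpotent_backward)
qed

end

theorem mainTheorem4:
  fixes \<mu> :: "'w::{banach,second_countable_topology} measure"
    and j :: "'h::{real_inner,banach,second_countable_topology} \<Rightarrow>\<^sub>L 'w"
    and \<delta> :: "'h \<Rightarrow> 'w \<Rightarrow> real"
    and e :: "nat \<Rightarrow> 'h"
    and \<alpha> :: real
    and u :: "'w \<Rightarrow> 'h"
  assumes wiener: "abstract_wiener_space \<mu> j"
    and infinite_dim: "\<not> (\<exists>B :: 'h set. finite B \<and> span B = UNIV)"
    and delta: "\<And>h. is_delta \<mu> j h (\<delta> h)"
    and basis: "inj_on e {1..}" "orthonormal_basis (e ` {1..})"
    and alpha: "\<alpha> > 0"
    and u: "u = (\<lambda>w. \<Sum>i. (2 powr (- (real (Suc i) * \<alpha>)) * \<delta> (e (Suc (Suc i))) w) *\<^sub>R e (Suc i))"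
  shows "u \<in> sobolev_D21 \<mu> j \<and>
    quasinilpotent_gradient \<mu> j u \<and>
    \<not> (\<exists>\<pi>. resolution_of_identity \<pi> \<and> resolution_continuous \<pi> \<and>
         resolution_strictly_increasing \<pi> \<and> adapted \<mu> \<delta> \<pi> u) \<and>
    \<not> (\<forall>v \<in> sobolev_D21 \<mu> j. quasinilpotent_gradient \<mu> j v \<longrightarrow>
         (\<exists>\<pi>. resolution_of_identity \<pi> \<and> resolution_continuous \<pi> \<and>
            resolution_strictly_increasing \<pi> \<and> adapted \<mu> \<delta> \<pi> v))"
proof -
  \<comment> \<open>The basis \<open>e\<close> is counted from 1 and \<open>b\<close> from 0;
    summand \<open>i\<close> of the series then has weight \<open>r ^ Suc i\<close> and involves
    \<open>b (Suc i)\<close> and \<open>b i\<close>.\<close>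
  define b where "b k = e (Suc k)" for k
  define r where "r = 2 powr (- \<alpha>)"
  have range_b: "range b = e ` {1..}"
  proof -
    have "range Suc = {1..}" by (auto simp: image_iff Suc_le_eq gr0_conv_Suc)
    then show ?thesis unfolding b_def by (metis image_image)
  qed
  interpret wiener_shift b \<mu> j r \<delta> u
  proof
    fix i k
    show "inner (b i) (b k) = (if i = k then 1 else 0)"
    proof (cases "i = k")
      case True
      have "b k \<in> e ` {1..}" unfolding range_b[symmetric] by blast
      then have "norm (b k) = 1" using basis(2) unfolding orthonormal_basis_def by blast
      then show ?thesis using True by (simp add: norm_eq_1)
    next
      case False
      then have "b i \<noteq> b k" using basis(1) by (auto simp: b_def inj_on_def)
      moreover have "b i \<in> e ` {1..}" "b k \<in> e ` {1..}" unfolding range_b[symmetric] by blast+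
      ultimately have "orthogonal (b i) (b k)"
        using basis(2) unfolding orthonormal_basis_def pairwise_def by blast
      then show ?thesis using False by (simp add: orthogonal_def)
    qed
  next
    show "closure (span (range b)) = UNIV"
      unfolding range_b using basis(2) by (simp add: orthonormal_basis_def)
    show "0 < r" "r < 1" using alpha by (simp_all add: r_def powr_less_one)
    show "u w = (\<Sum>i. (r ^ Suc i * \<delta> (b (Suc i)) w) *\<^sub>R b i)" for w
    proof -
      have "2 powr (- (real (Suc i) * \<alpha>)) = r ^ Suc i" for i
      proof -
        have "r ^ Suc i = r powr real (Suc i)" by (rule powr_realpow[symmetric]) (simp add: r_def)
        also have "\<dots> = 2 powr (- (real (Suc i) * \<alpha>))" by (simp only: r_def powr_powr) (simp add: mult.commute)
        finally show ?thesis by simp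
      qed
      then show ?thesis unfolding u b_def by (simp del: power_Suc)
    qed
  qed (fact wiener delta)+
  have "u \<in> sobolev_D21 \<mu> j" unfolding sobolev_D21_def using malliavin_gradient_u by blast
  \<comment> \<open>\<open>u\<close> itself also refutes the universal claim in the last
    conjunct.\<close>
  then show ?thesis using quasinilpotent_gradient_u not_adapted by blast
qed

end
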